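(* Let $d\ge2$, $0<\alpha<d$, $q>\frac{2d}{d+\alpha}$. If $V\in\mathring{H}^{\alpha/2}(\mathbb{R}^d)\cap C_b(\mathbb{R}^d)$, then the unique minimizer $\rho_V$ of $\mathcal{E}$ over $\mathcal{H}_\alpha$ belongs to $C(\mathbb{R}^d)$.
   Context: $C_b$ denotes bounded continuous functions. Fourier transform $\hat u(\xi)=\int e^{-2\pi ix\cdot\xi}u(x)dx$. $\mathring{H}^{\alpha/2}(\mathbb{R}^d)$: completion of $C_c^\infty$ under $\int(2\pi|\xi|)^\alpha|\hat u|^2d\xi$. $\mathring{H}^{-\alpha/2}(\mathbb{R}^d)$: tempered distributions $\rho$ with $\hat\rho\in L^1_{loc}$ and $\|\rho\|^2_{\mathring{H}^{-\alpha/2}}=\int(2\pi|\xi|)^{-\alpha}|\hat\rho|^2d\xi<\infty$, identified with the dual of $\mathring{H}^{\alpha/2}$ (duality $\langle\cdot,\cdot\rangle$). $\mathcal{H}_\alpha=L^q\cap\mathring{H}^{-\alpha/2}$. For $V\in\mathring{H}^{\alpha/2}$, $\mathcal{E}(\rho)=\frac1q\int|\rho|^q-\langle\rho,V\rangle+\frac12\|\rho\|^2_{\mathring{H}^{-\alpha/2}}$ on $\mathcal{H}_\alpha$; it has a unique minimizer $\rho_V$. *)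

theory Defs
  imports "HOL-Analysis.Analysis"
begin

fun dder :: "('a::real_normed_vector \<Rightarrow> real) \<Rightarrow> 'a list \<Rightarrow> 'a \<Rightarrow> real" where
  "dder f [] = f"
| "dder f (v # vs) = (\<lambda>x. frechet_derivative (dder f vs) (at x) v)"

definition smooth_fn :: "('a::real_normed_vector \<Rightarrow> real) \<Rightarrow> bool" where
  "smooth_fn f \<longleftrightarrow> (\<forall>vs x. dder f vs differentiable (at x))"

definition test_fn :: "('a::euclidean_space \<Rightarrow> real) \<Rightarrow> bool" where
  "test_fn \<phi> \<longleftrightarrow> smooth_fn \<phi> \<and> compact (closure {x. \<phi> x \<noteq> 0})"

definition fourier :: "('a::euclidean_space \<Rightarrow> complex) \<Rightarrow> 'a \<Rightarrow> complex" where
  "fourier u \<xi> = (LINT x|lborel. cis (- 2 * pi * (x \<bullet> \<xi>)) * u x)"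

definition loc_integrable :: "('a::euclidean_space \<Rightarrow> complex) \<Rightarrow> bool" where
  "loc_integrable g \<longleftrightarrow> g \<in> borel_measurable lborel \<and>
     (\<forall>K. compact K \<longrightarrow> set_integrable lborel K g)"

definition is_dist_FT :: "('a::euclidean_space \<Rightarrow> real) \<Rightarrow> ('a \<Rightarrow> complex) \<Rightarrow> bool" where
  "is_dist_FT u g \<longleftrightarrow> loc_integrable g \<and>
     (\<forall>\<phi>. test_fn \<phi> \<longrightarrow>
        (LINT x|lborel. complex_of_real (u x) * fourier (\<lambda>y. complex_of_real (\<phi> y)) x)
        = (LINT \<xi>|lborel. g \<xi> * complex_of_real (\<phi> \<xi>)))"

definition dist_FT :: "('a::euclidean_space \<Rightarrow> real) \<Rightarrow> 'a \<Rightarrow> complex" where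
  "dist_FT u = (SOME g. is_dist_FT u g)"

definition fweight :: "real \<Rightarrow> 'a::euclidean_space \<Rightarrow> real" where
  "fweight s \<xi> = (2 * pi * norm \<xi>) powr s"

text \<open>Lebesgue space L^q (as measurable functions, modulo a.e. equality implicitly).\<close>
definition Lq :: "real \<Rightarrow> ('a::euclidean_space \<Rightarrow> real) set" where
  "Lq q = {\<rho>. \<rho> \<in> borel_measurable lborel \<and> integrable lborel (\<lambda>x. \<bar>\<rho> x\<bar> powr q)}"

definition Hneg :: "real \<Rightarrow> ('a::euclidean_space \<Rightarrow> real) set" where
  "Hneg \<alpha> = {\<rho>. \<rho> \<in> borel_measurable lborel \<and>
     (\<exists>g. is_dist_FT \<rho> g \<and> integrable lborel (\<lambda>\<xi>. fweight (- \<alpha>) \<xi> * (cmod (g \<xi>))\<^sup>2))}"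

definition Hneg_norm_sq :: "real \<Rightarrow> ('a::euclidean_space \<Rightarrow> real) \<Rightarrow> real" where
  "Hneg_norm_sq \<alpha> \<rho> = (LINT \<xi>|lborel. fweight (- \<alpha>) \<xi> * (cmod (dist_FT \<rho> \<xi>))\<^sup>2)"

text \<open>Homogeneous Sobolev space H^{alpha/2}: completion of C_c^infinity under
  int (2 pi |xi|)^alpha |hat u|^2; a function V is identified with an element of the
  completion when its (distributional) Fourier transform is the limit in the weighted L^2
  space of Fourier transforms of test functions.\<close>
definition Hpos :: "real \<Rightarrow> ('a::euclidean_space \<Rightarrow> real) set" where
  "Hpos \<alpha> = {V. V \<in> borel_measurable lborel \<and>
     (\<exists>g. is_dist_FT V g \<and>
        (\<exists>\<phi>s. (\<forall>n. test_fn (\<phi>s n)) \<and>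
           (\<lambda>n. \<integral>\<^sup>+\<xi>. ennreal (fweight \<alpha> \<xi> *
               (cmod (fourier (\<lambda>y. complex_of_real (\<phi>s n y)) \<xi> - g \<xi>))\<^sup>2) \<partial>lborel)
           \<longlonglongrightarrow> 0))}"

text \<open>Duality pairing of H^{-alpha/2} with H^{alpha/2} (Parseval form).\<close>
definition pairing :: "('a::euclidean_space \<Rightarrow> real) \<Rightarrow> ('a \<Rightarrow> real) \<Rightarrow> real" where
  "pairing \<rho> V = Re (LINT \<xi>|lborel. dist_FT \<rho> \<xi> * cnj (dist_FT V \<xi>))"

definition H_alpha :: "real \<Rightarrow> real \<Rightarrow> ('a::euclidean_space \<Rightarrow> real) set" where
  "H_alpha q \<alpha> = Lq q \<inter> Hneg \<alpha>"

definition energy :: "real \<Rightarrow> real \<Rightarrow> ('a::euclidean_space \<Rightarrow> real) \<Rightarrow> ('a \<Rightarrow> real) \<Rightarrow> real" where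
  "energy q \<alpha> V \<rho> = (1 / q) * (LINT x|lborel. \<bar>\<rho> x\<bar> powr q) - pairing \<rho> V
      + (1 / 2) * Hneg_norm_sq \<alpha> \<rho>"

definition is_minimizer :: "real \<Rightarrow> real \<Rightarrow> ('a::euclidean_space \<Rightarrow> real) \<Rightarrow> ('a \<Rightarrow> real) \<Rightarrow> bool" where
  "is_minimizer q \<alpha> V \<rho> \<longleftrightarrow> \<rho> \<in> H_alpha q \<alpha> \<and>
     (\<forall>\<sigma> \<in> H_alpha q \<alpha>. energy q \<alpha> V \<rho> \<le> energy q \<alpha> V \<sigma>)"

definition Cb :: "('a::topological_space \<Rightarrow> real) set" where
  "Cb = {V. continuous_on UNIV V \<and> bounded (range V)}"

end

theory Submission
  imports Defs "HOL-Probability.Probability"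
begin

text \<open>
  Perturbing the minimizer by translated Gaussians turns the Euler--Lagrange equation
  \<open>|\<rho>|\<^sup>q\<^sup>-\<^sup>1 sgn \<rho> + (-\<Delta>)\<^sup>-\<^sup>\<alpha>\<^sup>/\<^sup>2 \<rho> = V\<close> into an identity between heat-semigroup
  averages, so that no duality theory is needed. Writing the Riesz weight as
  \<open>|2\<pi>\<xi>|\<^sup>-\<^sup>\<alpha> = c \<integral> t\<^sup>\<alpha>\<^sup>/\<^sup>2\<^sup>-\<^sup>1 exp (-\<pi> t |\<xi>|\<^sup>2) dt\<close> and cutting at \<open>t = 1\<close>, the large times contribute
  the Fourier transform of an integrable function, hence a bounded continuous function, and the
  small times contribute \<open>K \<rho> = c \<integral>\<^sub>0\<^sup>1 t\<^sup>\<alpha>\<^sup>/\<^sup>2\<^sup>-\<^sup>1 P\<^sub>t \<rho> dt\<close> with the heat semigroup \<open>P\<^sub>t\<close>. Thus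
  \<open>|\<rho>|\<^sup>q\<^sup>-\<^sup>1 \<le> M + K |\<rho>|\<close>. The operator \<open>K\<close> improves integrability, and for \<open>q > 2d/(d+\<alpha>)\<close> the gain beats the
  loss from the power \<open>q - 1\<close>: the exponent of integrability of \<open>\<rho>\<close> grows geometrically until it
  exceeds \<open>d/\<alpha>\<close>. From then on \<open>K \<rho>\<close> is continuous, and so is \<open>\<rho>\<close>.
\<close>

section \<open>Smooth functions and test functions\<close>

text \<open>The cut at \<open>t = 1\<close> keeps the argument inside L^1 + L^infinity. Integrated
  over all times, the heat averages of a constant diverge, while the times in (0,1) carry finite
  total weight. This class contains \<open>\<rho>\<close>, its signed power \<open>q - 1\<close> and
  \<open>V\<close>, is stable under averaging, and pairs with the Fourier transforms of test
  functions, through which the distributional transform is defined.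

  Gaussians are not test functions, but their transforms are explicit and lie in both weighted L^2
  spaces: decay handles the weight with exponent \<alpha>, and \<alpha> < d handles the singular
  one. The price is a limiting argument that identifies their pairing with \<open>V\<close>.

  The threshold on q comes from exponents. Small times take L^p to L^r if 1/r > 1/p - \<alpha>/d,
  and the equation turns L^r for K|\<rho>| into the exponent (q - 1) r for \<rho>. From p = q, with
  \<alpha> q < d, this is an improvement for some such r exactly if q - 1 > 1 - \<alpha> q/d, that
  is q > 2d/(d+\<alpha>). For p \<ge> q a ratio r/p admissible at p = q stays admissible, so one
  ratio serves all steps.\<close>

definition flat_fn :: "nat \<Rightarrow> real \<Rightarrow> real" where
  "flat_fn k s = (if s > 0 then exp (- 1 / s) / s ^ k else 0)"

lemma power_le_fact_exp: "0 \<le> (x::real) \<Longrightarrow> x ^ n \<le> fact n * exp x"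
proof -
  assume x: "0 \<le> x"
  have "(\<Sum>k\<in>{n}. x ^ k /\<^sub>R fact k) \<le> (\<Sum>k. x ^ k /\<^sub>R fact k)"
    by (rule sum_le_suminf) (use exp_converges[of x] x in \<open>auto simp: sums_iff\<close>)
  also have "\<dots> = exp x" using exp_converges[of x] by (simp add: sums_iff)
  finally show ?thesis by (simp add: field_simps)
qed

text \<open>A quadratic bound makes the difference quotient at the origin tend to zero, for every
  \<open>k\<close> at once. It comes from a single term of the exponential series at
  \<open>1 / s\<close>.\<close>

lemma flat_fn_bound: "\<bar>flat_fn k s\<bar> \<le> fact (k + 2) * s\<^sup>2"
proof (cases "s > 0")
  case True
  have "(1/s) ^ (k+2) \<le> fact (k + 2) * exp (1/s)"
    using True by (intro power_le_fact_exp) auto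
  then have "1 \<le> fact (k + 2) * exp (1/s) * s ^ (k+2)"
    using True by (simp add: power_one_over field_simps del: fact_Suc)
  then have "exp (- 1 / s) \<le> fact (k + 2) * s ^ (k+2)"
    using True by (simp add: exp_minus field_simps power2_eq_square del: fact_Suc)
  then have "exp (- 1 / s) / s ^ k \<le> fact (k + 2) * s ^ (k+2) / s ^ k"
    using True by (intro divide_right_mono) auto
  also have "\<dots> = fact (k + 2) * s\<^sup>2" using True by (simp add: power_add power2_eq_square)
  finally show ?thesis using True unfolding flat_fn_def by simp
qed (simp add: flat_fn_def)

text \<open>This is the purpose of the powers of \<open>1 / s\<close> in \<open>flat_fn\<close>: the
  span of the family is closed under differentiation, so smoothness becomes a closure property and
  no formula for higher derivatives is required.\<close>

lemma flat_fn_has_derivative: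
  "(flat_fn k has_real_derivative flat_fn (k+2) s - real k * flat_fn (k+1) s) (at s)"
proof -
  consider "s > 0" | "s < 0" | "s = 0" by linarith
  then show ?thesis
  proof cases
    case 1
    have "((\<lambda>s. exp (- inverse s) * inverse s ^ k) has_real_derivative
        (exp (- inverse s) * inverse s ^ 2) * inverse s ^ k +
        exp (- inverse s) * (real k * inverse s ^ (k - 1) * - (inverse s ^ 2))) (at s)"
      using 1 by (auto intro!: derivative_eq_intros simp: power2_eq_square)
    also have "(exp (- inverse s) * inverse s ^ 2) * inverse s ^ k +
        exp (- inverse s) * (real k * inverse s ^ (k - 1) * - (inverse s ^ 2)) =
        flat_fn (k+2) s - real k * flat_fn (k+1) s"
      using 1 by (cases k) (simp_all add: flat_fn_def power_inverse power_add divide_inverse power2_eq_square algebra_simps)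
    finally have "((\<lambda>s. exp (- inverse s) * inverse s ^ k) has_real_derivative
        flat_fn (k+2) s - real k * flat_fn (k+1) s) (at s)" .
    then show ?thesis
      by (rule has_field_derivative_transform_within_open[of _ _ _ "{0<..}"])
         (use 1 in \<open>auto simp: flat_fn_def divide_inverse power_inverse\<close>)
  next
    case 2
    have "((\<lambda>s::real. 0) has_real_derivative
        flat_fn (k+2) s - real k * flat_fn (k+1) s) (at s)"
      using 2 by (auto simp: flat_fn_def)
    then show ?thesis
      by (rule has_field_derivative_transform_within_open[of _ _ _ "{..<0}"])
         (use 2 in \<open>auto simp: flat_fn_def\<close>)
  next
    case 3
    have "(\<lambda>h. (flat_fn k h - flat_fn k 0) / (h - 0)) \<midarrow>0\<rightarrow> 0"
    proof (rule Lim_null_comparison)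
      have "norm ((flat_fn k h - flat_fn k 0) / (h - 0)) \<le> fact (k+2) * \<bar>h\<bar>" if "h \<noteq> 0" for h
      proof -
        have "\<bar>flat_fn k h\<bar> / \<bar>h\<bar> \<le> fact (k+2) * h\<^sup>2 / \<bar>h\<bar>"
          by (intro divide_right_mono flat_fn_bound) auto
        also have "\<dots> = fact (k+2) * \<bar>h\<bar>"
          using that by (simp add: power2_eq_square abs_if del: fact_Suc)
        finally show ?thesis by (simp add: flat_fn_def[of k 0] abs_divide del: fact_Suc)
      qed
      then show "\<forall>\<^sub>F h in at 0. norm ((flat_fn k h - flat_fn k 0) / (h - 0)) \<le> fact (k+2) * \<bar>h\<bar>"
        by (auto simp: eventually_at_filter simp del: fact_Suc)
      show "(\<lambda>h::real. fact (k+2) * \<bar>h\<bar>) \<midarrow>0\<rightarrow> 0"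
        by (intro tendsto_mult_right_zero tendsto_rabs_zero tendsto_ident_at)
    qed
    then show ?thesis using 3 by (simp add: has_field_derivative_iff flat_fn_def)
  qed
qed

text \<open>Being closed under directional derivatives, this set consists of smooth functions; it contains
  enough bump functions and plane waves for all the test functions needed here.\<close>

inductive_set smooth_alg :: "('a::euclidean_space \<Rightarrow> real) set" where
  const: "(\<lambda>x. c) \<in> smooth_alg"
| flat_fn: "(\<lambda>x. flat_fn k (x \<bullet> a + c)) \<in> smooth_alg"
| sin: "(\<lambda>x. sin (x \<bullet> a + c)) \<in> smooth_alg"
| add: "f \<in> smooth_alg \<Longrightarrow> g \<in> smooth_alg \<Longrightarrow> (\<lambda>x. f x + g x) \<in> smooth_alg"
| mult: "f \<in> smooth_alg \<Longrightarrow> g \<in> smooth_alg \<Longrightarrow> (\<lambda>x. f x * g x) \<in> smooth_alg"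

lemma smooth_alg_cos: "(\<lambda>x. cos (x \<bullet> a + c)) \<in> smooth_alg"
proof -
  have "(\<lambda>x. cos (x \<bullet> a + c)) = (\<lambda>x. sin (x \<bullet> a + (c + pi/2)))"
    by (simp only: add.assoc[symmetric] sin_add) simp
  then show ?thesis by (simp add: smooth_alg.sin)
qed

lemma smooth_alg_prod:
  "finite A \<Longrightarrow> (\<And>i. i \<in> A \<Longrightarrow> f i \<in> smooth_alg) \<Longrightarrow> (\<lambda>x. \<Prod>i\<in>A. f i x) \<in> smooth_alg"
  by (induction A rule: finite_induct) (auto intro: smooth_alg.intros)

lemma smooth_alg_derivative:
  assumes "f \<in> smooth_alg"
  shows "\<exists>D. (\<forall>x. (f has_derivative D x) (at x)) \<and> (\<forall>v. (\<lambda>x. D x v) \<in> smooth_alg)"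
  using assms
proof induction
  case (const c)
  show ?case by (rule exI[of _ "\<lambda>_ _. 0"]) (auto intro: smooth_alg.const)
next
  case (flat_fn k a c)
  let ?D = "\<lambda>s. flat_fn (k+2) s + (- real k) * flat_fn (k+1) s"
  have "((\<lambda>x. flat_fn k (x \<bullet> a + c)) has_derivative (\<lambda>v. ?D (x \<bullet> a + c) * (v \<bullet> a))) (at x)" for x
    using flat_fn_has_derivative[of k "x \<bullet> a + c"]
    by (intro has_derivative_compose[of "\<lambda>x. x \<bullet> a + c" "\<lambda>v. v \<bullet> a" _ UNIV "flat_fn k"])
       (auto simp: has_field_derivative_def intro!: derivative_eq_intros)
  then show ?case
    by (intro exI[of _ "\<lambda>x v. ?D (x \<bullet> a + c) * (v \<bullet> a)"])
       (intro conjI allI smooth_alg.intros, assumption)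
next
  case (sin a c)
  have "((\<lambda>x. sin (x \<bullet> a + c)) has_derivative (\<lambda>v. cos (x \<bullet> a + c) * (v \<bullet> a))) (at x)" for x
    by (auto intro!: derivative_eq_intros)
  then show ?case
    by (intro exI[of _ "\<lambda>x v. cos (x \<bullet> a + c) * (v \<bullet> a)"])
       (intro conjI allI smooth_alg.mult smooth_alg.const smooth_alg_cos, assumption)
next
  case (add f g)
  then obtain D E where DE: "\<forall>x. (f has_derivative D x) (at x)" "\<forall>v. (\<lambda>x. D x v) \<in> smooth_alg"
    "\<forall>x. (g has_derivative E x) (at x)" "\<forall>v. (\<lambda>x. E x v) \<in> smooth_alg" by blast
  show ?case
    by (intro exI[of _ "\<lambda>x v. D x v + E x v"])
       (use DE in \<open>intro conjI allI smooth_alg.add has_derivative_add; blast\<close>)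
next
  case (mult f g)
  then obtain D E where DE: "\<forall>x. (f has_derivative D x) (at x)" "\<forall>v. (\<lambda>x. D x v) \<in> smooth_alg"
    "\<forall>x. (g has_derivative E x) (at x)" "\<forall>v. (\<lambda>x. E x v) \<in> smooth_alg" by blast
  show ?case
    by (intro exI[of _ "\<lambda>x v. f x * E x v + D x v * g x"])
       (use DE mult in \<open>intro conjI allI smooth_alg.add smooth_alg.mult has_derivative_mult; blast\<close>)
qed

lemma smooth_alg_smooth_fn:
  assumes "f \<in> smooth_alg" shows "smooth_fn f"
proof -
  have "dder f vs \<in> smooth_alg" for vs
  proof (induction vs)
    case (Cons v vs)
    from smooth_alg_derivative[OF Cons] obtain D where D:
      "\<forall>x. (dder f vs has_derivative D x) (at x)" "\<forall>v. (\<lambda>x. D x v) \<in> smooth_alg" by blast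
    then have "frechet_derivative (dder f vs) (at x) = D x" for x
      using frechet_derivative_at by metis
    with D show ?case by simp
  qed (use assms in simp)
  with smooth_alg_derivative show ?thesis
    unfolding smooth_fn_def differentiable_def by blast
qed

lemma test_fnD:
  assumes "test_fn f"
  shows test_fn_has_derivative: "(f has_derivative frechet_derivative f (at x)) (at x)"
    and test_fn_continuous: "continuous_on UNIV f"
    and test_fn_compact: "compact (closure {x. f x \<noteq> 0})"
proof -
  have "f differentiable (at x)" for x
    using assms unfolding test_fn_def smooth_fn_def by (metis dder.simps(1))
  then show "(f has_derivative frechet_derivative f (at x)) (at x)" "continuous_on UNIV f"
    by (auto simp: frechet_derivative_works[symmetric] continuous_on_eq_continuous_at
        differentiable_imp_continuous_within)
  show "compact (closure {x. f x \<noteq> 0})" using assms unfolding test_fn_def by blast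
qed

lemma test_fn_measurable: "test_fn f \<Longrightarrow> f \<in> borel_measurable borel"
  using test_fn_continuous borel_measurable_continuous_onI by blast

lemma test_fn_support:
  assumes "test_fn f"
  obtains B where "B > 0" "\<And>x. f x \<noteq> 0 \<Longrightarrow> norm x \<le> B"
proof -
  have "bounded {x. f x \<noteq> 0}"
    using test_fn_compact[OF assms] compact_imp_bounded bounded_subset closure_subset by metis
  then show ?thesis using that unfolding bounded_pos by auto
qed

lemma test_fn_bounded:
  assumes "test_fn f"
  obtains M where "M > 0" "\<And>x. \<bar>f x\<bar> \<le> M"
proof -
  have "bounded (f ` closure {x. f x \<noteq> 0})"
    using test_fnD(2,3)[OF assms] by (meson compact_continuous_image compact_imp_bounded continuous_on_subset top_greatest)
  then obtain M where M: "M > 0" "\<And>x. x \<in> closure {x. f x \<noteq> 0} \<Longrightarrow> \<bar>f x\<bar> \<le> M"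
    unfolding bounded_pos by auto
  have "\<bar>f x\<bar> \<le> M" for x
    using M(2)[of x] M(1) closure_subset[of "{x. f x \<noteq> 0}"] by (cases "f x = 0") auto
  with M(1) show ?thesis using that by blast
qed

lemma dder_append: "dder (dder f us) vs = dder f (vs @ us)"
  by (induction vs) auto

lemma test_fn_frechet:
  assumes "test_fn f"
  shows "test_fn (\<lambda>x. frechet_derivative f (at x) v)"
proof -
  have "smooth_fn (dder f [v])"
    using assms unfolding test_fn_def smooth_fn_def dder_append by blast
  \<comment> \<open>Off the closed support \<open>f\<close> is locally zero, so its derivative
    vanishes there and the support cannot grow.\<close>
  moreover have "{x. frechet_derivative f (at x) v \<noteq> 0} \<subseteq> closure {x. f x \<noteq> 0}"
  proof (rule subsetI, rule ccontr)
    fix x assume x: "x \<in> {x. frechet_derivative f (at x) v \<noteq> 0}" "x \<notin> closure {x. f x \<noteq> 0}"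
    have "(f has_derivative (\<lambda>_. 0)) (at x)"
    proof (rule has_derivative_transform_within_open)
      show "((\<lambda>x. 0) has_derivative (\<lambda>_. 0)) (at x)" by simp
      show "open (- closure {x. f x \<noteq> 0})" by (rule open_Compl[OF closed_closure])
      show "x \<in> - closure {x. f x \<noteq> 0}" using x by simp
      show "0 = f y" if "y \<in> - closure {x. f x \<noteq> 0}" for y
        using that closure_subset[of "{x. f x \<noteq> 0}"] by auto
    qed
    then have "frechet_derivative f (at x) = (\<lambda>_. 0)" using frechet_derivative_at by metis
    with x show False by simp
  qed
  then have "closure {x. frechet_derivative f (at x) v \<noteq> 0} \<subseteq> closure {x. f x \<noteq> 0}"
    by (simp add: closure_minimal)
  then have "compact (closure {x. frechet_derivative f (at x) v \<noteq> 0})"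
    using test_fn_compact[OF assms] 
    by (metis compact_Int_closed closed_closure inf.absorb_iff2 inf_commute)
  ultimately show ?thesis unfolding test_fn_def by simp
qed

lemma integrable_bounded_support:
  fixes f :: "'a::euclidean_space \<Rightarrow> 'b::{banach,second_countable_topology}"
  assumes "f \<in> borel_measurable borel" "\<And>x. norm (f x) \<le> M" "\<And>x. f x \<noteq> 0 \<Longrightarrow> norm x \<le> B"
  shows "integrable lborel f"
proof (rule Bochner_Integration.integrable_bound)
  show "integrable lborel (\<lambda>x::'a. M * indicator (cball 0 B) x)"
    by (intro integrable_mult_right integrable_real_indicator emeasure_bounded_finite) auto
  show "AE x in lborel. norm (f x) \<le> norm (M * indicator (cball 0 B) x)"
  proof (rule AE_I2)
    fix x show "norm (f x) \<le> norm (M * indicator (cball 0 B) x)"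
      using assms(2)[of x] assms(3)[of x] by (cases "f x = 0") (auto simp: indicator_def abs_if)
  qed
qed (use assms in simp)

lemma test_fn_integrable:
  assumes "test_fn f" shows "integrable lborel f"
proof -
  obtain B where B: "\<And>x. f x \<noteq> 0 \<Longrightarrow> norm x \<le> B" using test_fn_support[OF assms] by blast
  obtain M where "\<And>x. \<bar>f x\<bar> \<le> M" using test_fn_bounded[OF assms] by blast
  then have "norm (f x) \<le> M" for x by simp
  then show ?thesis by (rule integrable_bounded_support[OF test_fn_measurable[OF assms] _ B])
qed

section \<open>Fourier transforms of test functions\<close>

lemma
  fixes f :: "'a::euclidean_space \<Rightarrow> 'b::{banach,second_countable_topology}"
  assumes [measurable]: "f \<in> borel_measurable borel" and c: "c \<noteq> 0"
  shows lborel_integral_affine: "(LINT x|lborel. f x) = \<bar>c\<bar> ^ DIM('a) *\<^sub>R (LINT x|lborel. f (t + c *\<^sub>R x))"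
    and lborel_integrable_affine: "integrable lborel f \<longleftrightarrow> integrable lborel (\<lambda>x. f (t + c *\<^sub>R x))"
proof -
  have "(LINT x|lborel. f x) = (LINT x|density (distr lborel borel (\<lambda>x. t + c *\<^sub>R x)) (\<lambda>_. ennreal (\<bar>c\<bar>^DIM('a))). f x)"
    using lborel_affine[OF c, of t] by (simp add: ennreal_power)
  then show "(LINT x|lborel. f x) = \<bar>c\<bar> ^ DIM('a) *\<^sub>R (LINT x|lborel. f (t + c *\<^sub>R x))"
    by (simp add: integral_density integral_distr)
  have "integrable lborel f \<longleftrightarrow> integrable (density (distr lborel borel (\<lambda>x. t + c *\<^sub>R x)) (\<lambda>_. ennreal (\<bar>c\<bar>^DIM('a)))) f"
    using lborel_affine[OF c, of t] by (simp add: ennreal_power)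
  then show "integrable lborel f \<longleftrightarrow> integrable lborel (\<lambda>x. f (t + c *\<^sub>R x))"
    using c integrable_scaleR_right[of "\<bar>c\<bar> ^ DIM('a)" lborel "\<lambda>x. f (t + c *\<^sub>R x)"]
      integrable_scaleR_right[of "inverse (\<bar>c\<bar> ^ DIM('a))" lborel "\<lambda>x. \<bar>c\<bar> ^ DIM('a) *\<^sub>R f (t + c *\<^sub>R x)"]
    by (auto simp: integrable_density integrable_distr_eq)
qed

lemma borel_measurable_cis[measurable (raw)]:
  "h \<in> borel_measurable M \<Longrightarrow> (\<lambda>x. cis (h x)) \<in> borel_measurable M"
  by (rule measurable_compose[where g=cis]) (auto intro!: borel_measurable_continuous_onI continuous_intros)

lemma
  fixes f :: "'a::euclidean_space \<Rightarrow> 'b::{banach,second_countable_topology}"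
  assumes "f \<in> borel_measurable borel"
  shows lborel_integral_shift: "(LINT x|lborel. f (x + a)) = (LINT x|lborel. f x)"
    and lborel_integral_reflect: "(LINT x|lborel. f (a - x)) = (LINT x|lborel. f x)"
    and lborel_integrable_shift: "integrable lborel (\<lambda>x. f (x + a)) \<longleftrightarrow> integrable lborel f"
    and lborel_integrable_reflect: "integrable lborel (\<lambda>x. f (a - x)) \<longleftrightarrow> integrable lborel f"
  using lborel_integral_affine[OF assms, of 1 a] lborel_integral_affine[OF assms, of "-1" a]
    lborel_integrable_affine[OF assms, of 1 a] lborel_integrable_affine[OF assms, of "-1" a]
  by (simp_all add: add.commute)

lemma integrable_cis_mult:
  fixes f :: "'a::euclidean_space \<Rightarrow> complex"
  assumes "integrable lborel f" "h \<in> borel_measurable borel"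
  shows "integrable lborel (\<lambda>x. cis (h x) * f x)"
proof (rule Bochner_Integration.integrable_bound[OF assms(1)])
  show "(\<lambda>x. cis (h x) * f x) \<in> borel_measurable lborel"
    using assms by auto
qed (simp add: norm_mult)

lemma continuous_fourier_integral:
  fixes f :: "'a::euclidean_space \<Rightarrow> complex"
  assumes f: "integrable lborel f"
  shows "continuous_on UNIV (\<lambda>\<xi>. LINT x|lborel. cis (c * (x \<bullet> \<xi>)) * f x)"
proof (rule continuous_on_sequentiallyI)
  fix u :: "nat \<Rightarrow> 'a" and a assume "u \<longlonglongrightarrow> a"
  then show "(\<lambda>n. LINT x|lborel. cis (c * (x \<bullet> u n)) * f x) \<longlonglongrightarrow> (LINT x|lborel. cis (c * (x \<bullet> a)) * f x)"
    using f by (intro integral_dominated_convergence[where w="\<lambda>x. norm (f x)"])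
      (auto intro!: borel_measurable_times tendsto_intros simp: norm_mult dest: borel_measurable_integrable)
qed

lemma fourier_continuous:
  "integrable lborel f \<Longrightarrow> continuous_on UNIV (fourier f)"
  using continuous_fourier_integral[of f "- 2 * pi"] unfolding fourier_def[abs_def] by simp

lemma fourier_norm_le:
  "cmod (fourier f \<xi>) \<le> (LINT x|lborel. cmod (f x))"
  unfolding fourier_def by (rule order_trans[OF integral_norm_bound]) (simp add: norm_mult)

lemma cis_difference_quotient:
  assumes "t \<longlonglongrightarrow> 0" "\<And>n. t n \<noteq> (0::real)"
  shows "(\<lambda>n. (cis (c * t n) - 1) / complex_of_real (t n)) \<longlonglongrightarrow> \<i> * complex_of_real c"
proof -
  have "((\<lambda>h. exp (\<i> * complex_of_real c * h)) has_field_derivative \<i> * complex_of_real c) (at 0)"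
    by (auto intro!: derivative_eq_intros)
  then have "(\<lambda>h. (exp (\<i> * complex_of_real c * h) - 1) / h) \<midarrow>0\<rightarrow> \<i> * complex_of_real c"
    by (simp add: has_field_derivative_iff)
  moreover have "filterlim (\<lambda>n. complex_of_real (t n)) (at 0) sequentially"
    using assms by (auto simp: filterlim_at intro!: tendsto_eq_intros)
  ultimately have "(\<lambda>n. (exp (\<i> * complex_of_real c * complex_of_real (t n)) - 1) / complex_of_real (t n)) \<longlonglongrightarrow> \<i> * complex_of_real c"
    by (rule filterlim_compose)
  then show ?thesis by (simp add: cis_conv_exp mult.assoc)
qed

text \<open>Translation invariance is applied to the difference quotient, which replaces the integration
  by parts.\<close>

lemma fourier_frechet:
  fixes f :: "'a::euclidean_space \<Rightarrow> real"
  assumes f: "test_fn f"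
  shows "fourier (\<lambda>x. complex_of_real (frechet_derivative f (at x) v)) \<xi>
    = 2 * pi * \<i> * (v \<bullet> \<xi>) * fourier (\<lambda>x. complex_of_real (f x)) \<xi>"
proof -
  define t where "t n = 1 / real (Suc n)" for n
  have t: "t \<longlonglongrightarrow> 0" "\<And>n. t n \<noteq> 0" "\<And>n. 0 < t n" "\<And>n. t n \<le> 1"
    unfolding t_def using LIMSEQ_inverse_real_of_nat by (auto simp: inverse_eq_divide)
  define D where "D n x = (f (x + t n *\<^sub>R v) - f x) / t n" for n x
  let ?f' = "\<lambda>x. frechet_derivative f (at x) v"
  obtain L where L: "L > 0" "\<And>x. \<bar>?f' x\<bar> \<le> L" using test_fn_bounded[OF test_fn_frechet[OF f]] by metis
  obtain B where B: "B > 0" "\<And>x. f x \<noteq> 0 \<Longrightarrow> norm x \<le> B" using test_fn_support[OF f] by metis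
  have line: "((\<lambda>s. f (x + s *\<^sub>R v)) has_real_derivative ?f' (x + s *\<^sub>R v)) (at s)" for x s
  proof -
    have "((\<lambda>s. f (x + s *\<^sub>R v)) has_derivative (\<lambda>h. frechet_derivative f (at (x + s *\<^sub>R v)) (h *\<^sub>R v))) (at s)"
      by (rule has_derivative_compose[of "\<lambda>s. x + s *\<^sub>R v" "\<lambda>h. h *\<^sub>R v" _ UNIV f])
         (auto intro!: derivative_eq_intros test_fn_has_derivative[OF f])
    moreover have "frechet_derivative f (at (x + s *\<^sub>R v)) (h *\<^sub>R v) = ?f' (x + s *\<^sub>R v) * h" for h
      using test_fn_has_derivative[OF f, of "x + s *\<^sub>R v"]
      by (simp add: has_derivative_bounded_linear linear_cmul bounded_linear.linear)
    ultimately show ?thesis unfolding has_field_derivative_def by simp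
  qed
  have D_lim: "(\<lambda>n. D n x) \<longlonglongrightarrow> ?f' x" for x
  proof -
    have "(\<lambda>h. (f (x + h *\<^sub>R v) - f x) / h) \<midarrow>0\<rightarrow> ?f' x"
      using line[of x 0] by (simp add: has_field_derivative_iff)
    moreover have "filterlim t (at 0) sequentially" using t by (auto simp: filterlim_at)
    ultimately show ?thesis unfolding D_def by (rule filterlim_compose)
  qed
  \<comment> \<open>One majorant for all quotients: the mean value theorem inside the ball, and
    \<open>t n \<le> 1\<close> outside, where a step of length at most \<open>norm v\<close> cannot
    reach the support.\<close>
  have D_bd: "\<bar>D n x\<bar> \<le> L * indicator (cball 0 (B + norm v)) x" for n x
  proof (cases "norm x \<le> B + norm v")
    case True
    obtain z where "f (x + t n *\<^sub>R v) - f (x + 0 *\<^sub>R v) = (t n - 0) * ?f' (x + z *\<^sub>R v)"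
      using MVT2[OF t(3)[of n], of "\<lambda>s. f (x + s *\<^sub>R v)" "\<lambda>s. ?f' (x + s *\<^sub>R v)"] line by blast
    then have "D n x = ?f' (x + z *\<^sub>R v)" using t(2) unfolding D_def by (simp add: field_simps)
    with L True show ?thesis by simp
  next
    case False
    then have "f x = 0" using B(2)[of x] norm_ge_zero[of v] by linarith
    moreover have "norm x \<le> norm (x + t n *\<^sub>R v) + norm (t n *\<^sub>R v)"
      using norm_triangle_ineq4[of "x + t n *\<^sub>R v" "t n *\<^sub>R v"] by simp
    then have "norm (x + t n *\<^sub>R v) > B"
      using False t(3,4)[of n] mult_left_le_one_le[of "norm v" "t n"] by simp
    then have "f (x + t n *\<^sub>R v) = 0" using B(2) by force
    ultimately show ?thesis using L unfolding D_def by simp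
  qed
  note [measurable] = test_fn_measurable[OF f] test_fn_measurable[OF test_fn_frechet[OF f]]
  have intf: "integrable lborel (\<lambda>x. complex_of_real (f x))" using test_fn_integrable[OF f] by simp
  have cm: "(\<lambda>x. cis (- 2 * pi * (x \<bullet> \<xi>))) \<in> borel_measurable borel"
    by (intro borel_measurable_continuous_onI continuous_intros)
  have "(\<lambda>n. LINT x|lborel. cis (- 2 * pi * (x \<bullet> \<xi>)) * complex_of_real (D n x)) \<longlonglongrightarrow>
    (LINT x|lborel. cis (- 2 * pi * (x \<bullet> \<xi>)) * complex_of_real (?f' x))"
  proof (rule integral_dominated_convergence[where w="\<lambda>x. L * indicator (cball 0 (B + norm v)) x"])
    show "integrable lborel (\<lambda>x::'a. L * indicator (cball 0 (B + norm v)) x)"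
      by (intro integrable_mult_right integrable_real_indicator emeasure_bounded_finite) auto
    show "AE x in lborel. (\<lambda>n. cis (- 2 * pi * (x \<bullet> \<xi>)) * complex_of_real (D n x)) \<longlonglongrightarrow>
      cis (- 2 * pi * (x \<bullet> \<xi>)) * complex_of_real (?f' x)"
      by (intro AE_I2 tendsto_intros D_lim)
    show "AE x in lborel. norm (cis (- 2 * pi * (x \<bullet> \<xi>)) * complex_of_real (D n x)) \<le> L * indicator (cball 0 (B + norm v)) x" for n
      by (intro AE_I2) (use D_bd in \<open>simp add: norm_mult\<close>)
  qed (use cm in \<open>auto simp: D_def\<close>)
  moreover have "(LINT x|lborel. cis (- 2 * pi * (x \<bullet> \<xi>)) * complex_of_real (D n x)) =
     (cis (2 * pi * (v \<bullet> \<xi>) * t n) - 1) / t n * fourier (\<lambda>x. complex_of_real (f x)) \<xi>" for n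
  proof -
    \<comment> \<open>The phase is evaluated one step back. Translating \<open>?g\<close> then
      yields the shifted term of the quotient, while \<open>?g\<close> itself is a constant phase
      times the integrand of the transform.\<close>
    let ?g = "\<lambda>x. cis (- 2 * pi * ((x - t n *\<^sub>R v) \<bullet> \<xi>)) * complex_of_real (f x)"
    have g: "?g x = cis (2 * pi * (v \<bullet> \<xi>) * t n) * (cis (- 2 * pi * (x \<bullet> \<xi>)) * complex_of_real (f x))" for x
    proof -
      have "- 2 * pi * ((x - t n *\<^sub>R v) \<bullet> \<xi>) = 2 * pi * (v \<bullet> \<xi>) * t n + (- 2 * pi * (x \<bullet> \<xi>))"
        by (simp add: inner_diff_left right_diff_distrib)
      then show ?thesis by (simp only: mult.assoc[symmetric] cis_mult)
    qed
    have ig: "integrable lborel ?g" unfolding g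
      by (intro integrable_mult_right integrable_cis_mult intf) simp
    have eqg: "?g (x + t n *\<^sub>R v) = cis (- 2 * pi * (x \<bullet> \<xi>)) * complex_of_real (f (x + t n *\<^sub>R v))" for x by simp
    have ig': "integrable lborel (\<lambda>x. ?g (x + t n *\<^sub>R v))"
      using ig by (subst lborel_integrable_shift) auto
    have "(LINT x|lborel. cis (- 2 * pi * (x \<bullet> \<xi>)) * complex_of_real (D n x)) =
       (LINT x|lborel. (?g (x + t n *\<^sub>R v) - cis (- 2 * pi * (x \<bullet> \<xi>)) * complex_of_real (f x)) / complex_of_real (t n))"
      unfolding D_def by (intro Bochner_Integration.integral_cong) (auto simp: field_simps)
    also have "\<dots> = ((LINT x|lborel. ?g (x + t n *\<^sub>R v)) - fourier (\<lambda>x. complex_of_real (f x)) \<xi>) / t n"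
      unfolding fourier_def integral_divide_zero
      by (subst Bochner_Integration.integral_diff[OF ig' integrable_cis_mult[OF intf]]) auto
    also have "(LINT x|lborel. ?g (x + t n *\<^sub>R v)) = (LINT x|lborel. ?g x)"
      using ig by (intro lborel_integral_shift) auto
    also have "\<dots> = cis (2 * pi * (v \<bullet> \<xi>) * t n) * fourier (\<lambda>x. complex_of_real (f x)) \<xi>"
      unfolding g fourier_def by simp
    finally show ?thesis by (simp add: field_simps)
  qed
  moreover have "(\<lambda>n. (cis (2 * pi * (v \<bullet> \<xi>) * t n) - 1) / t n * fourier (\<lambda>x. complex_of_real (f x)) \<xi>)
    \<longlonglongrightarrow> \<i> * complex_of_real (2 * pi * (v \<bullet> \<xi>)) * fourier (\<lambda>x. complex_of_real (f x)) \<xi>"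
    by (intro tendsto_mult cis_difference_quotient t tendsto_const)
  ultimately have "(LINT x|lborel. cis (- 2 * pi * (x \<bullet> \<xi>)) * complex_of_real (?f' x))
    = \<i> * complex_of_real (2 * pi * (v \<bullet> \<xi>)) * fourier (\<lambda>x. complex_of_real (f x)) \<xi>"
    using LIMSEQ_unique by simp
  then show ?thesis unfolding fourier_def[of "\<lambda>x. complex_of_real (?f' x)"] by (simp add: ac_simps)
qed

text \<open>Each factor \<open>\<bar>\<xi> \<bullet> b\<bar>\<close> is paid for by one derivative
  in direction \<open>b\<close>, which is again a test function; the induction therefore runs over
  all test functions at once.\<close>

lemma fourier_test_decay:
  fixes f :: "'a::euclidean_space \<Rightarrow> real"
  assumes "test_fn f"
  shows "\<exists>C. \<forall>\<xi>. (1 + norm \<xi>) ^ N * cmod (fourier (\<lambda>x. complex_of_real (f x)) \<xi>) \<le> C"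
  using assms
proof (induction N arbitrary: f)
  case 0
  then show ?case using fourier_norm_le[of "\<lambda>x. complex_of_real (f x)"] by auto
next
  case (Suc N)
  let ?F = "\<lambda>f \<xi>. cmod (fourier (\<lambda>x. complex_of_real (f x)) \<xi>)"
  let ?D = "\<lambda>b x. frechet_derivative f (at x) b"
  obtain C where C: "(1 + norm \<xi>) ^ N * ?F f \<xi> \<le> C" for \<xi> using Suc by blast
  have "\<forall>b. \<exists>C. \<forall>\<xi>. (1 + norm \<xi>) ^ N * ?F (?D b) \<xi> \<le> C"
    using Suc.IH[OF test_fn_frechet[OF Suc.prems]] by blast
  then obtain E where E: "(1 + norm \<xi>) ^ N * ?F (?D b) \<xi> \<le> E b" for b \<xi> by metis
  have "(1 + norm \<xi>) ^ Suc N * ?F f \<xi> \<le> C + (\<Sum>b\<in>Basis. E b)" for \<xi>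
  proof -
    have "norm \<xi> * ((1 + norm \<xi>) ^ N * ?F f \<xi>) \<le> (\<Sum>b\<in>Basis. \<bar>\<xi> \<bullet> b\<bar>) * ((1 + norm \<xi>) ^ N * ?F f \<xi>)"
      by (intro mult_right_mono norm_le_l1) auto
    also have "\<dots> = (\<Sum>b\<in>Basis. (1 + norm \<xi>) ^ N * (\<bar>\<xi> \<bullet> b\<bar> * ?F f \<xi>))"
      by (simp add: sum_distrib_right sum_distrib_left ac_simps)
    also have "\<dots> \<le> (\<Sum>b\<in>Basis. (1 + norm \<xi>) ^ N * ?F (?D b) \<xi>)"
    proof (intro sum_mono mult_left_mono)
      fix b :: 'a
      have "?F (?D b) \<xi> = 2 * pi * (\<bar>b \<bullet> \<xi>\<bar> * ?F f \<xi>)"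
        by (simp add: fourier_frechet[OF Suc.prems] norm_mult ac_simps)
      moreover have "1 * (\<bar>b \<bullet> \<xi>\<bar> * ?F f \<xi>) \<le> 2 * pi * (\<bar>b \<bullet> \<xi>\<bar> * ?F f \<xi>)"
        by (rule mult_right_mono) (use pi_gt3 in auto)
      ultimately show "\<bar>\<xi> \<bullet> b\<bar> * ?F f \<xi> \<le> ?F (?D b) \<xi>" by (simp add: inner_commute)
    qed auto
    also have "\<dots> \<le> (\<Sum>b\<in>Basis. E b)" by (intro sum_mono E)
    finally show ?thesis using C[of \<xi>] by (simp add: algebra_simps)
  qed
  then show ?case by blast
qed

section \<open>Integrability from polynomial decay\<close>

lemma nn_integral_cauchy_kernel: "(\<integral>\<^sup>+x. ennreal (1 / (1 + x\<^sup>2)) \<partial>lborel) < \<infinity>"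
proof -
  have pos: "(\<integral>\<^sup>+x. ennreal (1 / (1 + x\<^sup>2)) * indicator {0::real..} x \<partial>lborel) = ennreal (pi / 2 - arctan 0)"
    by (rule nn_integral_FTC_atLeast)
       (auto intro!: derivative_eq_intros tendsto_arctan_at_top simp: inverse_eq_divide)
  have "(\<integral>\<^sup>+x. ennreal (1 / (1 + x\<^sup>2)) \<partial>lborel) \<le>
    (\<integral>\<^sup>+x. ennreal (1 / (1 + x\<^sup>2)) * indicator {0::real..} x + ennreal (1 / (1 + (-x)\<^sup>2)) * indicator {0::real..} (-x) \<partial>lborel)"
    by (intro nn_integral_mono) (auto simp: indicator_def)
  also have "\<dots> = (\<integral>\<^sup>+x. ennreal (1 / (1 + x\<^sup>2)) * indicator {0::real..} x \<partial>lborel) +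
     (\<integral>\<^sup>+x. ennreal (1 / (1 + (-x)\<^sup>2)) * indicator {0::real..} (-x) \<partial>lborel)"
    by (intro nn_integral_add) auto
  also have "(\<integral>\<^sup>+x. ennreal (1 / (1 + (-x)\<^sup>2)) * indicator {0::real..} (-x) \<partial>lborel) =
     (\<integral>\<^sup>+x. ennreal (1 / (1 + x\<^sup>2)) * indicator {0::real..} x \<partial>lborel)"
    using nn_integral_real_affine[of "\<lambda>x. ennreal (1 / (1 + x\<^sup>2)) * indicator {0::real..} x" "-1" 0] by simp
  finally show ?thesis unfolding pos
    by (auto simp: ennreal_plus[symmetric] simp del: ennreal_plus elim!: order_le_less_trans)
qed

lemma integrable_cauchy_product:
  "integrable lborel (\<lambda>x::'a::euclidean_space. \<Prod>b\<in>Basis. 1 / (1 + (x \<bullet> b)\<^sup>2))"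
proof (rule integrableI_nonneg)
  have "(\<integral>\<^sup>+x. ennreal (\<Prod>b\<in>Basis. 1 / (1 + ((x::'a) \<bullet> b)\<^sup>2)) \<partial>lborel) = (\<integral>\<^sup>+x. (\<Prod>b\<in>Basis. ennreal (1 / (1 + ((x::'a) \<bullet> b)\<^sup>2))) \<partial>lborel)"
    by (simp add: prod_ennreal)
  also have "\<dots> = (\<Prod>b\<in>(Basis::'a set). \<integral>\<^sup>+x. ennreal (1 / (1 + x\<^sup>2)) \<partial>lborel)"
    by (rule nn_integral_lborel_prod) auto
  also have "\<dots> < \<infinity>" using nn_integral_cauchy_kernel by (simp add: power_less_top_ennreal)
  finally show "(\<integral>\<^sup>+x. ennreal (\<Prod>b\<in>Basis. 1 / (1 + ((x::'a) \<bullet> b)\<^sup>2)) \<partial>lborel) < \<infinity>" .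
qed (auto intro!: AE_I2 prod_nonneg)

text \<open>The majorant is a product of one-dimensional Cauchy kernels, whose integral factorises.
  Each factor \<open>1 + (x \<bullet> b)^2\<close> is at most \<open>(1 + norm x)^2\<close>, hence
  the exponent \<open>2 * DIM('a)\<close>.\<close>

lemma integrable_if_decay:
  fixes F :: "'a::euclidean_space \<Rightarrow> real"
  assumes "F \<in> borel_measurable borel" "\<And>x. (1 + norm x) ^ (2 * DIM('a)) * \<bar>F x\<bar> \<le> C"
  shows "integrable lborel F"
proof (rule Bochner_Integration.integrable_bound)
  show "integrable lborel (\<lambda>x::'a. C * (\<Prod>b\<in>Basis. 1 / (1 + (x \<bullet> b)\<^sup>2)))"
    by (intro integrable_mult_right integrable_cauchy_product)
  show "AE x in lborel. norm (F x) \<le> norm (C * (\<Prod>b\<in>Basis. 1 / (1 + (x \<bullet> b)\<^sup>2)))"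
  proof (rule AE_I2, goal_cases)
    case (1 x)
    have "(\<Prod>b\<in>Basis. 1 + (x \<bullet> b)\<^sup>2) \<le> (\<Prod>b\<in>(Basis::'a set). (1 + norm x) ^ 2)"
    proof (intro prod_mono conjI)
      fix b :: 'a assume b: "b \<in> Basis"
      have "(x \<bullet> b)\<^sup>2 \<le> (norm x)\<^sup>2" using Basis_le_norm[OF b, of x] by (simp add: abs_le_square_iff[symmetric])
      then show "1 + (x \<bullet> b)\<^sup>2 \<le> (1 + norm x) ^ 2" by (simp add: power2_sum) (smt (verit) norm_ge_zero)
    qed simp
    also have "\<dots> = (1 + norm x) ^ (2 * DIM('a))" by (simp add: power_mult)
    finally have "(\<Prod>b\<in>Basis. 1 + (x \<bullet> b)\<^sup>2) * \<bar>F x\<bar> \<le> (1 + norm x) ^ (2 * DIM('a)) * \<bar>F x\<bar>"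
      by (rule mult_right_mono) simp
    also have "\<dots> \<le> C" by (rule assms)
    finally have *: "(\<Prod>b\<in>Basis. 1 + (x \<bullet> b)\<^sup>2) * \<bar>F x\<bar> \<le> C" .
    have "(\<Prod>b\<in>Basis. 1 + (x \<bullet> b)\<^sup>2) > 0" by (intro prod_pos) (auto intro: add_pos_nonneg)
    with * have "\<bar>F x\<bar> \<le> C * (\<Prod>b\<in>Basis. 1 / (1 + (x \<bullet> b)\<^sup>2))"
      by (simp add: prod_dividef field_simps)
    then show ?case by simp
  qed
qed (use assms in simp)

lemma
  fixes f :: "'a::euclidean_space \<Rightarrow> real"
  assumes f: "test_fn f"
  shows fourier_test_integrable: "integrable lborel (fourier (\<lambda>x. complex_of_real (f x)))"
    and fourier_test_weight: "s \<ge> 0 \<Longrightarrow> integrable lborel (\<lambda>\<xi>::'a. fweight s \<xi> * (cmod (fourier (\<lambda>x. complex_of_real (f x)) \<xi>))\<^sup>2)"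
proof -
  let ?F = "fourier (\<lambda>x. complex_of_real (f x))"
  have m[measurable]: "?F \<in> borel_measurable borel"
    using test_fn_integrable[OF f] by (intro borel_measurable_continuous_onI fourier_continuous) simp
  obtain C where "(1 + norm \<xi>) ^ (2 * DIM('a)) * cmod (?F \<xi>) \<le> C" for \<xi>
    using fourier_test_decay[OF f] by blast
  then have "integrable lborel (\<lambda>\<xi>. cmod (?F \<xi>))"
    by (intro integrable_if_decay[of _ C]) simp_all
  then show "integrable lborel ?F" by (subst integrable_norm_iff[symmetric]) auto
  \<comment> \<open>Of the two factors in the square, one absorbs the polynomial growth of the
    weight and the other stays integrable.\<close>
  obtain N :: nat where N: "s \<le> real N" using real_arch_simple by blast
  obtain C1 where C1: "(1 + norm \<xi>) ^ N * cmod (?F \<xi>) \<le> C1" for \<xi>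
    using fourier_test_decay[OF f] by blast
  show "integrable lborel (\<lambda>\<xi>::'a. fweight s \<xi> * (cmod (?F \<xi>))\<^sup>2)" if "s \<ge> 0"
  proof (rule Bochner_Integration.integrable_bound)
    show "integrable lborel (\<lambda>\<xi>. (2 * pi) powr s * C1 * cmod (?F \<xi>))"
      using \<open>integrable lborel (\<lambda>\<xi>. cmod (?F \<xi>))\<close> by simp
    show "AE \<xi> in lborel. norm (fweight s \<xi> * (cmod (?F \<xi>))\<^sup>2) \<le> norm ((2 * pi) powr s * C1 * cmod (?F \<xi>))"
    proof (rule AE_I2, goal_cases)
      case (1 \<xi>)
      have "norm \<xi> powr s \<le> (1 + norm \<xi>) powr s" using that by (intro powr_mono2) auto
      also have "\<dots> \<le> (1 + norm \<xi>) powr (real N)" using N by (intro powr_mono) auto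
      also have "\<dots> = (1 + norm \<xi>) ^ N" by (intro powr_realpow) (simp add: add_pos_nonneg)
      finally have "norm \<xi> powr s * cmod (?F \<xi>) \<le> (1 + norm \<xi>) ^ N * cmod (?F \<xi>)" by (rule mult_right_mono) simp
      then have "norm \<xi> powr s * cmod (?F \<xi>) \<le> C1" using C1[of \<xi>] by simp
      then have "(2 * pi) powr s * (norm \<xi> powr s * cmod (?F \<xi>)) * cmod (?F \<xi>) \<le> (2 * pi) powr s * C1 * cmod (?F \<xi>)"
        by (intro mult_right_mono mult_left_mono) auto
      then have "\<bar>fweight s \<xi> * (cmod (?F \<xi>))\<^sup>2\<bar> \<le> (2 * pi) powr s * C1 * cmod (?F \<xi>)"
        unfolding fweight_def by (simp add: powr_mult power2_eq_square ac_simps abs_mult)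
      then show ?case by simp
    qed
  qed (simp add: fweight_def)
qed

section \<open>The fundamental lemma of the calculus of variations\<close>

text \<open>The positive and negative parts of \<open>H\<close> are densities of two measures that
  agree on boxes. Boxes are stable under intersection and generate the Borel sets, so the measures
  are equal, and densities are unique almost everywhere.\<close>

lemma AE_zero_if_boxes:
  fixes H :: "'a::euclidean_space \<Rightarrow> real"
  assumes [measurable]: "H \<in> borel_measurable borel"
    and int: "\<And>a b. set_integrable lborel (box a b) H"
    and zero: "\<And>a b. set_lebesgue_integral lborel (box a b) H = 0"
  shows "AE x in lborel. H x = 0"
proof -
  let ?M = "density lborel (\<lambda>x. ennreal (max 0 (H x)))"
  let ?N = "density lborel (\<lambda>x. ennreal (max 0 (- H x)))"
  let ?E = "range (\<lambda>(a, b). box a b :: 'a set)"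
  have i: "integrable lborel (\<lambda>x. max 0 (H x) * indicator (box a b) x)"
       "integrable lborel (\<lambda>x. max 0 (- H x) * indicator (box a b) x)" for a b
    by (rule Bochner_Integration.integrable_bound[OF int[of a b, unfolded set_integrable_def]];
        auto simp: indicator_def)+
  have M: "emeasure ?M (box a b) = ennreal (LINT x|lborel. max 0 (H x) * indicator (box a b) x)"
      "emeasure ?N (box a b) = ennreal (LINT x|lborel. max 0 (- H x) * indicator (box a b) x)" for a b
  proof -
    show "emeasure ?M (box a b) = ennreal (LINT x|lborel. max 0 (H x) * indicator (box a b) x)"
      by (subst nn_integral_eq_integral[OF i(1), symmetric])
         (auto simp: emeasure_density ennreal_mult' ennreal_indicator)
    show "emeasure ?N (box a b) = ennreal (LINT x|lborel. max 0 (- H x) * indicator (box a b) x)"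
      by (subst nn_integral_eq_integral[OF i(2), symmetric])
         (auto simp: emeasure_density ennreal_mult' ennreal_indicator)
  qed
  have eq: "(LINT x|lborel. max 0 (H x) * indicator (box a b) x) = (LINT x|lborel. max 0 (- H x) * indicator (box a b) x)" for a b
  proof -
    have "(LINT x|lborel. max 0 (H x) * indicator (box a b) x) - (LINT x|lborel. max 0 (- H x) * indicator (box a b) x)
      = (LINT x|lborel. indicator (box a b) x *\<^sub>R H x)"
      by (subst Bochner_Integration.integral_diff[OF i, symmetric], intro Bochner_Integration.integral_cong)
         (auto simp: indicator_def)
    then show ?thesis using zero[of a b] unfolding set_lebesgue_integral_def by simp
  qed
  have "?M = ?N"
  proof (rule measure_eqI_generator_eq[where E="?E" and \<Omega>=UNIV])
    show "Int_stable ?E" by (auto simp: Int_stable_def box_Int_box)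
    show "?E \<subseteq> Pow UNIV" "sets ?M = sigma_sets UNIV ?E" "sets ?N = sigma_sets UNIV ?E"
      by (simp_all add: borel_eq_box)
    let ?A = "\<lambda>n::nat. box (- (real n *\<^sub>R One)) (real n *\<^sub>R One) :: 'a set"
    show "range ?A \<subseteq> ?E" "(\<Union>i. ?A i) = UNIV" unfolding UN_box_eq_UNIV by auto
    show "emeasure ?M (?A i) \<noteq> \<infinity>" for i unfolding M by simp
    show "emeasure ?M X = emeasure ?N X" if "X \<in> ?E" for X using that M eq by auto
  qed
  then have "AE x in lborel. ennreal (max 0 (H x)) = ennreal (max 0 (- H x))"
    by (intro sigma_finite_measure.density_unique) (auto intro: sigma_finite_lborel)
  then show ?thesis by eventually_elim (auto simp: max_def split: if_splits)
qed

text \<open>A smooth substitute for the indicator of an open box, nonzero exactly on it: as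
  \<open>m\<close> grows, \<open>flat_fn 0 (m * s)\<close> tends to 1 for positive \<open>s\<close>
  and remains 0 otherwise.\<close>

definition box_bump :: "nat \<Rightarrow> 'a::euclidean_space \<Rightarrow> 'a \<Rightarrow> 'a \<Rightarrow> real" where
  "box_bump n a b x = (\<Prod>i\<in>Basis. flat_fn 0 (real (Suc n) * (x \<bullet> i - a \<bullet> i)) * flat_fn 0 (real (Suc n) * (b \<bullet> i - x \<bullet> i)))"

lemma flat_fn_0: "0 \<le> flat_fn 0 s" "flat_fn 0 s \<le> 1" "s \<le> 0 \<Longrightarrow> flat_fn 0 s = 0" "s > 0 \<Longrightarrow> flat_fn 0 s > 0"
  unfolding flat_fn_def by auto

lemma flat_fn_0_lim: "(\<lambda>n. flat_fn 0 (real (Suc n) * s)) \<longlonglongrightarrow> (if s > 0 then 1 else 0)"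
proof (cases "s > 0")
  case True
  have "(\<lambda>n. exp (- (1 / s) * (1 / real (Suc n)))) \<longlonglongrightarrow> exp (- (1 / s) * 0)"
    by (intro tendsto_intros LIMSEQ_Suc[OF lim_1_over_n])
  then show ?thesis using True by (simp add: flat_fn_def mult.commute del: of_nat_Suc)
next
  case False
  then show ?thesis by (simp add: flat_fn_def zero_less_mult_iff not_less del: of_nat_Suc)
qed

lemma box_bump_nonzero: "box_bump n a b x \<noteq> 0 \<longleftrightarrow> x \<in> box a b"
proof -
  have "flat_fn 0 (real (Suc n) * s) = 0 \<longleftrightarrow> s \<le> 0" for s
    using flat_fn_0(3,4)[of "real (Suc n) * s"] by (auto simp: zero_less_mult_iff mult_le_0_iff simp del: of_nat_Suc)
       (smt (verit) mult_pos_pos of_nat_0_less_iff zero_less_Suc)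
  then show ?thesis unfolding box_bump_def by (auto simp: box_def not_le simp del: of_nat_Suc)
qed

lemma box_bump_bounds: "0 \<le> box_bump n a b x" "box_bump n a b x \<le> 1"
  unfolding box_bump_def by (auto intro!: prod_nonneg prod_le_1 mult_le_one flat_fn_0 mult_nonneg_nonneg)

lemma box_bump_lim: "(\<lambda>n. box_bump n a b x) \<longlonglongrightarrow> indicator (box a b) x"
proof -
  have "(\<lambda>n. box_bump n a b x) \<longlonglongrightarrow>
    (\<Prod>i\<in>Basis. (if x \<bullet> i - a \<bullet> i > 0 then 1 else 0) * (if b \<bullet> i - x \<bullet> i > 0 then 1 else 0))"
    unfolding box_bump_def by (intro tendsto_prod tendsto_mult flat_fn_0_lim)
  also have "(\<Prod>i\<in>Basis. (if x \<bullet> i - a \<bullet> i > 0 then 1 else 0) * (if b \<bullet> i - x \<bullet> i > 0 then 1 else 0)) = (indicator (box a b) x :: real)"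
    by (auto simp: indicator_def box_def)
  finally show ?thesis .
qed

lemma box_bump_smooth_alg: "box_bump n a b \<in> smooth_alg"
proof -
  have "(\<lambda>x. flat_fn 0 (x \<bullet> (real (Suc n) *\<^sub>R i) + - (real (Suc n) * (a \<bullet> i))) *
      flat_fn 0 (x \<bullet> (- real (Suc n) *\<^sub>R i) + real (Suc n) * (b \<bullet> i))) \<in> smooth_alg" for i
    by (intro smooth_alg.mult smooth_alg.flat_fn)
  moreover have "x \<bullet> (real (Suc n) *\<^sub>R i) + - (real (Suc n) * (a \<bullet> i)) = real (Suc n) * (x \<bullet> i - a \<bullet> i)"
    "x \<bullet> (- real (Suc n) *\<^sub>R i) + real (Suc n) * (b \<bullet> i) = real (Suc n) * (b \<bullet> i - x \<bullet> i)" for x i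
    by (simp_all add: right_diff_distrib del: of_nat_Suc)
  ultimately have "(\<lambda>x. flat_fn 0 (real (Suc n) * (x \<bullet> i - a \<bullet> i)) * flat_fn 0 (real (Suc n) * (b \<bullet> i - x \<bullet> i))) \<in> smooth_alg" for i
    by simp
  then show ?thesis unfolding box_bump_def by (intro smooth_alg_prod) auto
qed

lemma test_fnI:
  assumes "f \<in> smooth_alg" "\<And>x. f x \<noteq> 0 \<Longrightarrow> x \<in> cbox a b"
  shows "test_fn f"
proof -
  have "closure {x. f x \<noteq> 0} \<subseteq> cbox a b" using assms(2) by (intro closure_minimal) auto
  then have "compact (closure {x. f x \<noteq> 0})"
    by (metis compact_Int_closed compact_cbox closed_closure inf.absorb_iff2 inf_commute)
  with assms(1) show ?thesis unfolding test_fn_def by (simp add: smooth_alg_smooth_fn)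
qed

lemma box_subset_cbox_self: "x \<in> box a b \<Longrightarrow> x \<in> cbox a b"
  by (auto simp: mem_box less_imp_le)

lemma test_fn_box_bump: "test_fn (box_bump n a b)"
  by (rule test_fnI[where a=a and b=b, OF box_bump_smooth_alg]) (auto simp: box_bump_nonzero mem_box less_imp_le)

text \<open>Bumps converge boundedly to indicators of boxes, so all box integrals vanish. Asking the
  hypothesis for non-negative \<open>\<phi>\<close> alone pays off in
  \<open>AE_zero_if_heat_conv\<close>, where the sign makes Scheffe's lemma applicable.\<close>

theorem AE_zero_if_test:
  fixes G :: "'a::euclidean_space \<Rightarrow> complex"
  assumes G: "loc_integrable G"
    and zero: "\<And>\<phi>. test_fn \<phi> \<Longrightarrow> (\<And>x. 0 \<le> \<phi> x) \<Longrightarrow> (LINT x|lborel. G x * complex_of_real (\<phi> x)) = 0"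
  shows "AE x in lborel. G x = 0"
proof -
  have [measurable]: "G \<in> borel_measurable borel" using G unfolding loc_integrable_def by simp
  have ic: "set_integrable lborel (cbox a b) G" for a b using G unfolding loc_integrable_def by simp
  have ib: "set_integrable lborel (box a b) G" for a b
    using ic[of a b] by (rule set_integrable_subset) (auto simp: mem_box less_imp_le)
  have [measurable]: "box_bump n a b \<in> borel_measurable borel" for n and a b :: 'a
    using test_fn_measurable[OF test_fn_box_bump] .
  have z: "(LINT x|lborel. indicator (box a b) x *\<^sub>R G x) = 0" for a b
  proof -
    have "(\<lambda>n. LINT x|lborel. G x * complex_of_real (box_bump n a b x)) \<longlonglongrightarrow> (LINT x|lborel. G x * complex_of_real (indicator (box a b) x))"
    proof (rule integral_dominated_convergence[where w="\<lambda>x. norm (indicator (cbox a b) x *\<^sub>R G x)"])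
      show "integrable lborel (\<lambda>x. norm (indicator (cbox a b) x *\<^sub>R G x))"
        using ic unfolding set_integrable_def by (rule integrable_norm)
      show "AE x in lborel. (\<lambda>n. G x * complex_of_real (box_bump n a b x)) \<longlonglongrightarrow> G x * complex_of_real (indicator (box a b) x)"
        by (intro AE_I2 tendsto_intros box_bump_lim)
      show "AE x in lborel. norm (G x * complex_of_real (box_bump n a b x)) \<le> norm (indicator (cbox a b) x *\<^sub>R G x)" for n
      proof (rule AE_I2, goal_cases)
        case (1 x)
        show ?case
          using box_bump_nonzero[of n a b x] box_subset_cbox_self box_bump_bounds[of n a b x]
          by (cases "x \<in> box a b") (auto simp: norm_mult mult_left_le indicator_def)
      qed
    qed auto
    moreover have "(LINT x|lborel. G x * complex_of_real (box_bump n a b x)) = 0" for n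
      by (rule zero[OF test_fn_box_bump box_bump_bounds(1)])
    ultimately have "(LINT x|lborel. G x * complex_of_real (indicator (box a b) x)) = 0"
      by (simp add: LIMSEQ_const_iff)
    moreover have "G x * complex_of_real (indicator (box a b) x) = indicator (box a b) x *\<^sub>R G x" for x
      by (simp add: scaleR_conv_of_real)
    ultimately show ?thesis by simp
  qed
  have "AE x in lborel. Re (G x) = 0"
  proof (rule AE_zero_if_boxes)
    fix a b
    show "set_integrable lborel (box a b) (\<lambda>x. Re (G x))"
      using integrable_Re[OF ib[unfolded set_integrable_def, of a b]] unfolding set_integrable_def by simp
    show "set_lebesgue_integral lborel (box a b) (\<lambda>x. Re (G x)) = 0"
      using integral_Re[OF ib[unfolded set_integrable_def, of a b]] z[of a b] unfolding set_lebesgue_integral_def by simp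
  qed auto
  moreover have "AE x in lborel. Im (G x) = 0"
  proof (rule AE_zero_if_boxes)
    fix a b
    show "set_integrable lborel (box a b) (\<lambda>x. Im (G x))"
      using integrable_Im[OF ib[unfolded set_integrable_def, of a b]] unfolding set_integrable_def by simp
    show "set_lebesgue_integral lborel (box a b) (\<lambda>x. Im (G x)) = 0"
      using integral_Im[OF ib[unfolded set_integrable_def, of a b]] z[of a b] unfolding set_lebesgue_integral_def by simp
  qed auto
  ultimately show ?thesis by eventually_elim (simp add: complex_eq_iff)
qed

section \<open>Gaussians and the heat semigroup\<close>

text \<open>The Gauss-Weierstrass kernel at time t/(4 pi). With this clock it has mass one, its
  Fourier transform is \<open>gs t\<close>, and no further constants appear.\<close>

definition heat :: "real \<Rightarrow> 'a::euclidean_space \<Rightarrow> real" where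
  "heat t x = t powr (- real DIM('a) / 2) * exp (- (pi * (norm x)\<^sup>2 / t))"

definition gs :: "real \<Rightarrow> 'a::euclidean_space \<Rightarrow> real" where
  "gs t \<xi> = exp (- (pi * t * (norm \<xi>)\<^sup>2))"

lemma borel_measurable_heat[measurable (raw)]:
  assumes [measurable]: "t \<in> borel_measurable M" "f \<in> borel_measurable M"
  shows "(\<lambda>x. heat (t x) (f x)) \<in> borel_measurable M"
  unfolding heat_def by measurable

lemma borel_measurable_gs[measurable (raw)]:
  assumes [measurable]: "t \<in> borel_measurable M" "f \<in> borel_measurable M"
  shows "(\<lambda>x. gs (t x) (f x)) \<in> borel_measurable M"
  unfolding gs_def by measurable

lemma heat_nonneg[simp]: "0 \<le> heat t x" unfolding heat_def by simp
lemma gs_pos[simp]: "0 < gs t x" unfolding gs_def by simp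
lemma gs_nonneg[simp]: "0 \<le> gs t x" unfolding gs_def by simp
lemma heat_minus[simp]: "heat t (- x) = heat t x" unfolding heat_def by simp
lemma heat_commute: "heat t (x - y) = heat t (y - x)" unfolding heat_def by (simp add: norm_minus_commute)
lemma gs_add: "gs (s + t) x = gs s x * gs t x" unfolding gs_def by (simp add: exp_add[symmetric] algebra_simps)
lemma gs_le_1: "t \<ge> 0 \<Longrightarrow> gs t x \<le> 1" unfolding gs_def by simp

lemma heat_le: "t > 0 \<Longrightarrow> heat t (x::'a::euclidean_space) \<le> t powr (- real DIM('a) / 2)"
  unfolding heat_def by (simp add: mult_left_le)

lemma lborel_prod_integral:
  fixes f :: "'a::euclidean_space \<Rightarrow> real \<Rightarrow> complex"
  assumes "\<And>b. b \<in> Basis \<Longrightarrow> integrable lborel (f b)"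
  shows "integrable lborel (\<lambda>x::'a. \<Prod>b\<in>Basis. f b (x \<bullet> b))"
    and "(LINT x|lborel. (\<Prod>b\<in>Basis. f b (x \<bullet> b))) = (\<Prod>b\<in>(Basis::'a set). (LINT s|lborel. f b s))"
proof -
  interpret product_sigma_finite "\<lambda>_::'a. lborel :: real measure" by standard
  have [measurable]: "f b \<in> borel_measurable borel" if "b \<in> Basis" for b
    using assms[OF that] by auto
  have eq: "(lborel :: 'a measure) = distr (\<Pi>\<^sub>M b\<in>Basis. lborel) borel (\<lambda>f. \<Sum>b\<in>Basis. f b *\<^sub>R b)"
    unfolding lborel_def[where 'a='a] lborel_eq_real ..
  have c: "(\<Prod>b\<in>Basis. f b ((\<Sum>b\<in>Basis. x b *\<^sub>R b) \<bullet> b)) = (\<Prod>b\<in>Basis. f b (x b))" for x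
    by (intro prod.cong) (auto simp: inner_sum_left inner_Basis if_distrib cong: if_cong)
  show "integrable lborel (\<lambda>x::'a. \<Prod>b\<in>Basis. f b (x \<bullet> b))"
    using product_integrable_prod[of Basis f] assms
    by (subst eq, subst integrable_distr_eq) (auto simp: c)
  show "(LINT x|lborel. (\<Prod>b\<in>Basis. f b (x \<bullet> b))) = (\<Prod>b\<in>(Basis::'a set). (LINT s|lborel. f b s))"
    using product_integral_prod[of Basis f] assms
    by (subst eq, subst integral_distr) (auto simp: c)
qed

lemma gaussian_integral_1d:
  assumes t: "t > 0"
  shows "integrable lborel (\<lambda>s. cis (2 * pi * (s * u)) * complex_of_real (exp (- (pi * s\<^sup>2 / t))))"
    and "(LINT s|lborel. cis (2 * pi * (s * u)) * complex_of_real (exp (- (pi * s\<^sup>2 / t)))) = complex_of_real (sqrt t * exp (- (pi * t * u\<^sup>2)))"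
proof -
  \<comment> \<open>Scaling by \<open>c\<close> turns exp(-x^2/2) into exp(-pi s^2/t), and
    \<open>v\<close> below carries the frequency along. What remains is the characteristic function
    of the standard normal distribution.\<close>
  define c where "c = sqrt (2 * pi / t)"
  have c: "c > 0" "c\<^sup>2 = 2 * pi / t" using t unfolding c_def by auto
  define v where "v = 2 * pi * u / c"
  define F where "F x = std_normal_density x *\<^sub>R iexp (v * x)" for x
  have [measurable]: "F \<in> borel_measurable borel" unfolding F_def by measurable
  have iF: "integrable lborel F"
    by (rule Bochner_Integration.integrable_bound[OF integrable_normal_density[of 1 0]]) (auto simp: F_def)
  have F: "F (0 + c *\<^sub>R s) = (1 / sqrt (2 * pi)) *\<^sub>R (cis (2 * pi * (s * u)) * complex_of_real (exp (- (pi * s\<^sup>2 / t))))" for s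
  proof -
    have "v * (c * s) = 2 * pi * (s * u)" using c unfolding v_def by simp
    then have 1: "iexp (v * (c * s)) = cis (2 * pi * (s * u))" by (simp only: cis_conv_exp)
    have "(c * s)\<^sup>2 / 2 = pi * s\<^sup>2 / t" using c by (simp add: power_mult_distrib)
    then have 2: "- (c * s)\<^sup>2 / 2 = - (pi * s\<^sup>2 / t)" by simp
    have "F (0 + c *\<^sub>R s) = ((1 / sqrt (2 * pi)) * exp (- (c * s)\<^sup>2 / 2)) *\<^sub>R iexp (v * (c * s))"
      by (simp add: F_def std_normal_density_def)
    then show ?thesis unfolding 1 2 by (simp add: scaleR_conv_of_real)
  qed
  have "integrable lborel (\<lambda>s. F (0 + c *\<^sub>R s))" using iF c lborel_integrable_affine[of F c 0] by simp
  then have "integrable lborel (\<lambda>s. sqrt (2 * pi) *\<^sub>R F (0 + c *\<^sub>R s))" by simp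
  then show "integrable lborel (\<lambda>s. cis (2 * pi * (s * u)) * complex_of_real (exp (- (pi * s\<^sup>2 / t))))"
    unfolding F by simp
  have "(LINT x|lborel. F x) = char std_normal_distribution v"
    unfolding char_def F_def by (subst integral_density) (auto simp: normal_density_nonneg)
  also have "\<dots> = complex_of_real (exp (- (v\<^sup>2) / 2))" by (simp add: char_std_normal_distribution)
  also have "v\<^sup>2 / 2 = pi * t * u\<^sup>2" unfolding v_def power_divide c(2) using t by (simp add: power_mult_distrib power2_eq_square)
  then have "- (v\<^sup>2) / 2 = - (pi * t * u\<^sup>2)" by simp
  finally have "complex_of_real (exp (- (pi * t * u\<^sup>2))) = c *\<^sub>R (LINT s|lborel. F (0 + c *\<^sub>R s))"
    using lborel_integral_affine[of F c 0] c by simp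
  also have "\<dots> = (c / sqrt (2 * pi)) *\<^sub>R (LINT s|lborel. cis (2 * pi * (s * u)) * complex_of_real (exp (- (pi * s\<^sup>2 / t))))"
    unfolding F by simp
  also have "c / sqrt (2 * pi) = 1 / sqrt t" unfolding c_def by (simp add: real_sqrt_divide)
  finally show "(LINT s|lborel. cis (2 * pi * (s * u)) * complex_of_real (exp (- (pi * s\<^sup>2 / t)))) = complex_of_real (sqrt t * exp (- (pi * t * u\<^sup>2)))"
    using t by (simp add: scaleR_conv_of_real field_simps)
qed

lemma
  fixes \<xi> :: "'a::euclidean_space"
  assumes t: "t > 0"
  shows heat_cis_integrable: "integrable lborel (\<lambda>x. cis (2 * pi * (x \<bullet> \<xi>)) * complex_of_real (heat t x))"
    and heat_cis_integral: "(LINT x|lborel. cis (2 * pi * (x \<bullet> \<xi>)) * complex_of_real (heat t x)) = complex_of_real (gs t \<xi>)"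
proof -
  let ?f = "\<lambda>b s. cis (2 * pi * (s * (\<xi> \<bullet> b))) * complex_of_real (exp (- (pi * s\<^sup>2 / t)))"
  have cis_sum: "cis (\<Sum>b\<in>A. h b) = (\<Prod>b\<in>A. cis (h b))" if "finite A" for A and h :: "'a \<Rightarrow> real"
    using that by (induction rule: finite_induct) (auto simp: cis_mult[symmetric])
  have n2: "(norm x)\<^sup>2 = (\<Sum>b\<in>Basis. (x \<bullet> b)\<^sup>2)" for x :: 'a
    unfolding power2_norm_eq_inner by (subst euclidean_inner) (simp add: power2_eq_square)
  have eq: "cis (2 * pi * (x \<bullet> \<xi>)) * complex_of_real (heat t x) =
     complex_of_real (t powr (- real DIM('a) / 2)) * (\<Prod>b\<in>Basis. ?f b (x \<bullet> b))" for x
  proof -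
    have "cis (2 * pi * (x \<bullet> \<xi>)) = (\<Prod>b\<in>Basis. cis (2 * pi * ((x \<bullet> b) * (\<xi> \<bullet> b))))"
      by (subst euclidean_inner) (simp add: sum_distrib_left cis_sum)
    moreover have "exp (- (pi * (norm x)\<^sup>2 / t)) = (\<Prod>b\<in>Basis. exp (- (pi * (x \<bullet> b)\<^sup>2 / t)))"
      by (simp add: n2 exp_sum[symmetric] sum_distrib_left sum_divide_distrib sum_negf)
    ultimately show ?thesis unfolding heat_def by (simp add: prod.distrib)
  qed
  note i = lborel_prod_integral[of ?f, OF gaussian_integral_1d(1)[OF t]]
  show "integrable lborel (\<lambda>x. cis (2 * pi * (x \<bullet> \<xi>)) * complex_of_real (heat t x))"
    unfolding eq by (intro integrable_mult_right i)
  have "(LINT x|lborel. cis (2 * pi * (x \<bullet> \<xi>)) * complex_of_real (heat t x)) =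
     complex_of_real (t powr (- real DIM('a) / 2)) * (\<Prod>b\<in>Basis. complex_of_real (sqrt t * exp (- (pi * t * (\<xi> \<bullet> b)\<^sup>2))))"
    unfolding eq by (simp add: i(2) gaussian_integral_1d(2)[OF t])
  also have "\<dots> = complex_of_real (t powr (- real DIM('a) / 2) * (\<Prod>b\<in>(Basis::'a set). sqrt t * exp (- (pi * t * (\<xi> \<bullet> b)\<^sup>2))))"
    by simp
  also have "(\<Prod>b\<in>(Basis::'a set). sqrt t * exp (- (pi * t * (\<xi> \<bullet> b)\<^sup>2))) = sqrt t ^ DIM('a) * gs t \<xi>"
    by (simp add: prod.distrib gs_def n2 exp_sum[symmetric] sum_distrib_left sum_negf)
  also have "sqrt t ^ DIM('a) = t powr (real DIM('a) / 2)"
    using t by (simp add: powr_half_sqrt[symmetric] powr_realpow[symmetric] powr_powr)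
  also have "t powr (- real DIM('a) / 2) * (t powr (real DIM('a) / 2) * gs t \<xi>) = gs t \<xi>"
    using t by (simp add: mult.assoc[symmetric] powr_add[symmetric])
  finally show "(LINT x|lborel. cis (2 * pi * (x \<bullet> \<xi>)) * complex_of_real (heat t x)) = complex_of_real (gs t \<xi>)" .
qed

lemma heat_integrable: "t > 0 \<Longrightarrow> integrable lborel (heat t :: 'a::euclidean_space \<Rightarrow> real)"
  using integrable_norm[OF heat_cis_integrable[of t "0::'a"]] by simp

lemma heat_integral: "t > 0 \<Longrightarrow> (LINT x|lborel. heat t (x::'a::euclidean_space)) = 1"
  using heat_cis_integral[of t "0::'a"] by (simp add: gs_def)

lemma gs_eq_heat: "t > 0 \<Longrightarrow> gs t (x::'a::euclidean_space) = t powr (- real DIM('a) / 2) * heat (1 / t) x"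
  unfolding gs_def heat_def by (simp add: powr_divide powr_minus field_simps)

lemma gs_integrable: "t > 0 \<Longrightarrow> integrable lborel (gs t :: 'a::euclidean_space \<Rightarrow> real)"
  using heat_integrable[of "1/t", where 'a='a] by (simp add: gs_eq_heat cong: Bochner_Integration.integrable_cong)

lemma gs_integral: "t > 0 \<Longrightarrow> (LINT x|lborel. gs t (x::'a::euclidean_space)) = t powr (- real DIM('a) / 2)"
  using heat_integral[of "1/t", where 'a='a] by (simp add: gs_eq_heat)

text \<open>Inversion costs nothing for Gaussians: \<open>gs t\<close> is a multiple of
  \<open>heat (1 / t)\<close>, whose transform is already known.\<close>

lemma gs_cis_integral:
  fixes x :: "'a::euclidean_space"
  assumes t: "t > 0"
  shows "(LINT \<xi>|lborel. cis (2 * pi * (\<xi> \<bullet> x)) * complex_of_real (gs t \<xi>)) = complex_of_real (heat t x)"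
proof -
  have "(LINT \<xi>|lborel. cis (2 * pi * (\<xi> \<bullet> x)) * complex_of_real (gs t \<xi>)) =
    (LINT \<xi>|lborel. complex_of_real (t powr (- real DIM('a) / 2)) * (cis (2 * pi * (\<xi> \<bullet> x)) * complex_of_real (heat (1/t) \<xi>)))"
    by (intro Bochner_Integration.integral_cong) (simp_all add: gs_eq_heat[OF t])
  also have "\<dots> = complex_of_real (t powr (- real DIM('a) / 2)) * complex_of_real (gs (1/t) x)"
    using t by (subst integral_mult_right_zero) (simp add: heat_cis_integral)
  also have "\<dots> = complex_of_real (heat t x)" unfolding gs_def heat_def by simp
  finally show ?thesis .
qed

lemma
  fixes f :: "'a::euclidean_space \<Rightarrow> 'b::euclidean_space \<Rightarrow> 'c::{banach,second_countable_topology}"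
  assumes m: "case_prod f \<in> borel_measurable (lborel \<Otimes>\<^sub>M lborel)"
    and i: "\<And>x. integrable lborel (f x)"
    and le: "\<And>x. (LINT y|lborel. norm (f x y)) \<le> g x" and g: "integrable lborel g"
  shows lborel_pair_integrable: "integrable (lborel \<Otimes>\<^sub>M lborel) (case_prod f)"
    and lborel_Fubini: "(LINT x|lborel. (LINT y|lborel. f x y)) = (LINT y|lborel. (LINT x|lborel. f x y))"
proof -
  show *: "integrable (lborel \<Otimes>\<^sub>M lborel) (case_prod f)"
  proof (rule lborel_pair.Fubini_integrable[OF m])
    show "integrable lborel (\<lambda>x. LINT y|lborel. norm (case_prod f (x, y)))"
    proof (rule Bochner_Integration.integrable_bound[OF g])
      show "(\<lambda>x. LINT y|lborel. norm (case_prod f (x, y))) \<in> borel_measurable lborel"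
        using m by measurable
      show "AE x in lborel. norm (LINT y|lborel. norm (case_prod f (x, y))) \<le> norm (g x)"
        using le by (intro AE_I2) (simp add: abs_of_nonneg integral_nonneg_AE order_trans[OF _ abs_ge_self])
    qed
  qed (use i in simp)
  show "(LINT x|lborel. (LINT y|lborel. f x y)) = (LINT y|lborel. (LINT x|lborel. f x y))"
    using lborel_pair.Fubini_integral[OF *] by simp
qed

text \<open>The space L^1 + L^infinity, encoded by a pointwise majorant in place of a decomposition.
  The bound is required at every point, which makes the class convenient for integrals over a
  shifted kernel but forces some care where a bound is known only almost everywhere.\<close>

definition L1_Linf :: "('a::euclidean_space \<Rightarrow> real) \<Rightarrow> bool" where
  "L1_Linf F \<longleftrightarrow> F \<in> borel_measurable borel \<and>
    (\<exists>f M. integrable lborel f \<and> 0 \<le> M \<and> (\<forall>x. 0 \<le> f x \<and> \<bar>F x\<bar> \<le> f x + M))"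

lemma L1_LinfE:
  assumes "L1_Linf F"
  obtains f M where "F \<in> borel_measurable borel" "f \<in> borel_measurable borel" "integrable lborel f"
    "0 \<le> M" "\<And>x. 0 \<le> f x" "\<And>x. \<bar>F x\<bar> \<le> f x + M"
  using assms unfolding L1_Linf_def by (metis borel_measurable_integrable measurable_lborel2)

lemma L1_LinfI:
  assumes "F \<in> borel_measurable borel" "integrable lborel f" "\<And>x. \<bar>F x\<bar> \<le> f x + M"
  shows "L1_Linf F"
  unfolding L1_Linf_def
proof (intro conjI exI[of _ "\<lambda>x. \<bar>f x\<bar>"] exI[of _ "\<bar>M\<bar>"] allI)
  fix x show "\<bar>F x\<bar> \<le> \<bar>f x\<bar> + \<bar>M\<bar>" using assms(3)[of x] by linarith
qed (use assms in auto)

lemma L1_Linf_bounded: "F \<in> borel_measurable borel \<Longrightarrow> (\<And>x. \<bar>F x\<bar> \<le> M) \<Longrightarrow> L1_Linf F"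
  by (rule L1_LinfI[of F "\<lambda>_. 0" M]) auto

lemma L1_Linf_add:
  assumes "L1_Linf F" "L1_Linf G" shows "L1_Linf (\<lambda>x. F x + G x)"
proof -
  obtain f M where F: "F \<in> borel_measurable borel" "integrable lborel f" "\<And>x. \<bar>F x\<bar> \<le> f x + M"
    using assms(1) by (rule L1_LinfE) (rule that)
  obtain g N where G: "G \<in> borel_measurable borel" "integrable lborel g" "\<And>x. \<bar>G x\<bar> \<le> g x + N"
    using assms(2) by (rule L1_LinfE) (rule that)
  show ?thesis
  proof (rule L1_LinfI[of _ "\<lambda>x. f x + g x" "M + N"])
    fix x show "\<bar>F x + G x\<bar> \<le> f x + g x + (M + N)" using F(3)[of x] G(3)[of x] by linarith
  qed (use F G in auto)
qed

lemma L1_Linf_minus: "L1_Linf F \<Longrightarrow> L1_Linf (\<lambda>x. - F x)"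
  unfolding L1_Linf_def by auto

lemma L1_Linf_abs: "L1_Linf F \<Longrightarrow> L1_Linf (\<lambda>x. \<bar>F x\<bar>)"
  unfolding L1_Linf_def by auto

text \<open>Duality with L^1 \<inter> L^infinity: the bound \<open>B\<close> on \<open>k\<close>
  handles \<open>f\<close>, the integrability of \<open>k\<close> handles the constant
  \<open>M\<close>. Heat kernels and transforms of test functions are such \<open>k\<close>.\<close>

lemma L1_Linf_mult_integrable:
  fixes k :: "'a::euclidean_space \<Rightarrow> 'b::{real_normed_field,banach,second_countable_topology}"
  assumes "L1_Linf F" "integrable lborel k" "\<And>x. norm (k x) \<le> B"
  shows "integrable lborel (\<lambda>x. of_real (F x) * k x)"
proof -
  obtain f M where F: "F \<in> borel_measurable borel" "f \<in> borel_measurable borel" "integrable lborel f"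
    "0 \<le> M" "\<And>x. 0 \<le> f x" "\<And>x. \<bar>F x\<bar> \<le> f x + M"
    using assms(1) by (rule L1_LinfE) (rule that)
  have "integrable lborel (\<lambda>x. B * f x + M * norm (k x))" using F assms by auto
  then show ?thesis
  proof (rule Bochner_Integration.integrable_bound)
    show "(\<lambda>x. of_real (F x) * k x) \<in> borel_measurable lborel"
      using F borel_measurable_integrable[OF assms(2)] by measurable
    show "AE x in lborel. norm (of_real (F x) * k x) \<le> norm (B * f x + M * norm (k x))"
    proof (rule AE_I2, goal_cases)
      case (1 x)
      have "norm (of_real (F x) * k x) \<le> (f x + M) * norm (k x)"
        using F(6)[of x] by (simp add: norm_mult mult_right_mono)
      also have "\<dots> \<le> B * f x + M * norm (k x)"
        using mult_right_mono[OF assms(3)[of x] F(5)[of x]] by (simp add: algebra_simps)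
      finally show ?case by simp
    qed
  qed
qed

section \<open>Heat averages of functions in L^1 + L^infinity\<close>

definition heat_conv :: "real \<Rightarrow> ('a::euclidean_space \<Rightarrow> real) \<Rightarrow> 'a \<Rightarrow> real" where
  "heat_conv t F x = (LINT z|lborel. heat t (x - z) * F z)"

lemma
  fixes x :: "'a::euclidean_space"
  assumes t: "t > 0"
  shows heat_shift_integrable: "integrable lborel (\<lambda>z. heat t (x - z))"
    and heat_shift_integral: "(LINT z|lborel. heat t (x - z)) = 1"
    and heat_shift_integrable': "integrable lborel (\<lambda>z. heat t (z - x))"
    and heat_shift_integral': "(LINT z|lborel. heat t (z - x)) = 1"
  using lborel_integrable_reflect[of "heat t" x] lborel_integral_reflect[of "heat t" x]
    heat_integrable[OF t, where 'a='a] heat_integral[OF t, where 'a='a]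
  by (simp_all add: heat_commute[of t _ x])

lemma
  fixes x :: "'a::euclidean_space"
  assumes t: "t > 0"
  shows heat_shift_cis_integral: "(LINT z|lborel. complex_of_real (heat t (x - z)) * cis (2 * pi * (z \<bullet> \<xi>))) = cis (2 * pi * (x \<bullet> \<xi>)) * complex_of_real (gs t \<xi>)"
proof -
  let ?f = "\<lambda>w. cis (2 * pi * (w \<bullet> - \<xi>)) * complex_of_real (heat t w)"
  have eq: "complex_of_real (heat t (x - z)) * cis (2 * pi * (z \<bullet> \<xi>)) = cis (2 * pi * (x \<bullet> \<xi>)) * ?f (x - z)" for z
  proof -
    have "2 * pi * (z \<bullet> \<xi>) = 2 * pi * (x \<bullet> \<xi>) + 2 * pi * ((x - z) \<bullet> - \<xi>)"
      by (simp add: inner_diff_left right_diff_distrib)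
    then show ?thesis by (simp only: cis_mult[symmetric] ac_simps)
  qed
  have i: "integrable lborel ?f" by (rule heat_cis_integrable[OF t])
  have "(LINT z|lborel. ?f (x - z)) = complex_of_real (gs t (- \<xi>))"
    using lborel_integral_reflect[of ?f x] i heat_cis_integral[OF t, of "- \<xi>"] by simp
  then show "(LINT z|lborel. complex_of_real (heat t (x - z)) * cis (2 * pi * (z \<bullet> \<xi>))) = cis (2 * pi * (x \<bullet> \<xi>)) * complex_of_real (gs t \<xi>)"
    unfolding eq by (simp add: gs_def)
qed

lemma heat_conv_integrable:
  fixes F :: "'a::euclidean_space \<Rightarrow> real"
  assumes "L1_Linf F" "t > 0"
  shows "integrable lborel (\<lambda>z. heat t (x - z) * F z)"
proof -
  have "integrable lborel (\<lambda>z. of_real (F z) * heat t (x - z))"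
    by (rule L1_Linf_mult_integrable[OF assms(1) heat_shift_integrable[OF assms(2)], where B="t powr (- real DIM('a) / 2)"])
       (use heat_le[OF assms(2), where 'a='a] in simp)
  then show ?thesis by (simp add: mult.commute)
qed

lemma borel_measurable_heat_conv[measurable (raw)]:
  fixes F :: "'a::euclidean_space \<Rightarrow> real" 
  assumes [measurable]: "F \<in> borel_measurable borel" "t \<in> borel_measurable M" "f \<in> borel_measurable M"
  shows "(\<lambda>x. heat_conv (t x) F (f x)) \<in> borel_measurable M"
  unfolding heat_conv_def by measurable

lemma heat_conv_const: "t > 0 \<Longrightarrow> heat_conv t (\<lambda>_. c) x = c"
  unfolding heat_conv_def by (simp add: heat_shift_integral)

lemma heat_conv_mono:
  assumes "t > 0" "L1_Linf F" "L1_Linf G" "\<And>x. F x \<le> G x"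
  shows "heat_conv t F x \<le> heat_conv t G x"
  unfolding heat_conv_def
  by (intro integral_mono heat_conv_integrable assms mult_left_mono) simp

lemma heat_conv_add:
  assumes "t > 0" "L1_Linf F" "L1_Linf G"
  shows "heat_conv t (\<lambda>x. F x + G x) x = heat_conv t F x + heat_conv t G x"
  unfolding heat_conv_def distrib_left by (intro Bochner_Integration.integral_add heat_conv_integrable assms)

lemma heat_conv_minus: "heat_conv t (\<lambda>x. - F x) x = - heat_conv t F x"
  unfolding heat_conv_def by simp

lemma heat_conv_abs_le:
  assumes "t > 0" "L1_Linf F"
  shows "\<bar>heat_conv t F x\<bar> \<le> heat_conv t (\<lambda>x. \<bar>F x\<bar>) x"
  unfolding heat_conv_def
  by (rule order_trans[OF integral_abs_bound]) (simp add: abs_mult)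

lemma heat_conv_nonneg: "(\<And>x. 0 \<le> F x) \<Longrightarrow> 0 \<le> heat_conv t F x"
  unfolding heat_conv_def by (intro integral_nonneg_AE AE_I2) simp

lemma heat_conv_L1_le:
  fixes f :: "'a::euclidean_space \<Rightarrow> real"
  assumes "t > 0" "integrable lborel f" "\<And>x. 0 \<le> f x"
  shows "heat_conv t f x \<le> t powr (- real DIM('a) / 2) * (LINT z|lborel. f z)"
proof -
  have "heat_conv t f x \<le> (LINT z|lborel. t powr (- real DIM('a) / 2) * f z)"
    unfolding heat_conv_def using assms
    by (intro integral_mono heat_conv_integrable L1_LinfI[of f f 0] mult_right_mono heat_le) auto
  then show ?thesis by simp
qed

lemma heat_conv_dominated:
  assumes "t > 0" "F \<in> borel_measurable borel" "integrable lborel f" "\<And>x. \<bar>F x\<bar> \<le> f x + M" "\<And>x. 0 \<le> f x"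
  shows "\<bar>heat_conv t F x\<bar> \<le> heat_conv t f x + M"
proof -
  have L: "L1_Linf F" "L1_Linf f" "L1_Linf (\<lambda>_::'a. M)" using assms
    by (auto intro: L1_LinfI[of _ f M] L1_LinfI[of _ f 0] L1_Linf_bounded)
  have "\<bar>heat_conv t F x\<bar> \<le> heat_conv t (\<lambda>x. \<bar>F x\<bar>) x" by (rule heat_conv_abs_le) fact+
  also have "\<dots> \<le> heat_conv t (\<lambda>x. f x + M) x"
    using L assms by (intro heat_conv_mono L1_Linf_abs L1_Linf_add) auto
  also have "\<dots> = heat_conv t f x + M" using L assms by (simp add: heat_conv_add heat_conv_const)
  finally show ?thesis .
qed

lemma heat_conv_le:
  fixes F :: "'a::euclidean_space \<Rightarrow> real"
  assumes "t > 0" "F \<in> borel_measurable borel" "integrable lborel f" "\<And>x. \<bar>F x\<bar> \<le> f x + M" "\<And>x. 0 \<le> f x"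
  shows "\<bar>heat_conv t F x\<bar> \<le> t powr (- real DIM('a) / 2) * (LINT z|lborel. f z) + M"
  using heat_conv_dominated[OF assms, of x] heat_conv_L1_le[of t f x] assms(1,3,5) by simp

lemma heat_conv_continuous:
  fixes F :: "'a::euclidean_space \<Rightarrow> real"
  assumes F: "L1_Linf F" and t: "t > 0"
  shows "continuous_on UNIV (heat_conv t F)"
proof (rule continuous_on_sequentiallyI)
  fix u :: "nat \<Rightarrow> 'a" and a assume lim: "u \<longlonglongrightarrow> a"
  have "Bseq (\<lambda>n. u n - a)" using lim
    by (intro convergent_imp_Bseq convergent_diff convergent_const) (auto simp: convergent_def)
  then obtain B where B: "\<And>n. norm (u n - a) \<le> B" unfolding Bseq_def by auto
  obtain f M where F': "F \<in> borel_measurable borel" "f \<in> borel_measurable borel" "integrable lborel f"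
    "0 \<le> M" "\<And>x. 0 \<le> f x" "\<And>x. \<bar>F x\<bar> \<le> f x + M"
    using F by (rule L1_LinfE) (rule that)
  define c where "c = t powr (- real DIM('a) / 2)"
  \<comment> \<open>\<open>C\<close> absorbs a displacement of the centre by at most
    \<open>B\<close>: since |a - z|^2 is at most 2 |u_n - z|^2 + 2 B^2, doubling the time gives one
    Gaussian above the whole sequence. It dominates the bounded part of \<open>F\<close>; the L^1
    part uses the supremum \<open>c\<close> of the kernel.\<close>
  define C where "C = c * exp (pi * B\<^sup>2 / t) / (2 * t) powr (- real DIM('a) / 2)"
  have heat_bd: "heat t (u n - z) \<le> C * heat (2 * t) (a - z)" for n z
  proof -
    have "(norm (a - z))\<^sup>2 \<le> 2 * (norm (u n - z))\<^sup>2 + 2 * (norm (u n - a))\<^sup>2"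
    proof -
      have "norm (a - z) \<le> norm (u n - z) + norm (u n - a)"
        using norm_triangle_ineq4[of "u n - z" "u n - a"] by simp
      then have "(norm (a - z))\<^sup>2 \<le> (norm (u n - z) + norm (u n - a))\<^sup>2" by (intro power_mono) auto
      also have "\<dots> \<le> 2 * (norm (u n - z))\<^sup>2 + 2 * (norm (u n - a))\<^sup>2"
        using sum_squares_bound[of "norm (u n - z)" "norm (u n - a)"] by (simp add: power2_sum)
      finally show ?thesis .
    qed
    moreover have "(norm (u n - a))\<^sup>2 \<le> B\<^sup>2" using B[of n] by (intro power_mono) auto
    ultimately have "- ((norm (u n - z))\<^sup>2) \<le> B\<^sup>2 - (norm (a - z))\<^sup>2 / 2" by linarith
    then have "pi / t * (- ((norm (u n - z))\<^sup>2)) \<le> pi / t * (B\<^sup>2 - (norm (a - z))\<^sup>2 / 2)"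
      using t by (intro mult_left_mono) auto
    then have "exp (- (pi * (norm (u n - z))\<^sup>2 / t)) \<le> exp (pi * B\<^sup>2 / t) * exp (- (pi * (norm (a - z))\<^sup>2 / (2 * t)))"
      using t by (simp add: exp_add[symmetric] field_simps)
    then have "c * exp (- (pi * (norm (u n - z))\<^sup>2 / t)) \<le> c * (exp (pi * B\<^sup>2 / t) * exp (- (pi * (norm (a - z))\<^sup>2 / (2 * t))))"
      unfolding c_def by (intro mult_left_mono) auto
    then show ?thesis using t unfolding heat_def C_def c_def by simp
  qed
  show "(\<lambda>n. heat_conv t F (u n)) \<longlonglongrightarrow> heat_conv t F a"
    unfolding heat_conv_def
  proof (rule integral_dominated_convergence[where w="\<lambda>z. c * f z + C * heat (2 * t) (a - z) * M"])
    show "integrable lborel (\<lambda>z. c * f z + C * heat (2 * t) (a - z) * M)"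
      using heat_shift_integrable[of "2 * t" a] t F' by simp
    show "AE z in lborel. (\<lambda>n. heat t (u n - z) * F z) \<longlonglongrightarrow> heat t (a - z) * F z"
      unfolding heat_def using t lim by (intro AE_I2 tendsto_intros) auto
    show "AE z in lborel. norm (heat t (u n - z) * F z) \<le> c * f z + C * heat (2 * t) (a - z) * M" for n
    proof (rule AE_I2, goal_cases)
      case (1 z)
      have "norm (heat t (u n - z) * F z) \<le> heat t (u n - z) * (f z + M)"
        using F'(6)[of z] by (simp add: abs_mult mult_left_mono)
      also have "\<dots> = heat t (u n - z) * f z + heat t (u n - z) * M" by (simp add: algebra_simps)
      also have "\<dots> \<le> c * f z + C * heat (2 * t) (a - z) * M"
        using F'(4,5) heat_bd heat_le[OF t] unfolding c_def by (intro add_mono mult_right_mono) auto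
      finally show ?case .
    qed
  qed (use F' in measurable)
qed

lemma heat_conv_tendsto:
  fixes \<phi> :: "'a::euclidean_space \<Rightarrow> real"
  assumes cont: "continuous_on UNIV \<phi>" and bd: "\<And>x. \<bar>\<phi> x\<bar> \<le> M"
    and t: "t \<longlonglongrightarrow> 0" "\<And>n. t n > 0"
  shows "(\<lambda>n. heat_conv (t n) \<phi> x) \<longlonglongrightarrow> \<phi> x"
proof -
  have [measurable]: "\<phi> \<in> borel_measurable borel" by (rule borel_measurable_continuous_onI) fact
  \<comment> \<open>The substitution z = x - sqrt(t) w freezes the kernel at time 1 and moves all
    dependence on \<open>t\<close> into the argument of \<open>\<phi>\<close>.\<close>
  have eq: "heat_conv (t n) \<phi> x = (LINT w|lborel. heat 1 w * \<phi> (x + - sqrt (t n) *\<^sub>R w))" for n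
  proof -
    have s: "- sqrt (t n) \<noteq> 0" using t(2)[of n] by simp
    have h: "\<bar>- sqrt (t n)\<bar> ^ DIM('a) * heat (t n) (sqrt (t n) *\<^sub>R w) = heat 1 w" for w :: 'a
    proof -
      have "sqrt (t n) ^ DIM('a) = t n powr (real DIM('a) / 2)"
        using t(2)[of n] by (simp add: powr_half_sqrt[symmetric] powr_realpow[symmetric] powr_powr)
      then show ?thesis using t(2)[of n] unfolding heat_def
        by (simp add: power_mult_distrib mult.assoc[symmetric] powr_add[symmetric])
    qed
    have "heat_conv (t n) \<phi> x = \<bar>- sqrt (t n)\<bar> ^ DIM('a) *\<^sub>R
      (LINT w|lborel. heat (t n) (x - (x + - sqrt (t n) *\<^sub>R w)) * \<phi> (x + - sqrt (t n) *\<^sub>R w))"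
      unfolding heat_conv_def by (rule lborel_integral_affine[OF _ s]) measurable
    also have "\<dots> = (LINT w|lborel. (\<bar>- sqrt (t n)\<bar> ^ DIM('a) * heat (t n) (sqrt (t n) *\<^sub>R w)) * \<phi> (x + - sqrt (t n) *\<^sub>R w))"
      unfolding real_scaleR_def integral_mult_right_zero[symmetric] by (simp add: mult.assoc)
    finally show ?thesis unfolding h .
  qed
  have "(\<lambda>n. LINT w|lborel. heat 1 w * \<phi> (x + - sqrt (t n) *\<^sub>R w)) \<longlonglongrightarrow> (LINT w|lborel. heat 1 (w::'a) * \<phi> x)"
  proof (rule integral_dominated_convergence[where w="\<lambda>w. M * heat 1 w"])
    show "integrable lborel (\<lambda>w::'a. M * heat 1 w)" using heat_integrable[of 1, where 'a='a] by simp
    show "AE w in lborel. (\<lambda>n. heat 1 w * \<phi> (x + - sqrt (t n) *\<^sub>R w)) \<longlonglongrightarrow> heat 1 w * \<phi> x"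
    proof (intro AE_I2 tendsto_mult tendsto_const)
      fix w
      have "(\<lambda>n. x + - sqrt (t n) *\<^sub>R w) \<longlonglongrightarrow> x + - sqrt 0 *\<^sub>R w" by (intro tendsto_intros t)
      moreover have "isCont \<phi> x" using cont by (simp add: continuous_on_eq_continuous_at)
      ultimately show "(\<lambda>n. \<phi> (x + - sqrt (t n) *\<^sub>R w)) \<longlonglongrightarrow> \<phi> x"
        by (intro isCont_tendsto_compose[of x \<phi>]) auto
    qed
    show "AE w in lborel. norm (heat 1 w * \<phi> (x + - sqrt (t n) *\<^sub>R w)) \<le> M * heat 1 w" for n
      using mult_left_mono[OF bd heat_nonneg] by (intro AE_I2) (simp add: abs_mult mult.commute[of M])
  qed measurable
  also have "(LINT w|lborel. heat 1 (w::'a) * \<phi> x) = \<phi> x" by (simp add: heat_integral)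
  finally show ?thesis unfolding eq .
qed

text \<open>Self-adjointness of the semigroup: the kernel is even, so Fubini moves the average from
  \<open>F\<close> to \<open>\<phi>\<close>. Taking \<open>F\<close> constant yields conservation of
  mass.\<close>

lemma
  fixes F \<phi> :: "'a::euclidean_space \<Rightarrow> real"
  assumes F: "L1_Linf F" and t: "t > 0" and \<phi>: "integrable lborel \<phi>"
  shows heat_conv_swap: "(LINT y|lborel. \<phi> y * heat_conv t F y) = (LINT z|lborel. F z * heat_conv t \<phi> z)"
proof -
  obtain f M where F': "F \<in> borel_measurable borel" "f \<in> borel_measurable borel" "integrable lborel f"
    "0 \<le> M" "\<And>x. 0 \<le> f x" "\<And>x. \<bar>F x\<bar> \<le> f x + M"
    using F by (rule L1_LinfE) (rule that)
  note [measurable] = F'(1,2) borel_measurable_integrable[OF \<phi>]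
  define c where "c = t powr (- real DIM('a) / 2) * (LINT z|lborel. f z) + M"
  have "(LINT y|lborel. (LINT z|lborel. \<phi> y * (heat t (y - z) * F z))) = (LINT z|lborel. (LINT y|lborel. \<phi> y * (heat t (y - z) * F z)))"
  proof (rule lborel_Fubini[where g="\<lambda>y. \<bar>\<phi> y\<bar> * c"])
    show "integrable lborel (\<lambda>z. \<phi> y * (heat t (y - z) * F z))" for y
      by (intro integrable_mult_right heat_conv_integrable F t)
    show "(LINT z|lborel. norm (\<phi> y * (heat t (y - z) * F z))) \<le> \<bar>\<phi> y\<bar> * c" for y
    proof -
      have "(LINT z|lborel. norm (\<phi> y * (heat t (y - z) * F z))) = \<bar>\<phi> y\<bar> * heat_conv t (\<lambda>z. \<bar>F z\<bar>) y"
        unfolding heat_conv_def by (simp add: abs_mult)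
      also have "heat_conv t (\<lambda>z. \<bar>F z\<bar>) y \<le> c"
        unfolding c_def by (rule order_trans[OF abs_ge_self heat_conv_le]) (use F' t in auto)
      finally show ?thesis by (simp add: mult_left_mono)
    qed
    show "integrable lborel (\<lambda>y. \<bar>\<phi> y\<bar> * c)" using \<phi> by simp
  qed measurable
  moreover have "(LINT y|lborel. \<phi> y * (heat t (y - z) * F z)) = F z * heat_conv t \<phi> z" for z
  proof -
    have "(LINT y|lborel. \<phi> y * (heat t (y - z) * F z)) = (LINT y|lborel. F z * (heat t (z - y) * \<phi> y))"
      by (intro Bochner_Integration.integral_cong) (simp_all add: heat_commute[of t _ z])
    then show ?thesis unfolding heat_conv_def by simp
  qed
  ultimately show ?thesis unfolding heat_conv_def by simp
qed

lemma heat_conv_integral: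
  fixes \<phi> :: "'a::euclidean_space \<Rightarrow> real"
  assumes t: "t > 0" and \<phi>: "integrable lborel \<phi>"
  shows "(LINT z|lborel. heat_conv t \<phi> z) = (LINT z|lborel. \<phi> z)"
proof -
  have "L1_Linf (\<lambda>_::'a. 1)" by (rule L1_Linf_bounded[of _ 1]) auto
  from heat_conv_swap[OF this t \<phi>] t show ?thesis by (simp add: heat_conv_const)
qed

lemma heat_conv_L1:
  fixes f :: "'a::euclidean_space \<Rightarrow> real"
  assumes t: "t > 0" and f: "integrable lborel f"
  shows "integrable lborel (heat_conv t f)"
proof -
  have [measurable]: "f \<in> borel_measurable borel" using f by auto
  have "integrable (lborel \<Otimes>\<^sub>M lborel) (\<lambda>(z, x). heat t (x - z) * f z)"
    by (rule lborel_pair_integrable[where g="\<lambda>z. \<bar>f z\<bar>"])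
       (use f in \<open>auto simp: abs_mult heat_shift_integrable'[OF t] heat_shift_integral'[OF t]\<close>)
  from lborel_pair.integrable_snd[OF this] show ?thesis unfolding heat_conv_def[abs_def] by simp
qed

lemma L1_Linf_loc_integrable:
  assumes "L1_Linf F" shows "loc_integrable (\<lambda>x. complex_of_real (F x))"
  unfolding loc_integrable_def set_integrable_def
proof (intro conjI allI impI)
  obtain f M where F': "F \<in> borel_measurable borel" "f \<in> borel_measurable borel" "integrable lborel f"
    "0 \<le> M" "\<And>x. 0 \<le> f x" "\<And>x. \<bar>F x\<bar> \<le> f x + M"
    using assms by (rule L1_LinfE) (rule that)
  then show "(\<lambda>x. complex_of_real (F x)) \<in> borel_measurable lborel" by auto
  fix K :: "'a set" assume K: "compact K"
  have "integrable lborel (\<lambda>x. indicat_real K x)"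
    using K by (intro integrable_real_indicator emeasure_bounded_finite) (auto simp: compact_imp_bounded borel_compact)
  then have "integrable lborel (\<lambda>x. complex_of_real (F x) * complex_of_real (indicat_real K x))"
    by (intro L1_Linf_mult_integrable[OF assms, where B=1] integrable_of_real) (auto simp: indicator_def)
  then show "integrable lborel (\<lambda>x. indicat_real K x *\<^sub>R complex_of_real (F x))"
    by (simp add: scaleR_conv_of_real mult.commute)
qed

text \<open>By self-adjointness the averages of a test function are orthogonal to \<open>F\<close>,
  and they converge to the test function. The convergence has to be strong enough for both parts of
  the majorant \<open>f + M\<close>: dominated convergence for \<open>f\<close>, convergence in L^1
  for \<open>M\<close>.\<close>

theorem AE_zero_if_heat_conv:
  fixes F :: "'a::euclidean_space \<Rightarrow> real"
  assumes F: "L1_Linf F" and zero: "\<And>t x. t > 0 \<Longrightarrow> heat_conv t F x = 0"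
  shows "AE x in lborel. F x = 0"
proof -
  obtain f M where F': "F \<in> borel_measurable borel" "f \<in> borel_measurable borel" "integrable lborel f"
    "0 \<le> M" "\<And>x. 0 \<le> f x" "\<And>x. \<bar>F x\<bar> \<le> f x + M"
    using F by (rule L1_LinfE) (rule that)
  note [measurable] = F'(1,2)
  define t where "t n = 1 / real (Suc n)" for n
  have t: "t \<longlonglongrightarrow> 0" "\<And>n. t n > 0"
    unfolding t_def using LIMSEQ_inverse_real_of_nat by (auto simp: inverse_eq_divide)
  have "(LINT x|lborel. complex_of_real (F x) * complex_of_real (\<phi> x)) = 0"
    if \<phi>: "test_fn \<phi>" and nn: "\<And>x. 0 \<le> \<phi> x" for \<phi>
  proof -
    obtain B where B: "B > 0" "\<And>x. \<bar>\<phi> x\<bar> \<le> B" using test_fn_bounded[OF \<phi>] by blast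
    note i = test_fn_integrable[OF \<phi>]
    have [measurable]: "\<phi> \<in> borel_measurable borel" using test_fn_measurable[OF \<phi>] .
    let ?P = "\<lambda>n. heat_conv (t n) \<phi>"
    have lim: "(\<lambda>n. ?P n x) \<longlonglongrightarrow> \<phi> x" for x
      using heat_conv_tendsto[OF test_fn_continuous[OF \<phi>] B(2) t] .
    have Pnn: "0 \<le> ?P n x" for n x using heat_conv_nonneg nn by blast
    have Pi: "integrable lborel (?P n)" for n by (rule heat_conv_L1[OF t(2) i])
    have PB: "\<bar>?P n x\<bar> \<le> B" for n x using heat_conv_le[OF t(2), of \<phi> "\<lambda>_. 0" B] B by simp
    have "(\<lambda>n. \<integral>\<^sup>+ x. norm (?P n x - \<phi> x) \<partial>lborel) \<longlonglongrightarrow> 0"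
    \<comment> \<open>Non-negative functions of equal mass that converge pointwise converge in
      L^1.\<close>
    proof (rule Scheffe_lemma2)
      show "(\<integral>\<^sup>+ x. norm (?P n x) \<partial>lborel) \<le> (\<integral>\<^sup>+ x. norm (\<phi> x) \<partial>lborel)" for n
        using heat_conv_integral[OF t(2)[of n] i]
        by (simp add: Pnn nn nn_integral_eq_integral[OF Pi] nn_integral_eq_integral[OF i])
    qed (use i lim in auto)
    moreover have "(\<integral>\<^sup>+ x. norm (?P n x - \<phi> x) \<partial>lborel) = ennreal (LINT x|lborel. \<bar>?P n x - \<phi> x\<bar>)" for n
      using Pi i by (subst nn_integral_eq_integral) auto
    ultimately have L1: "(\<lambda>n. LINT x|lborel. \<bar>?P n x - \<phi> x\<bar>) \<longlonglongrightarrow> 0"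
      using tendsto_ennreal_iff[of "\<lambda>n. LINT x|lborel. \<bar>?P n x - \<phi> x\<bar>" sequentially 0] by (simp add: integral_nonneg_AE)
    have fbd: "norm (f x * \<bar>?P n x - \<phi> x\<bar>) \<le> f x * (2 * B)" for n x
      using F'(5)[of x] PB[of n x] B(2)[of x] by (simp add: abs_mult) (intro mult_left_mono, linarith+)
    have L2: "(\<lambda>n. LINT x|lborel. f x * \<bar>?P n x - \<phi> x\<bar>) \<longlonglongrightarrow> (LINT x|lborel. f x * 0)"
    proof (rule integral_dominated_convergence[where w="\<lambda>x. f x * (2 * B)"])
      show "AE x in lborel. (\<lambda>n. f x * \<bar>?P n x - \<phi> x\<bar>) \<longlonglongrightarrow> f x * 0"
        using lim by (intro AE_I2 tendsto_mult tendsto_const tendsto_rabs_zero LIM_zero)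
    qed (use F' fbd in auto)
    have fi: "integrable lborel (\<lambda>x. f x * \<bar>?P n x - \<phi> x\<bar>)" for n
    proof (rule Bochner_Integration.integrable_bound[where f="\<lambda>x. f x * (2 * B)"])
      show "AE x in lborel. norm (f x * \<bar>?P n x - \<phi> x\<bar>) \<le> norm (f x * (2 * B))"
        by (intro AE_I2 order_trans[OF fbd]) simp
    qed (use F' in auto)
    have iFP: "integrable lborel (\<lambda>x. F x * ?P n x)" "integrable lborel (\<lambda>x. F x * \<phi> x)" for n
      using L1_Linf_mult_integrable[OF F Pi[of n], where B=B] PB L1_Linf_mult_integrable[OF F i, where B=B] B(2) by auto
    have "\<bar>LINT x|lborel. F x * \<phi> x\<bar> \<le> (LINT x|lborel. f x * \<bar>?P n x - \<phi> x\<bar>) + M * (LINT x|lborel. \<bar>?P n x - \<phi> x\<bar>)" for n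
    proof -
      have "(LINT x|lborel. F x * ?P n x) = 0" using heat_conv_swap[OF F t(2)[of n] i] zero[OF t(2)[of n]] by simp
      then have "\<bar>LINT x|lborel. F x * \<phi> x\<bar> = \<bar>LINT x|lborel. F x * (?P n x - \<phi> x)\<bar>"
        unfolding right_diff_distrib by (subst Bochner_Integration.integral_diff[OF iFP]) simp
      also have "\<dots> \<le> (LINT x|lborel. \<bar>F x * (?P n x - \<phi> x)\<bar>)" by (rule integral_abs_bound)
      also have "\<dots> \<le> (LINT x|lborel. f x * \<bar>?P n x - \<phi> x\<bar> + M * \<bar>?P n x - \<phi> x\<bar>)"
      proof (rule integral_mono)
        show "integrable lborel (\<lambda>x. \<bar>F x * (?P n x - \<phi> x)\<bar>)"
          using iFP(1)[of n] iFP(2) by (intro integrable_abs) (simp add: right_diff_distrib)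
        show "integrable lborel (\<lambda>x. f x * \<bar>?P n x - \<phi> x\<bar> + M * \<bar>?P n x - \<phi> x\<bar>)" using fi[of n] Pi[of n] i by auto
        show "\<bar>F x * (?P n x - \<phi> x)\<bar> \<le> f x * \<bar>?P n x - \<phi> x\<bar> + M * \<bar>?P n x - \<phi> x\<bar>" for x
          using mult_right_mono[OF F'(6)[of x], where c="\<bar>?P n x - \<phi> x\<bar>"] by (simp add: abs_mult distrib_right)
      qed
      also have "\<dots> = (LINT x|lborel. f x * \<bar>?P n x - \<phi> x\<bar>) + M * (LINT x|lborel. \<bar>?P n x - \<phi> x\<bar>)"
        using fi[of n] Pi[of n] i by (subst Bochner_Integration.integral_add) auto
      finally show ?thesis .
    qed
    moreover have "(\<lambda>n. (LINT x|lborel. f x * \<bar>?P n x - \<phi> x\<bar>) + M * (LINT x|lborel. \<bar>?P n x - \<phi> x\<bar>)) \<longlonglongrightarrow> (LINT x|lborel. f x * 0) + M * 0"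
      by (intro tendsto_intros L1 L2)
    ultimately have "\<bar>LINT x|lborel. F x * \<phi> x\<bar> \<le> (LINT x|lborel. f x * 0) + M * 0"
      by (intro LIMSEQ_le_const) auto
    then have "(LINT x|lborel. F x * \<phi> x) = 0" by simp
    then have "complex_of_real (LINT x|lborel. F x * \<phi> x) = 0" by simp
    then show ?thesis unfolding integral_complex_of_real[symmetric] by simp
  qed
  from AE_zero_if_test[OF L1_Linf_loc_integrable[OF F] this] show ?thesis by simp
qed

text \<open>On inverse transforms of integrable functions the semigroup acts as the multiplier
  \<open>gs t\<close>, by Fubini. The real part appears because \<open>heat_conv\<close> acts on
  real functions.\<close>

lemma inverse_fourier_heat_conv:
  fixes m :: "'a::euclidean_space \<Rightarrow> complex"
  assumes m: "integrable lborel m" and t: "t > 0"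
  shows "heat_conv t (\<lambda>x. Re (LINT \<xi>|lborel. cis (2 * pi * (\<xi> \<bullet> x)) * m \<xi>)) y =
    Re (LINT \<xi>|lborel. cis (2 * pi * (\<xi> \<bullet> y)) * (complex_of_real (gs t \<xi>) * m \<xi>))"
proof -
  have [measurable]: "m \<in> borel_measurable borel" using m by auto
  let ?I = "\<lambda>x. LINT \<xi>|lborel. cis (2 * pi * (\<xi> \<bullet> x)) * m \<xi>"
  have cI: "continuous_on UNIV ?I" by (rule continuous_fourier_integral[OF m])
  then have [measurable]: "?I \<in> borel_measurable borel" by (rule borel_measurable_continuous_onI)
  have bI: "norm (?I x) \<le> (LINT \<xi>|lborel. norm (m \<xi>))" for x
    by (rule order_trans[OF integral_norm_bound]) (simp add: norm_mult)
  have iI: "integrable lborel (\<lambda>x. complex_of_real (heat t (y - x)) * ?I x)"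
  proof (rule Bochner_Integration.integrable_bound)
    show "integrable lborel (\<lambda>x. heat t (y - x) * (LINT \<xi>|lborel. norm (m \<xi>)))"
      using heat_shift_integrable[OF t, of y] by simp
    show "AE x in lborel. norm (complex_of_real (heat t (y - x)) * ?I x) \<le> norm (heat t (y - x) * (LINT \<xi>|lborel. norm (m \<xi>)))"
      using bI by (intro AE_I2) (simp add: norm_mult mult_left_mono integral_nonneg_AE)
  qed measurable
  have "heat_conv t (\<lambda>x. Re (?I x)) y = (LINT x|lborel. Re (complex_of_real (heat t (y - x)) * ?I x))"
    unfolding heat_conv_def by simp
  also have "\<dots> = Re (LINT x|lborel. complex_of_real (heat t (y - x)) * ?I x)"
    by (rule integral_Re[OF iI])
  also have "(LINT x|lborel. complex_of_real (heat t (y - x)) * ?I x) =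
     (LINT x|lborel. (LINT \<xi>|lborel. complex_of_real (heat t (y - x)) * (cis (2 * pi * (\<xi> \<bullet> x)) * m \<xi>)))"
    by simp
  also have "\<dots> = (LINT \<xi>|lborel. (LINT x|lborel. complex_of_real (heat t (y - x)) * (cis (2 * pi * (\<xi> \<bullet> x)) * m \<xi>)))"
  proof (rule lborel_Fubini[where g="\<lambda>x. heat t (y - x) * (LINT \<xi>|lborel. norm (m \<xi>))"])
    show "integrable lborel (\<lambda>\<xi>. complex_of_real (heat t (y - x)) * (cis (2 * pi * (\<xi> \<bullet> x)) * m \<xi>))" for x
      by (intro integrable_mult_right integrable_cis_mult m) measurable
    show "integrable lborel (\<lambda>x. heat t (y - x) * (LINT \<xi>|lborel. norm (m \<xi>)))"
      using heat_shift_integrable[OF t, of y] by simp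
  qed (auto simp: norm_mult)
  also have "\<dots> = (LINT \<xi>|lborel. cis (2 * pi * (\<xi> \<bullet> y)) * (complex_of_real (gs t \<xi>) * m \<xi>))"
  proof (rule Bochner_Integration.integral_cong[OF refl], goal_cases)
    case (1 \<xi>)
    have "(LINT x|lborel. complex_of_real (heat t (y - x)) * (cis (2 * pi * (\<xi> \<bullet> x)) * m \<xi>)) =
      (LINT x|lborel. complex_of_real (heat t (y - x)) * cis (2 * pi * (x \<bullet> \<xi>))) * m \<xi>"
      unfolding inner_commute[of \<xi>] integral_mult_left_zero[symmetric] by (simp add: mult.assoc)
    also have "\<dots> = cis (2 * pi * (y \<bullet> \<xi>)) * complex_of_real (gs t \<xi>) * m \<xi>"
      by (subst heat_shift_cis_integral[OF t]) simp
    finally show ?case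
      by (simp add: inner_commute[of y] mult.assoc)
  qed
  finally show ?thesis .
qed

section \<open>The heat semigroup and distributional Fourier transforms\<close>

lemma smooth_alg_scale: "f \<in> smooth_alg \<Longrightarrow> (\<lambda>x. f (c *\<^sub>R x)) \<in> smooth_alg"
proof (induction rule: smooth_alg.induct)
  case (flat_fn k a e)
  then show ?case using smooth_alg.flat_fn[of k "c *\<^sub>R a" e] by simp
next
  case (sin a e)
  then show ?case using smooth_alg.sin[of "c *\<^sub>R a" e] by simp
qed (auto intro: smooth_alg.intros)

lemma loc_integrable_test:
  fixes h :: "'a::euclidean_space \<Rightarrow> complex"
  assumes h: "loc_integrable h" and \<phi>: "test_fn \<phi>"
  shows "integrable lborel (\<lambda>\<xi>. h \<xi> * complex_of_real (\<phi> \<xi>))"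
proof -
  obtain B where B: "B > 0" "\<And>x. \<phi> x \<noteq> 0 \<Longrightarrow> norm x \<le> B" using test_fn_support[OF \<phi>] by blast
  obtain M where M: "M > 0" "\<And>x. \<bar>\<phi> x\<bar> \<le> M" using test_fn_bounded[OF \<phi>] by blast
  note [measurable] = test_fn_measurable[OF \<phi>]
  have [measurable]: "h \<in> borel_measurable borel" using h unfolding loc_integrable_def by simp
  have "integrable lborel (\<lambda>x. indicator (cball 0 B) x *\<^sub>R h x)"
    using h unfolding loc_integrable_def set_integrable_def by auto
  then have "integrable lborel (\<lambda>x. M *\<^sub>R (indicator (cball 0 B) x *\<^sub>R h x))"
    by (rule integrable_scaleR_right)
  then show ?thesis
  proof (rule Bochner_Integration.integrable_bound)
    show "AE \<xi> in lborel. norm (h \<xi> * complex_of_real (\<phi> \<xi>)) \<le> norm (M *\<^sub>R (indicat_real (cball 0 B) \<xi> *\<^sub>R h \<xi>))"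
    proof (rule AE_I2, goal_cases)
      case (1 x)
      show ?case
      proof (cases "\<phi> x = 0")
        case False
        then show ?thesis using B(2)[of x] M by (simp add: norm_mult mult.commute[of "norm (h x)"] mult_right_mono)
      qed simp
    qed
  qed measurable
qed

text \<open>Translation on the left is modulation on the right. Since \<open>is_dist_FT\<close>
  speaks of real test functions only, \<open>\<phi>\<close> times the phase is split into a cosine
  and a sine part; this is why \<open>smooth_alg\<close> contains plane waves.\<close>

lemma dist_FT_modulated:
  fixes F :: "'a::euclidean_space \<Rightarrow> real"
  assumes F: "L1_Linf F" and ft: "is_dist_FT F h"
    and \<phi>: "\<phi> \<in> smooth_alg" "\<And>\<xi>. \<phi> \<xi> \<noteq> 0 \<Longrightarrow> \<xi> \<in> cbox a b"
  shows "(LINT x|lborel. complex_of_real (F x) * fourier (\<lambda>\<xi>. complex_of_real (\<phi> \<xi>)) (x - z))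
    = (LINT \<xi>|lborel. h \<xi> * complex_of_real (\<phi> \<xi>) * cis (2 * pi * (z \<bullet> \<xi>)))"
proof -
  define A where "A = (\<lambda>\<xi>. \<phi> \<xi> * cos (\<xi> \<bullet> ((2 * pi) *\<^sub>R z) + 0))"
  define B where "B = (\<lambda>\<xi>. \<phi> \<xi> * sin (\<xi> \<bullet> ((2 * pi) *\<^sub>R z) + 0))"
  have t: "test_fn A" "test_fn B"
    unfolding A_def B_def using \<phi>
    by (auto intro!: test_fnI[of _ a b] smooth_alg.mult smooth_alg_cos smooth_alg.sin simp del: inner_scaleR_right add_0_right)
  have AB: "complex_of_real (\<phi> \<xi>) * cis (2 * pi * (z \<bullet> \<xi>)) = complex_of_real (A \<xi>) + \<i> * complex_of_real (B \<xi>)" for \<xi>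
    unfolding A_def B_def cis.code by (simp add: complex_eq_iff inner_commute)
  let ?A = "fourier (\<lambda>\<xi>. complex_of_real (A \<xi>))" and ?B = "fourier (\<lambda>\<xi>. complex_of_real (B \<xi>))"
  have iA: "integrable lborel (\<lambda>\<xi>. complex_of_real (A \<xi>))" and iB: "integrable lborel (\<lambda>\<xi>. complex_of_real (B \<xi>))"
    using t test_fn_integrable by auto
  have c: "(\<lambda>\<xi>. - 2 * pi * (\<xi> \<bullet> x)) \<in> borel_measurable borel" for x :: 'a by measurable
  have four: "fourier (\<lambda>\<xi>. complex_of_real (\<phi> \<xi>)) (x - z) = ?A x + \<i> * ?B x" for x
  proof -
    have "fourier (\<lambda>\<xi>. complex_of_real (\<phi> \<xi>)) (x - z) =
      (LINT \<xi>|lborel. cis (- 2 * pi * (\<xi> \<bullet> x)) * complex_of_real (A \<xi>) + \<i> * (cis (- 2 * pi * (\<xi> \<bullet> x)) * complex_of_real (B \<xi>)))"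
      unfolding fourier_def
    proof (rule Bochner_Integration.integral_cong[OF refl], goal_cases)
      case (1 \<xi>)
      have "- 2 * pi * (\<xi> \<bullet> (x - z)) = - 2 * pi * (\<xi> \<bullet> x) + 2 * pi * (z \<bullet> \<xi>)"
        by (simp add: inner_diff_right right_diff_distrib inner_commute)
      then have "cis (- 2 * pi * (\<xi> \<bullet> (x - z))) * complex_of_real (\<phi> \<xi>) =
        cis (- 2 * pi * (\<xi> \<bullet> x)) * (complex_of_real (\<phi> \<xi>) * cis (2 * pi * (z \<bullet> \<xi>)))"
        by (simp only: cis_mult[symmetric] ac_simps)
      then show ?case
        unfolding AB by (simp add: algebra_simps)
    qed
    also have "\<dots> = ?A x + \<i> * ?B x"
      unfolding fourier_def
      by (subst Bochner_Integration.integral_add) (auto intro!: integrable_cis_mult integrable_mult_right iA iB)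
    finally show ?thesis .
  qed
  have bd: "norm (?A x) \<le> (LINT \<xi>|lborel. norm (complex_of_real (A \<xi>)))" "norm (?B x) \<le> (LINT \<xi>|lborel. norm (complex_of_real (B \<xi>)))" for x
    by (rule fourier_norm_le)+
  note iFA = L1_Linf_mult_integrable[OF F fourier_test_integrable[OF t(1)] bd(1)]
  note iFB = L1_Linf_mult_integrable[OF F fourier_test_integrable[OF t(2)] bd(2)]
  have lh: "loc_integrable h" using ft unfolding is_dist_FT_def by simp
  have "(LINT x|lborel. complex_of_real (F x) * fourier (\<lambda>\<xi>. complex_of_real (\<phi> \<xi>)) (x - z)) =
     (LINT x|lborel. complex_of_real (F x) * ?A x + \<i> * (complex_of_real (F x) * ?B x))"
    unfolding four by (simp add: algebra_simps)
  also have "\<dots> = (LINT x|lborel. complex_of_real (F x) * ?A x) + \<i> * (LINT x|lborel. complex_of_real (F x) * ?B x)"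
    using iFA iFB by (subst Bochner_Integration.integral_add) auto
  also have "(LINT x|lborel. complex_of_real (F x) * ?A x) = (LINT \<xi>|lborel. h \<xi> * complex_of_real (A \<xi>))"
    using ft t(1) unfolding is_dist_FT_def by blast
  also have "(LINT x|lborel. complex_of_real (F x) * ?B x) = (LINT \<xi>|lborel. h \<xi> * complex_of_real (B \<xi>))"
    using ft t(2) unfolding is_dist_FT_def by blast
  also have "(LINT \<xi>|lborel. h \<xi> * complex_of_real (A \<xi>)) + \<i> * (LINT \<xi>|lborel. h \<xi> * complex_of_real (B \<xi>)) =
    (LINT \<xi>|lborel. h \<xi> * complex_of_real (A \<xi>) + \<i> * (h \<xi> * complex_of_real (B \<xi>)))"
    using loc_integrable_test[OF lh t(1)] loc_integrable_test[OF lh t(2)]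
    by (subst Bochner_Integration.integral_add) auto
  also have "\<dots> = (LINT \<xi>|lborel. h \<xi> * complex_of_real (\<phi> \<xi>) * cis (2 * pi * (z \<bullet> \<xi>)))"
    unfolding mult.assoc[of "h _"] AB by (simp add: algebra_simps)
  finally show ?thesis .
qed

text \<open>The modulated identity averaged over \<open>z\<close> against
  \<open>heat e (y - z)\<close>: on the left the average falls on \<open>F\<close>, on the right it
  damps the phase by \<open>gs e\<close>. The first Fubini exchange rests on the transform of
  \<open>\<phi>\<close> being integrable, the second on \<open>h * \<phi>\<close> being so.\<close>

lemma heat_conv_FT_test:
  fixes F :: "'a::euclidean_space \<Rightarrow> real"
  assumes F: "L1_Linf F" and ft: "is_dist_FT F h" and e: "e > 0"
    and \<phi>: "\<phi> \<in> smooth_alg" "\<And>\<xi>. \<phi> \<xi> \<noteq> 0 \<Longrightarrow> \<xi> \<in> cbox a b"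
  shows "(LINT v|lborel. fourier (\<lambda>\<xi>. complex_of_real (\<phi> \<xi>)) v * complex_of_real (heat_conv e F (y + v)))
    = (LINT \<xi>|lborel. h \<xi> * complex_of_real (\<phi> \<xi>) * (cis (2 * pi * (y \<bullet> \<xi>)) * complex_of_real (gs e \<xi>)))"
proof -
  let ?X = "fourier (\<lambda>\<xi>. complex_of_real (\<phi> \<xi>))"
  have t: "test_fn \<phi>" by (rule test_fnI[OF \<phi>])
  have lh: "loc_integrable h" using ft unfolding is_dist_FT_def by simp
  have ihp: "integrable lborel (\<lambda>\<xi>. h \<xi> * complex_of_real (\<phi> \<xi>))" by (rule loc_integrable_test[OF lh t])
  have iX: "integrable lborel ?X" by (rule fourier_test_integrable[OF t])
  note [measurable] = borel_measurable_integrable[OF ihp] borel_measurable_integrable[OF iX] test_fn_measurable[OF t]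
  have [measurable]: "h \<in> borel_measurable borel" using lh unfolding loc_integrable_def by simp
  obtain f M where F': "F \<in> borel_measurable borel" "f \<in> borel_measurable borel" "integrable lborel f"
    "0 \<le> M" "\<And>x. 0 \<le> f x" "\<And>x. \<bar>F x\<bar> \<le> f x + M"
    using F by (rule L1_LinfE) (rule that)
  note [measurable] = F'(1)
  define c where "c = e powr (- real DIM('a) / 2) * (LINT z|lborel. f z) + M"
  have shift: "(LINT z|lborel. heat e (y - z) * F (z + v)) = heat_conv e F (y + v)"
    "integrable lborel (\<lambda>z. heat e (y - z) * F (z + v))"
    "(LINT z|lborel. heat e (y - z) * \<bar>F (z + v)\<bar>) = heat_conv e (\<lambda>x. \<bar>F x\<bar>) (y + v)" for v
    using lborel_integral_shift[of "\<lambda>z. heat e (y + v - z) * F z" v]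
      lborel_integrable_shift[of "\<lambda>z. heat e (y + v - z) * F z" v]
      lborel_integral_shift[of "\<lambda>z. heat e (y + v - z) * \<bar>F z\<bar>" v] heat_conv_integrable[OF F e, of "y + v"]
    unfolding heat_conv_def by simp_all
  have "(LINT v|lborel. ?X v * complex_of_real (heat_conv e F (y + v))) =
    (LINT v|lborel. (LINT z|lborel. ?X v * complex_of_real (heat e (y - z) * F (z + v))))"
    unfolding shift(1)[symmetric] by (simp add: integral_complex_of_real del: of_real_mult)
  also have "\<dots> = (LINT z|lborel. (LINT v|lborel. ?X v * complex_of_real (heat e (y - z) * F (z + v))))"
  proof (rule lborel_Fubini[where g="\<lambda>v. norm (?X v) * c"])
    show "integrable lborel (\<lambda>z. ?X v * complex_of_real (heat e (y - z) * F (z + v)))" for v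
      by (intro integrable_mult_right integrable_of_real shift)
    show "(LINT z|lborel. norm (?X v * complex_of_real (heat e (y - z) * F (z + v)))) \<le> norm (?X v) * c" for v
    proof -
      have "heat_conv e (\<lambda>x. \<bar>F x\<bar>) (y + v) \<le> c"
        unfolding c_def by (rule order_trans[OF abs_ge_self heat_conv_le]) (use F' e in auto)
      then show ?thesis by (simp add: norm_mult abs_mult shift mult_left_mono)
    qed
    show "integrable lborel (\<lambda>v. norm (?X v) * c)" using iX by simp
  qed measurable
  also have "\<dots> = (LINT z|lborel. complex_of_real (heat e (y - z)) * (LINT \<xi>|lborel. h \<xi> * complex_of_real (\<phi> \<xi>) * cis (2 * pi * (z \<bullet> \<xi>))))"
  proof (rule Bochner_Integration.integral_cong[OF refl], goal_cases)
    case (1 z)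
    have "(LINT v|lborel. ?X v * complex_of_real (heat e (y - z) * F (z + v))) =
       complex_of_real (heat e (y - z)) * (LINT v|lborel. complex_of_real (F (v + z)) * ?X (v + z - z))"
      unfolding integral_mult_right_zero[symmetric] by (intro Bochner_Integration.integral_cong) (simp_all add: add.commute)
    also have "(LINT v|lborel. complex_of_real (F (v + z)) * ?X (v + z - z)) = (LINT x|lborel. complex_of_real (F x) * ?X (x - z))"
      by (rule lborel_integral_shift) measurable
    finally show ?case
      using dist_FT_modulated[OF F ft \<phi>] by simp
  qed
  also have "\<dots> = (LINT z|lborel. (LINT \<xi>|lborel. complex_of_real (heat e (y - z)) * (h \<xi> * complex_of_real (\<phi> \<xi>) * cis (2 * pi * (z \<bullet> \<xi>)))))"
    by simp
  also have "\<dots> = (LINT \<xi>|lborel. (LINT z|lborel. complex_of_real (heat e (y - z)) * (h \<xi> * complex_of_real (\<phi> \<xi>) * cis (2 * pi * (z \<bullet> \<xi>)))))"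
  proof (rule lborel_Fubini[where g="\<lambda>z. heat e (y - z) * (LINT \<xi>|lborel. norm (h \<xi> * complex_of_real (\<phi> \<xi>)))"])
    show "integrable lborel (\<lambda>\<xi>. complex_of_real (heat e (y - z)) * (h \<xi> * complex_of_real (\<phi> \<xi>) * cis (2 * pi * (z \<bullet> \<xi>))))" for z
      using integrable_cis_mult[OF ihp, of "\<lambda>\<xi>. 2 * pi * (z \<bullet> \<xi>)"] by (simp add: mult.commute)
    show "integrable lborel (\<lambda>z. heat e (y - z) * (LINT \<xi>|lborel. norm (h \<xi> * complex_of_real (\<phi> \<xi>))))"
      using heat_shift_integrable[OF e, of y] by simp
  qed (auto simp: norm_mult)
  also have "\<dots> = (LINT \<xi>|lborel. h \<xi> * complex_of_real (\<phi> \<xi>) * (cis (2 * pi * (y \<bullet> \<xi>)) * complex_of_real (gs e \<xi>)))"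
  proof (rule Bochner_Integration.integral_cong[OF refl], goal_cases)
    case (1 \<xi>)
    have "(LINT z|lborel. complex_of_real (heat e (y - z)) * (h \<xi> * complex_of_real (\<phi> \<xi>) * cis (2 * pi * (z \<bullet> \<xi>)))) =
      h \<xi> * complex_of_real (\<phi> \<xi>) * (LINT z|lborel. complex_of_real (heat e (y - z)) * cis (2 * pi * (z \<bullet> \<xi>)))"
      unfolding integral_mult_right_zero[symmetric] by (intro Bochner_Integration.integral_cong) (simp_all add: ac_simps)
    then show ?case
      by (simp add: heat_shift_cis_integral[OF e])
  qed
  finally show ?thesis .
qed

text \<open>Fourier inversion at the origin, the total mass of the approximate identity used for
  \<open>heat_conv_dist_FT\<close>. A Gaussian factor makes Fubini legitimate and turns the integral
  into a heat average of \<open>\<phi>\<close> at 0.\<close>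

lemma fourier_test_integral:
  fixes \<phi> :: "'a::euclidean_space \<Rightarrow> real"
  assumes \<phi>: "test_fn \<phi>"
  shows "(LINT v|lborel. fourier (\<lambda>\<xi>. complex_of_real (\<phi> \<xi>)) v) = complex_of_real (\<phi> 0)"
proof -
  let ?X = "fourier (\<lambda>\<xi>. complex_of_real (\<phi> \<xi>))"
  define t where "t n = 1 / real (Suc n)" for n
  have t: "t \<longlonglongrightarrow> 0" "\<And>n. t n > 0"
    unfolding t_def using LIMSEQ_inverse_real_of_nat by (auto simp: inverse_eq_divide)
  have iX: "integrable lborel ?X" by (rule fourier_test_integrable[OF \<phi>])
  note i = test_fn_integrable[OF \<phi>]
  note [measurable] = test_fn_measurable[OF \<phi>] borel_measurable_integrable[OF iX]
  obtain B where B: "\<And>x. \<bar>\<phi> x\<bar> \<le> B" using test_fn_bounded[OF \<phi>] by blast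
  have eq: "(LINT v|lborel. complex_of_real (gs (t n) v) * ?X v) = complex_of_real (heat_conv (t n) \<phi> 0)" for n
  proof -
    have "(LINT v|lborel. complex_of_real (gs (t n) v) * ?X v) =
      (LINT v|lborel. (LINT \<xi>|lborel. complex_of_real (gs (t n) v) * (cis (- 2 * pi * (\<xi> \<bullet> v)) * complex_of_real (\<phi> \<xi>))))"
      unfolding fourier_def by simp
    also have "\<dots> = (LINT \<xi>|lborel. (LINT v|lborel. complex_of_real (gs (t n) v) * (cis (- 2 * pi * (\<xi> \<bullet> v)) * complex_of_real (\<phi> \<xi>))))"
    proof (rule lborel_Fubini[where g="\<lambda>v. gs (t n) v * (LINT \<xi>|lborel. \<bar>\<phi> \<xi>\<bar>)"])
      show "integrable lborel (\<lambda>\<xi>. complex_of_real (gs (t n) v) * (cis (- 2 * pi * (\<xi> \<bullet> v)) * complex_of_real (\<phi> \<xi>)))" for v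
        by (intro integrable_mult_right integrable_cis_mult) (use i in auto)
      show "integrable lborel (\<lambda>v::'a. gs (t n) v * (LINT \<xi>|lborel. \<bar>\<phi> \<xi>\<bar>))" using gs_integrable[OF t(2), where 'a='a] by simp
    qed (auto simp: norm_mult)
    also have "\<dots> = (LINT \<xi>|lborel. complex_of_real (heat (t n) (0 - \<xi>) * \<phi> \<xi>))"
    proof (rule Bochner_Integration.integral_cong[OF refl], goal_cases)
      case (1 \<xi>)
      have "(LINT v|lborel. complex_of_real (gs (t n) v) * (cis (- 2 * pi * (\<xi> \<bullet> v)) * complex_of_real (\<phi> \<xi>))) =
        (LINT v|lborel. cis (2 * pi * (v \<bullet> - \<xi>)) * complex_of_real (gs (t n) v)) * complex_of_real (\<phi> \<xi>)"
        unfolding integral_mult_left_zero[symmetric]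
        by (intro Bochner_Integration.integral_cong) (simp_all add: ac_simps inner_commute[of \<xi>])
      also have "(LINT v|lborel. cis (2 * pi * (v \<bullet> - \<xi>)) * complex_of_real (gs (t n) v)) = complex_of_real (heat (t n) (- \<xi>))"
        by (rule gs_cis_integral[OF t(2)])
      finally show ?case by simp
    qed
    finally show ?thesis unfolding heat_conv_def integral_complex_of_real .
  qed
  have "(\<lambda>n. LINT v|lborel. complex_of_real (gs (t n) v) * ?X v) \<longlonglongrightarrow> (LINT v|lborel. ?X v)"
  proof (rule integral_dominated_convergence[where w="\<lambda>v. norm (?X v)"])
    show "AE v in lborel. (\<lambda>n. complex_of_real (gs (t n) v) * ?X v) \<longlonglongrightarrow> ?X v"
    proof (rule AE_I2, goal_cases)
      case (1 v)
      have "(\<lambda>n. complex_of_real (gs (t n) v) * ?X v) \<longlonglongrightarrow> complex_of_real (exp (- (pi * 0 * (norm v)\<^sup>2))) * ?X v"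
        unfolding gs_def by (intro tendsto_intros t)
      then show ?case by simp
    qed
    show "AE v in lborel. norm (complex_of_real (gs (t n) v) * ?X v) \<le> norm (?X v)" for n
      using gs_le_1[of "t n", where 'a='a] t(2)[of n] by (intro AE_I2) (simp add: norm_mult mult_left_le_one_le less_imp_le)
  qed (use iX in auto)
  moreover have "(\<lambda>n. LINT v|lborel. complex_of_real (gs (t n) v) * ?X v) \<longlonglongrightarrow> complex_of_real (\<phi> 0)"
    unfolding eq by (intro tendsto_of_real heat_conv_tendsto[OF test_fn_continuous[OF \<phi>] B t])
  ultimately show ?thesis by (rule LIMSEQ_unique)
qed

lemma fourier_scale:
  fixes f :: "'a::euclidean_space \<Rightarrow> complex"
  assumes R: "R > 0" and [measurable]: "f \<in> borel_measurable borel"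
  shows "fourier (\<lambda>\<xi>. f ((1/R) *\<^sub>R \<xi>)) v = R ^ DIM('a) *\<^sub>R fourier f (R *\<^sub>R v)"
proof -
  have "fourier (\<lambda>\<xi>. f ((1/R) *\<^sub>R \<xi>)) v = \<bar>R\<bar> ^ DIM('a) *\<^sub>R
    (LINT \<xi>|lborel. cis (- 2 * pi * ((0 + R *\<^sub>R \<xi>) \<bullet> v)) * f ((1/R) *\<^sub>R (0 + R *\<^sub>R \<xi>)))"
    unfolding fourier_def by (rule lborel_integral_affine) (use R in auto)
  then show ?thesis using R unfolding fourier_def by simp
qed

text \<open>The distributional Fourier transform only pairs with compactly supported functions of the
  frequency, so the Gaussian is first cut off by \<open>\<theta> (t\<^sub>n \<xi>)\<close>.\<close>

theorem heat_conv_dist_FT: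
  fixes F :: "'a::euclidean_space \<Rightarrow> real"
  assumes F: "L1_Linf F" and ft: "is_dist_FT F h" and e: "e > 0"
    and ih: "integrable lborel (\<lambda>\<xi>. h \<xi> * complex_of_real (gs e \<xi>))"
  shows "complex_of_real (heat_conv e F y) = (LINT \<xi>|lborel. cis (2 * pi * (y \<bullet> \<xi>)) * (h \<xi> * complex_of_real (gs e \<xi>)))"
proof -
  \<comment> \<open>A bump serves without normalisation: its value at 0 appears on both sides in the
    limit and is cancelled.\<close>
  define \<theta> :: "'a \<Rightarrow> real" where "\<theta> = box_bump 0 (- One) One"
  have \<theta>: "test_fn \<theta>" "\<theta> \<in> smooth_alg" "\<And>\<xi>. \<theta> \<xi> \<noteq> 0 \<Longrightarrow> \<xi> \<in> cbox (- One) One" "\<And>\<xi>. \<bar>\<theta> \<xi>\<bar> \<le> 1" "\<theta> 0 \<noteq> 0"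
    unfolding \<theta>_def using box_bump_bounds[of 0 "- One::'a" One] box_subset_cbox_self[of _ "- One::'a" One]
    by (auto simp: test_fn_box_bump box_bump_smooth_alg box_bump_nonzero abs_le_iff mem_box intro: order_trans[of _ 0])
  let ?X = "fourier (\<lambda>\<xi>. complex_of_real (\<theta> \<xi>))"
  have iX: "integrable lborel ?X" by (rule fourier_test_integrable[OF \<theta>(1)])
  have [measurable]: "h \<in> borel_measurable borel" using ft unfolding is_dist_FT_def loc_integrable_def by simp
  note [measurable] = test_fn_measurable[OF \<theta>(1)] borel_measurable_integrable[OF iX]
  obtain f M where F': "F \<in> borel_measurable borel" "f \<in> borel_measurable borel" "integrable lborel f"
    "0 \<le> M" "\<And>x. 0 \<le> f x" "\<And>x. \<bar>F x\<bar> \<le> f x + M"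
    using F by (rule L1_LinfE) (rule that)
  note [measurable] = F'(1)
  define c where "c = e powr (- real DIM('a) / 2) * (LINT z|lborel. f z) + M"
  let ?G = "heat_conv e F"
  have cG: "continuous_on UNIV ?G" by (rule heat_conv_continuous[OF F e])
  have bG: "\<bar>?G x\<bar> \<le> c" for x unfolding c_def by (rule heat_conv_le) (use F' e in auto)
  define t where "t n = 1 / real (Suc n)" for n
  have t: "t \<longlonglongrightarrow> 0" "\<And>n. t n > 0"
    unfolding t_def using LIMSEQ_inverse_real_of_nat by (auto simp: inverse_eq_divide)
  \<comment> \<open>Widening the cut-off concentrates its transform. After rescaling, the left side
    samples the continuous bounded \<open>?G\<close> ever closer to \<open>y\<close> and tends to
    \<open>\<theta> 0 * ?G y\<close>; the right side converges with \<open>ih\<close> as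
    majorant.\<close>
  have eq: "(LINT w|lborel. ?X w * complex_of_real (?G (y + t n *\<^sub>R w))) =
    (LINT \<xi>|lborel. complex_of_real (\<theta> (t n *\<^sub>R \<xi>)) * (cis (2 * pi * (y \<bullet> \<xi>)) * (h \<xi> * complex_of_real (gs e \<xi>))))" for n
  proof -
    define R where "R = 1 / t n"
    have R: "R > 0" "1 / R = t n" using t(2)[of n] by (auto simp: R_def)
    have m: "(\<lambda>\<xi>. complex_of_real (\<theta> \<xi>)) \<in> borel_measurable borel" by measurable
    have "(LINT v|lborel. fourier (\<lambda>\<xi>. complex_of_real (\<theta> (t n *\<^sub>R \<xi>))) v * complex_of_real (?G (y + v))) =
      (LINT v|lborel. R ^ DIM('a) *\<^sub>R ?X (R *\<^sub>R v) * complex_of_real (?G (y + v)))"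
      using fourier_scale[OF R(1) m] by (simp add: R(2))
    also have "\<dots> = \<bar>1 / R\<bar> ^ DIM('a) *\<^sub>R
      (LINT w|lborel. R ^ DIM('a) *\<^sub>R ?X (R *\<^sub>R (0 + (1/R) *\<^sub>R w)) * complex_of_real (?G (y + (0 + (1/R) *\<^sub>R w))))"
      by (rule lborel_integral_affine) (use R in auto)
    also have "\<dots> = (LINT w|lborel. ?X w * complex_of_real (?G (y + t n *\<^sub>R w)))"
      using R(1) by (simp add: R(2)) (simp add: R(2)[symmetric] power_one_over)
    finally have "(LINT w|lborel. ?X w * complex_of_real (?G (y + t n *\<^sub>R w))) =
       (LINT v|lborel. fourier (\<lambda>\<xi>. complex_of_real (\<theta> (t n *\<^sub>R \<xi>))) v * complex_of_real (?G (y + v)))" by simp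
    also have "\<dots> = (LINT \<xi>|lborel. h \<xi> * complex_of_real (\<theta> (t n *\<^sub>R \<xi>)) * (cis (2 * pi * (y \<bullet> \<xi>)) * complex_of_real (gs e \<xi>)))"
    proof (rule heat_conv_FT_test[OF F ft e smooth_alg_scale[OF \<theta>(2)], where a="- (R *\<^sub>R One)" and b="R *\<^sub>R One"])
      fix \<xi> assume "\<theta> (t n *\<^sub>R \<xi>) \<noteq> 0"
      then have "t n *\<^sub>R \<xi> \<in> cbox (- One) One" by (rule \<theta>(3))
      then show "\<xi> \<in> cbox (- (R *\<^sub>R One)) (R *\<^sub>R One)"
        using t(2)[of n] unfolding R_def by (auto simp: mem_box field_simps)
    qed
    finally show ?thesis by (simp add: ac_simps)
  qed
  have "(\<lambda>n. LINT w|lborel. ?X w * complex_of_real (?G (y + t n *\<^sub>R w))) \<longlonglongrightarrow> (LINT w|lborel. ?X w * complex_of_real (?G y))"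
  proof (rule integral_dominated_convergence[where w="\<lambda>w. norm (?X w) * c"])
    show "AE w in lborel. (\<lambda>n. ?X w * complex_of_real (?G (y + t n *\<^sub>R w))) \<longlonglongrightarrow> ?X w * complex_of_real (?G y)"
    proof (intro AE_I2 tendsto_mult tendsto_const tendsto_of_real)
      fix w
      have "(\<lambda>n. y + t n *\<^sub>R w) \<longlonglongrightarrow> y + 0 *\<^sub>R w" by (intro tendsto_intros t)
      moreover have "isCont ?G y" using cG by (simp add: continuous_on_eq_continuous_at)
      ultimately show "(\<lambda>n. ?G (y + t n *\<^sub>R w)) \<longlonglongrightarrow> ?G y"
        by (intro isCont_tendsto_compose[of y ?G]) auto
    qed
    show "AE w in lborel. norm (?X w * complex_of_real (?G (y + t n *\<^sub>R w))) \<le> norm (?X w) * c" for n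
      by (intro AE_I2) (simp add: norm_mult mult_left_mono bG)
  qed (use iX in auto)
  also have "(LINT w|lborel. ?X w * complex_of_real (?G y)) = complex_of_real (\<theta> 0) * complex_of_real (?G y)"
    using fourier_test_integral[OF \<theta>(1)] by simp
  finally have 1: "(\<lambda>n. LINT \<xi>|lborel. complex_of_real (\<theta> (t n *\<^sub>R \<xi>)) * (cis (2 * pi * (y \<bullet> \<xi>)) * (h \<xi> * complex_of_real (gs e \<xi>))))
    \<longlonglongrightarrow> complex_of_real (\<theta> 0) * complex_of_real (?G y)" unfolding eq .
  have 2: "(\<lambda>n. LINT \<xi>|lborel. complex_of_real (\<theta> (t n *\<^sub>R \<xi>)) * (cis (2 * pi * (y \<bullet> \<xi>)) * (h \<xi> * complex_of_real (gs e \<xi>))))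
    \<longlonglongrightarrow> (LINT \<xi>|lborel. complex_of_real (\<theta> 0) * (cis (2 * pi * (y \<bullet> \<xi>)) * (h \<xi> * complex_of_real (gs e \<xi>))))"
  proof (rule integral_dominated_convergence[where w="\<lambda>\<xi>. norm (h \<xi> * complex_of_real (gs e \<xi>))"])
    show "AE \<xi> in lborel. (\<lambda>n. complex_of_real (\<theta> (t n *\<^sub>R \<xi>)) * (cis (2 * pi * (y \<bullet> \<xi>)) * (h \<xi> * complex_of_real (gs e \<xi>))))
      \<longlonglongrightarrow> complex_of_real (\<theta> 0) * (cis (2 * pi * (y \<bullet> \<xi>)) * (h \<xi> * complex_of_real (gs e \<xi>)))"
    proof (intro AE_I2 tendsto_mult tendsto_const tendsto_of_real)
      fix \<xi> :: 'a
      have "(\<lambda>n. t n *\<^sub>R \<xi>) \<longlonglongrightarrow> 0 *\<^sub>R \<xi>" by (intro tendsto_intros t)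
      moreover have "isCont \<theta> 0" using test_fn_continuous[OF \<theta>(1)] by (simp add: continuous_on_eq_continuous_at)
      ultimately show "(\<lambda>n. \<theta> (t n *\<^sub>R \<xi>)) \<longlonglongrightarrow> \<theta> 0"
        by (intro isCont_tendsto_compose[of 0 \<theta>]) auto
    qed
    show "AE \<xi> in lborel. norm (complex_of_real (\<theta> (t n *\<^sub>R \<xi>)) * (cis (2 * pi * (y \<bullet> \<xi>)) * (h \<xi> * complex_of_real (gs e \<xi>))))
       \<le> norm (h \<xi> * complex_of_real (gs e \<xi>))" for n
    proof (rule AE_I2, goal_cases)
      case (1 \<xi>)
      show ?case
        using mult_right_mono[OF \<theta>(4)[of "t n *\<^sub>R \<xi>"], of "norm (h \<xi>) * gs e \<xi>"] by (simp add: norm_mult)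
    qed
  qed (use ih in auto)
  from LIMSEQ_unique[OF 1 2] \<theta>(5) show ?thesis by simp
qed

section \<open>The Riesz weight\<close>

text \<open>The constant is dictated by the Gamma integral: t^(a/2-1) exp(-pi t |x|^2) integrates to
  Gamma(a/2) (pi |x|^2)^(-a/2), which the prefactor turns into (2 pi |x|)^(-a). The value 0 at
  non-positive times lets integrals run over the whole line.\<close>

definition kern :: "real \<Rightarrow> real \<Rightarrow> real" where
  "kern a t = (if t > 0 then pi powr (a/2) * (2 * pi) powr (- a) / Gamma (a/2) * t powr (a/2 - 1) else 0)"

lemma borel_measurable_kern[measurable]: "kern a \<in> borel_measurable borel"
  unfolding kern_def by measurable

lemma kern_nonneg: "a > 0 \<Longrightarrow> 0 \<le> kern a t"
  unfolding kern_def by (auto intro!: mult_nonneg_nonneg divide_nonneg_nonneg Gamma_real_nonneg)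

text \<open>The Gamma integral in the variable \<open>c * t\<close> with c = pi |x|^2. At the origin
  the two sides differ: the integral is infinite, while \<open>0 powr (- a) = 0\<close>.\<close>

lemma kern_nn_integral:
  fixes \<xi> :: "'a::euclidean_space"
  assumes a: "a > 0" and \<xi>: "\<xi> \<noteq> 0"
  shows "(\<integral>\<^sup>+t. ennreal (kern a t * gs t \<xi>) \<partial>lborel) = ennreal (fweight (- a) \<xi>)"
proof -
  define c where "c = pi * (norm \<xi>)\<^sup>2"
  have c: "c > 0" using \<xi> by (simp add: c_def)
  have G: "Gamma (a/2) > 0" using a by (intro Gamma_real_pos) auto
  define C where "C = pi powr (a/2) * (2 * pi) powr (- a) / Gamma (a/2)"
  have C: "C > 0" using G by (simp add: C_def)
  let ?f = "\<lambda>s. ennreal (indicator {0..} s * s powr (a/2 - 1) / exp s)"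
  have "(\<integral>\<^sup>+t. ennreal (kern a t * gs t \<xi>) \<partial>lborel) = (\<integral>\<^sup>+t. ennreal (C * c powr (1 - a/2)) * ?f (0 + c * t) \<partial>lborel)"
  proof (rule nn_integral_cong_AE, rule AE_mp[OF AE_lborel_singleton[of 0]], intro AE_I2 impI)
    fix t :: real assume t: "t \<noteq> 0"
    show "ennreal (kern a t * gs t \<xi>) = ennreal (C * c powr (1 - a/2)) * ?f (0 + c * t)"
    proof (cases "t > 0")
      case True
      have "gs t \<xi> = 1 / exp (c * t)" by (simp add: gs_def c_def exp_minus inverse_eq_divide ac_simps)
      moreover have "c powr (1 - a/2) * (c * t) powr (a/2 - 1) = t powr (a/2 - 1)"
        using c True by (simp add: powr_mult mult.assoc[symmetric] powr_add[symmetric])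
      ultimately have "kern a t * gs t \<xi> = C * c powr (1 - a/2) * ((c * t) powr (a/2 - 1) / exp (c * t))"
        using True unfolding kern_def C_def[symmetric] by simp
      then show ?thesis using True c C by (simp add: ennreal_mult'[symmetric] indicator_def)
    next
      case False
      then have "c * t < 0" using t c by (simp add: mult_pos_neg)
      then show ?thesis using False by (simp add: kern_def indicator_def)
    qed
  qed
  also have "\<dots> = ennreal (C * c powr (1 - a/2)) * (\<integral>\<^sup>+t. ?f (0 + c * t) \<partial>lborel)"
    by (intro nn_integral_cmult) measurable
  also have "(\<integral>\<^sup>+t. ?f (0 + c * t) \<partial>lborel) = ennreal (1 / c) * (\<integral>\<^sup>+t. ?f t \<partial>lborel)"
  proof -
    have "ennreal (1 / c) * (\<integral>\<^sup>+t. ?f t \<partial>lborel) = ennreal (1 / c) * (ennreal c * (\<integral>\<^sup>+t. ?f (0 + c * t) \<partial>lborel))"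
      using c by (subst nn_integral_real_affine[of ?f c 0]) auto
    also have "\<dots> = ennreal (1 / c * c) * (\<integral>\<^sup>+t. ?f (0 + c * t) \<partial>lborel)"
      using c by (subst ennreal_mult) (auto simp: mult.assoc)
    finally show ?thesis using c by simp
  qed
  also have "(\<integral>\<^sup>+t. ?f t \<partial>lborel) = ennreal (Gamma (a/2))"
    using a by (intro Gamma_conv_nn_integral_real[symmetric]) auto
  also have "ennreal (C * c powr (1 - a/2)) * (ennreal (1 / c) * ennreal (Gamma (a/2))) = ennreal (C * c powr (1 - a/2) * (1 / c) * Gamma (a/2))"
    using C c G by (simp add: ennreal_mult'[symmetric] mult.assoc)
  also have "C * c powr (1 - a/2) * (1 / c) * Gamma (a/2) = fweight (- a) \<xi>"
  proof -
    have 1: "c powr (1 - a/2) * (1 / c) = c powr (- (a/2))" 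
      using c powr_diff[of c "1 - a/2" 1] by simp
    have 2: "c powr (- (a/2)) = pi powr (- (a/2)) * norm \<xi> powr (- a)"
    proof -
      have "((norm \<xi>)\<^sup>2) powr (- (a/2)) = norm \<xi> powr (- a)"
      proof -
        have "(norm \<xi>)\<^sup>2 = norm \<xi> powr 2" using \<xi> by simp
        then show ?thesis by (simp only: powr_powr) simp
      qed
      then show ?thesis unfolding c_def by (simp add: powr_mult)
    qed
    have 3: "pi powr (a/2) * pi powr (- (a/2)) = 1" by (simp add: powr_add[symmetric])
    have "C * c powr (1 - a/2) * (1 / c) * Gamma (a/2) = (C * Gamma (a/2)) * (c powr (1 - a/2) * (1 / c))" by simp
    also have "C * Gamma (a/2) = pi powr (a/2) * (2 * pi) powr (- a)" using G by (simp add: C_def)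
    also have "pi powr (a/2) * (2 * pi) powr (- a) * (c powr (1 - a/2) * (1 / c)) =
       (pi powr (a/2) * pi powr (- (a/2))) * ((2 * pi) powr (- a) * norm \<xi> powr (- a))"
      unfolding 1 2 by (simp only: ac_simps)
    also have "\<dots> = fweight (- a) \<xi>" unfolding 3 fweight_def by (simp add: powr_mult)
    finally show ?thesis .
  qed
  finally show ?thesis .
qed

lemma
  fixes \<xi> :: "'a::euclidean_space"
  assumes a: "a > 0" and \<xi>: "\<xi> \<noteq> 0"
  shows kern_integrable: "integrable lborel (\<lambda>t. kern a t * gs t \<xi>)"
    and kern_integral: "(LINT t|lborel. kern a t * gs t \<xi>) = fweight (- a) \<xi>"
proof -
  have "has_bochner_integral lborel (\<lambda>t. kern a t * gs t \<xi>) (fweight (- a) \<xi>)"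
    using kern_nn_integral[OF assms] kern_nonneg[OF a]
    by (intro has_bochner_integral_nn_integral) (auto simp: fweight_def)
  then show "integrable lborel (\<lambda>t. kern a t * gs t \<xi>)" "(LINT t|lborel. kern a t * gs t \<xi>) = fweight (- a) \<xi>"
    by (auto simp: has_bochner_integral_iff)
qed

lemma integrable_powr_01:
  assumes "s > 0"
  shows "integrable lborel (\<lambda>t::real. indicator {0<..<1} t * t powr (s - 1))"
proof (rule Bochner_Integration.integrable_bound)
  show "integrable lborel (\<lambda>t. exp 1 * (indicator {0..} t * t powr (s - 1) / exp t))"
  proof (rule integrable_mult_right, rule integrableI_nonneg)
    show "(\<integral>\<^sup>+t. ennreal (indicator {0..} t * t powr (s - 1) / exp t) \<partial>lborel) < \<infinity>"
      using Gamma_conv_nn_integral_real[OF assms] by (metis ennreal_less_top infinity_ennreal_def)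
  qed auto
  show "AE t in lborel. norm (indicator {0<..<1} t * t powr (s - 1)) \<le> norm (exp 1 * (indicator {0..} t * t powr (s - 1) / exp t))"
  proof (rule AE_I2, goal_cases)
    case (1 t)
    show ?case
    proof (cases "t \<in> {0<..<1}")
      case True
      then have "exp t \<le> exp (1::real)" by simp
      then have "t powr (s - 1) * exp t \<le> t powr (s - 1) * exp 1" by (intro mult_left_mono) auto
      then show ?thesis using True by (simp add: field_simps)
    qed simp
  qed
qed measurable

lemma nn_integral_powr_atLeast_1:
  assumes "s < 0"
  shows "(\<integral>\<^sup>+t. ennreal (t powr (s - 1)) * indicator {1..} t \<partial>lborel) < \<infinity>"
proof -
  have "((\<lambda>x::real. x powr s / s) \<longlongrightarrow> 0 / s) at_top"
    using assms by (intro tendsto_divide tendsto_const tendsto_neg_powr filterlim_ident) auto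
  then have "(\<integral>\<^sup>+t. ennreal (t powr (s - 1)) * indicator {1..} t \<partial>lborel) = ennreal (0 / s - 1 powr s / s)"
    using assms by (intro nn_integral_FTC_atLeast[where F="\<lambda>x. x powr s / s"]) (auto intro!: derivative_eq_intros)
  then show ?thesis by simp
qed

text \<open>Two different reasons at the two ends: near zero \<open>e\<close> bounds the second
  factor and t^(a/2-1) is integrable as a > 0; for large times the product decays like
  t^((a-d)/2-1), integrable as a < d.\<close>

lemma kern_heat_nn_integral:
  assumes a: "0 < a" "a < real d" and e: "e > 0"
  shows "(\<integral>\<^sup>+t. ennreal (kern a t * (t + e) powr (- real d / 2)) \<partial>lborel) < \<infinity>"
proof -
  define C where "C = pi powr (a/2) * (2 * pi) powr (- a) / Gamma (a/2)"
  have C: "C \<ge> 0" using a unfolding C_def by (auto intro!: divide_nonneg_nonneg Gamma_real_nonneg)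
  have "(\<integral>\<^sup>+t. ennreal (kern a t * (t + e) powr (- real d / 2)) \<partial>lborel) \<le>
    (\<integral>\<^sup>+t. ennreal (C * e powr (- real d / 2)) * ennreal (indicator {0<..<1} t * t powr (a/2 - 1)) +
       ennreal C * (ennreal (t powr ((a - real d) / 2 - 1)) * indicator {1..} t) \<partial>lborel)"
  proof (intro nn_integral_mono)
    fix t :: real
    consider "t \<le> 0" | "0 < t" "t < 1" | "t \<ge> 1" by linarith
    then show "ennreal (kern a t * (t + e) powr (- real d / 2)) \<le> 
      ennreal (C * e powr (- real d / 2)) * ennreal (indicator {0<..<1} t * t powr (a/2 - 1)) +
       ennreal C * (ennreal (t powr ((a - real d) / 2 - 1)) * indicator {1..} t)"
    proof cases
      case 1
      then show ?thesis by (simp add: kern_def)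
    next
      case 2
      have "(t + e) powr (- real d / 2) \<le> e powr (- real d / 2)" using 2 e by (intro powr_mono2') auto
      then have "C * t powr (a/2 - 1) * (t + e) powr (- real d / 2) \<le> C * t powr (a/2 - 1) * e powr (- real d / 2)"
        using C by (intro mult_left_mono) auto
      then show ?thesis using 2 C unfolding kern_def C_def[symmetric]
        by (simp add: ennreal_mult'[symmetric] ennreal_leI ac_simps)
    next
      case 3
      have "(t + e) powr (- real d / 2) \<le> t powr (- real d / 2)" using 3 e by (intro powr_mono2') auto
      then have "C * t powr (a/2 - 1) * (t + e) powr (- real d / 2) \<le> C * t powr (a/2 - 1) * t powr (- real d / 2)"
        using C by (intro mult_left_mono) auto
      also have "\<dots> = C * t powr ((a - real d) / 2 - 1)"
        using 3 by (simp add: mult.assoc powr_add[symmetric]) (simp add: diff_divide_distrib algebra_simps)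
      finally show ?thesis using 3 C unfolding kern_def C_def[symmetric]
        by (simp add: ennreal_mult'[symmetric] ennreal_leI)
    qed
  qed
  also have "\<dots> = ennreal (C * e powr (- real d / 2)) * (\<integral>\<^sup>+t. ennreal (indicator {0<..<1} t * t powr (a/2 - 1)) \<partial>lborel) +
     ennreal C * (\<integral>\<^sup>+t. ennreal (t powr ((a - real d) / 2 - 1)) * indicator {1..} t \<partial>lborel)"
    by (subst nn_integral_add) (auto simp: nn_integral_cmult)
  also have "\<dots> < \<infinity>"
  proof -
    have "(\<integral>\<^sup>+t. ennreal (indicator {0<..<1} t * t powr (a/2 - 1)) \<partial>lborel) < \<infinity>"
      using integrable_powr_01[of "a/2"] a(1) by (simp add: integrable_iff_bounded)
    moreover have "(\<integral>\<^sup>+t. ennreal (t powr ((a - real d) / 2 - 1)) * indicator {1..} t \<partial>lborel) < \<infinity>"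
      using a by (intro nn_integral_powr_atLeast_1) auto
    ultimately show ?thesis by (simp add: ennreal_mult_less_top)
  qed
  finally show ?thesis .
qed

text \<open>Writing the weight as a superposition of Gaussians and integrating over the frequency
  first reduces the singularity at the origin to a one-dimensional integral in time.\<close>

lemma fweight_gs_integrable:
  assumes a: "0 < a" "a < real DIM('a)" and e: "e > 0"
  shows "integrable lborel (\<lambda>\<xi>::'a::euclidean_space. fweight (- a) \<xi> * gs e \<xi>)"
proof (rule integrableI_nonneg)
  have "(\<integral>\<^sup>+(\<xi>::'a). ennreal (fweight (- a) \<xi> * gs e \<xi>) \<partial>lborel) =
    (\<integral>\<^sup>+(\<xi>::'a). (\<integral>\<^sup>+t. ennreal (kern a t) * ennreal (gs (t + e) \<xi>) \<partial>lborel) \<partial>lborel)"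
  proof (rule nn_integral_cong_AE, rule AE_mp[OF AE_lborel_singleton[of 0]], intro AE_I2 impI)
    fix \<xi> :: 'a assume "\<xi> \<noteq> 0"
    then have "ennreal (fweight (- a) \<xi> * gs e \<xi>) = (\<integral>\<^sup>+t. ennreal (kern a t * gs t \<xi>) \<partial>lborel) * ennreal (gs e \<xi>)"
      using a by (subst kern_nn_integral) (auto simp: ennreal_mult fweight_def)
    also have "\<dots> = (\<integral>\<^sup>+t. ennreal (kern a t) * ennreal (gs (t + e) \<xi>) \<partial>lborel)"
      using kern_nonneg[OF a(1)] by (subst nn_integral_multc[symmetric])
         (auto simp: gs_add ennreal_mult'[symmetric] mult.assoc intro!: nn_integral_cong)
    finally show "ennreal (fweight (- a) \<xi> * gs e \<xi>) = (\<integral>\<^sup>+t. ennreal (kern a t) * ennreal (gs (t + e) \<xi>) \<partial>lborel)" .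
  qed
  also have "\<dots> = (\<integral>\<^sup>+t. (\<integral>\<^sup>+(\<xi>::'a). ennreal (kern a t) * ennreal (gs (t + e) \<xi>) \<partial>lborel) \<partial>lborel)"
    by (rule lborel_pair.Fubini') measurable
  also have "\<dots> = (\<integral>\<^sup>+t. ennreal (kern a t * (t + e) powr (- real DIM('a) / 2)) \<partial>lborel)"
  proof (rule nn_integral_cong)
    fix t :: real
    show "(\<integral>\<^sup>+(\<xi>::'a). ennreal (kern a t) * ennreal (gs (t + e) \<xi>) \<partial>lborel) = ennreal (kern a t * (t + e) powr (- real DIM('a) / 2))"
    proof (cases "t > 0")
      case True
      then have "(\<integral>\<^sup>+(\<xi>::'a). ennreal (gs (t + e) \<xi>) \<partial>lborel) = ennreal ((t + e) powr (- real DIM('a) / 2))"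
        using e gs_integral[of "t + e", where 'a='a] gs_integrable[of "t + e", where 'a='a]
        by (subst nn_integral_eq_integral) auto
      then show ?thesis using kern_nonneg[OF a(1)] by (subst nn_integral_cmult) (auto simp: ennreal_mult)
    qed (simp add: kern_def)
  qed
  also have "\<dots> < \<infinity>" by (rule kern_heat_nn_integral[OF a e])
  finally show "(\<integral>\<^sup>+(\<xi>::'a). ennreal (fweight (- a) \<xi> * gs e \<xi>) \<partial>lborel) < \<infinity>" .
qed (auto simp: fweight_def)

lemma fweight_pos_gs_integrable:
  assumes a: "0 \<le> a" and e: "e > 0"
  shows "integrable lborel (\<lambda>\<xi>::'a::euclidean_space. fweight a \<xi> * gs e \<xi>)"
proof -
  obtain N :: nat where N: "a \<le> 2 * real N" using real_arch_simple[of "a/2"] by (metis mult.commute divide_le_eq_numeral1(1))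
  \<comment> \<open>Half of the Gaussian pays for the power of the norm: by 1 inside the unit ball
    and by \<open>power_le_fact_exp\<close> outside. The other half stays integrable.\<close>
  define C where "C = (2 * pi) powr a * (1 + fact N * (2 / (pi * e)) ^ N)"
  have bd: "fweight a \<xi> * gs e \<xi> \<le> C * gs (e/2) \<xi>" for \<xi> :: 'a
  proof -
    have "norm \<xi> powr a * gs (e/2) \<xi> \<le> 1 + fact N * (2 / (pi * e)) ^ N"
    proof (cases "norm \<xi> \<le> 1")
      case True
      have "norm \<xi> powr a \<le> 1 powr a" using True a by (intro powr_mono2) auto
      then have "norm \<xi> powr a * gs (e/2) \<xi> \<le> 1 * 1" using e by (intro mult_mono gs_le_1) auto
      then show ?thesis using e by (simp add: add_increasing2)
    next
      case False
      define u where "u = pi * (e/2) * (norm \<xi>)\<^sup>2"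
      have "norm \<xi> powr a \<le> norm \<xi> powr (2 * real N)" using False N by (intro powr_mono) auto
      also have "\<dots> = (norm \<xi>) ^ (2 * N)" using False powr_realpow[of "norm \<xi>" "2 * N"] by (cases "\<xi> = 0") auto
      also have "\<dots> = (2 / (pi * e)) ^ N * u ^ N"
        using e by (simp add: u_def power_mult power_mult_distrib[symmetric])
      also have "\<dots> \<le> (2 / (pi * e)) ^ N * (fact N * exp u)"
        using e by (intro mult_left_mono power_le_fact_exp) (auto simp: u_def)
      finally have "norm \<xi> powr a * gs (e/2) \<xi> \<le> (2 / (pi * e)) ^ N * (fact N * exp u) * gs (e/2) \<xi>"
        by (rule mult_right_mono) simp
      also have "\<dots> = fact N * (2 / (pi * e)) ^ N" unfolding gs_def u_def by (simp add: exp_minus)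
      finally show ?thesis by simp
    qed
    then have "(2 * pi) powr a * (norm \<xi> powr a * gs (e/2) \<xi>) * gs (e/2) \<xi> \<le> C * gs (e/2) \<xi>"
      unfolding C_def by (intro mult_right_mono mult_left_mono) auto
    moreover have "gs e \<xi> = gs (e/2) \<xi> * gs (e/2) \<xi>" using gs_add[of "e/2" "e/2" \<xi>] by simp
    ultimately show ?thesis unfolding fweight_def by (simp add: powr_mult mult.assoc)
  qed
  have "integrable lborel (\<lambda>\<xi>::'a. C * gs (e/2) \<xi>)" using gs_integrable[of "e/2", where 'a='a] e by simp
  then show ?thesis
    by (rule Bochner_Integration.integrable_bound)
       (use bd in \<open>auto simp: fweight_def intro!: AE_I2 order_trans[OF _ abs_ge_self]\<close>)
qed

text \<open>The arithmetic-geometric mean inequality with the weight split evenly between the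
  factors does the work of Cauchy-Schwarz, as finiteness is all that is wanted. The origin is
  discarded because \<open>0 powr x = 0\<close> there breaks the cancellation of the
  weights.\<close>

lemma fweight_mult_integrable:
  fixes g h :: "'a::euclidean_space \<Rightarrow> complex"
  assumes [measurable]: "g \<in> borel_measurable borel" "h \<in> borel_measurable borel"
    and g: "integrable lborel (\<lambda>\<xi>. fweight (- a) \<xi> * (cmod (g \<xi>))\<^sup>2)"
    and h: "integrable lborel (\<lambda>\<xi>. fweight a \<xi> * (cmod (h \<xi>))\<^sup>2)"
  shows "integrable lborel (\<lambda>\<xi>. g \<xi> * h \<xi>)"
proof (rule Bochner_Integration.integrable_bound)
  show "integrable lborel (\<lambda>\<xi>. fweight (- a) \<xi> * (cmod (g \<xi>))\<^sup>2 + fweight a \<xi> * (cmod (h \<xi>))\<^sup>2)"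
    using g h by simp
  show "AE \<xi> in lborel. norm (g \<xi> * h \<xi>) \<le> norm (fweight (- a) \<xi> * (cmod (g \<xi>))\<^sup>2 + fweight a \<xi> * (cmod (h \<xi>))\<^sup>2)"
  proof (rule AE_mp[OF AE_lborel_singleton[of 0]], intro AE_I2 impI)
    fix \<xi> :: 'a assume "\<xi> \<noteq> 0"
    define W where "W = 2 * pi * norm \<xi>"
    have W: "W > 0" using \<open>\<xi> \<noteq> 0\<close> by (simp add: W_def)
    define x where "x = W powr (- a/2) * cmod (g \<xi>)"
    define y where "y = W powr (a/2) * cmod (h \<xi>)"
    have "x * y = cmod (g \<xi>) * cmod (h \<xi>) * (W powr (- a/2) * W powr (a/2))" by (simp add: x_def y_def)
    then have "x * y = norm (g \<xi> * h \<xi>)" using W by (simp add: powr_add[symmetric] norm_mult)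
    moreover have "x\<^sup>2 = fweight (- a) \<xi> * (cmod (g \<xi>))\<^sup>2" "y\<^sup>2 = fweight a \<xi> * (cmod (h \<xi>))\<^sup>2"
      using W unfolding x_def y_def fweight_def W_def[symmetric]
      by (simp_all add: power_mult_distrib powr_power)
    moreover have "x * y \<le> x\<^sup>2 + y\<^sup>2"
    proof -
      have "0 \<le> x * y" by (simp add: x_def y_def)
      moreover have "2 * (x * y) \<le> x\<^sup>2 + y\<^sup>2" using sum_squares_bound[of x y] by (simp add: mult.assoc)
      ultimately show ?thesis by linarith
    qed
    ultimately show "norm (g \<xi> * h \<xi>) \<le> norm (fweight (- a) \<xi> * (cmod (g \<xi>))\<^sup>2 + fweight a \<xi> * (cmod (h \<xi>))\<^sup>2)" by simp
  qed
qed measurable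

lemma fweight_product_integrable:
  fixes g h :: "'a::euclidean_space \<Rightarrow> complex"
  assumes [measurable]: "g \<in> borel_measurable borel" "h \<in> borel_measurable borel"
    and g: "integrable lborel (\<lambda>\<xi>. fweight a \<xi> * (cmod (g \<xi>))\<^sup>2)"
    and h: "integrable lborel (\<lambda>\<xi>. fweight a \<xi> * (cmod (h \<xi>))\<^sup>2)"
  shows "integrable lborel (\<lambda>\<xi>. complex_of_real (fweight a \<xi>) * (g \<xi> * h \<xi>))"
proof (rule Bochner_Integration.integrable_bound)
  show "integrable lborel (\<lambda>\<xi>. fweight a \<xi> * (cmod (g \<xi>))\<^sup>2 + fweight a \<xi> * (cmod (h \<xi>))\<^sup>2)"
    using g h by simp
  show "AE \<xi> in lborel. norm (complex_of_real (fweight a \<xi>) * (g \<xi> * h \<xi>)) \<le> norm (fweight a \<xi> * (cmod (g \<xi>))\<^sup>2 + fweight a \<xi> * (cmod (h \<xi>))\<^sup>2)"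
  proof (rule AE_I2, goal_cases)
    case (1 \<xi>)
    have w: "0 \<le> fweight a \<xi>" by (simp add: fweight_def)
    have "cmod (g \<xi>) * cmod (h \<xi>) \<le> (cmod (g \<xi>))\<^sup>2 + (cmod (h \<xi>))\<^sup>2"
    proof -
      have "0 \<le> cmod (g \<xi>) * cmod (h \<xi>)" by simp
      moreover have "2 * (cmod (g \<xi>) * cmod (h \<xi>)) \<le> (cmod (g \<xi>))\<^sup>2 + (cmod (h \<xi>))\<^sup>2"
        using sum_squares_bound[of "cmod (g \<xi>)" "cmod (h \<xi>)"] by (simp add: mult.assoc)
      ultimately show ?thesis by linarith
    qed
    from mult_left_mono[OF this w] w show ?case
      by (simp add: norm_mult distrib_left)
  qed
qed (auto simp: fweight_def)

text \<open>Large times see low frequencies: this part of the Riesz weight decays like a Gaussian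
  but keeps the singularity at the origin. Its counterpart \<open>w_high\<close> is bounded and
  keeps the algebraic tail.\<close>

definition w_low :: "real \<Rightarrow> 'a::euclidean_space \<Rightarrow> real" where
  "w_low a \<xi> = (LINT t|lborel. indicator {1..} t * kern a t * gs t \<xi>)"

definition w_high :: "real \<Rightarrow> 'a::euclidean_space \<Rightarrow> real" where
  "w_high a \<xi> = (LINT t|lborel. indicator {0<..<1} t * kern a t * gs t \<xi>)"

lemma borel_measurable_w[measurable]:
  "w_low a \<in> borel_measurable (borel :: 'a::euclidean_space measure)"
  "w_high a \<in> borel_measurable (borel :: 'a::euclidean_space measure)"
  unfolding w_low_def[abs_def] w_high_def[abs_def] by measurable

lemma
  fixes \<xi> :: "'a::euclidean_space"
  assumes a: "a > 0" and \<xi>: "\<xi> \<noteq> 0"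
  shows w_split: "fweight (- a) \<xi> = w_high a \<xi> + w_low a \<xi>"
    and w_low_le: "w_low a \<xi> \<le> 2 powr (a/2) * (fweight (- a) \<xi> * gs (1/2) \<xi>)"
    and w_low_nonneg: "0 \<le> w_low a \<xi>"
proof -
  note k = kern_nonneg[OF a]
  have i: "integrable lborel (\<lambda>t. indicator A t * kern a t * gs t \<xi>)" if "A \<in> sets borel" for A
    by (rule Bochner_Integration.integrable_bound[OF kern_integrable[OF assms]])
       (use that k in \<open>auto simp: indicator_def\<close>)
  have "fweight (- a) \<xi> = (LINT t|lborel. indicator {0<..<1} t * kern a t * gs t \<xi> + indicator {1..} t * kern a t * gs t \<xi>)"
    unfolding kern_integral[OF assms, symmetric] by (intro Bochner_Integration.integral_cong) (auto simp: indicator_def kern_def)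
  also have "\<dots> = w_high a \<xi> + w_low a \<xi>"
    unfolding w_high_def w_low_def by (intro Bochner_Integration.integral_add i) auto
  finally show "fweight (- a) \<xi> = w_high a \<xi> + w_low a \<xi>" .
  show "0 \<le> w_low a \<xi>" unfolding w_low_def using k by (intro integral_nonneg_AE AE_I2) auto
  \<comment> \<open>Half of the time \<open>t\<close> rebuilds the full weight at the frequency
    \<open>\<eta>\<close>, where \<open>gs t \<eta> = gs (t/2) \<xi>\<close>; homogeneity then costs
    \<open>2 powr (a/2)\<close>. The other half is at least 1/2 and leaves the Gaussian
    factor.\<close>
  define \<eta> where "\<eta> = (1 / sqrt 2) *\<^sub>R \<xi>"
  have \<eta>: "\<eta> \<noteq> 0" using \<xi> by (simp add: \<eta>_def)
  have g: "gs t \<eta> = gs (t/2) \<xi>" for t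
    unfolding gs_def \<eta>_def by (simp add: power_mult_distrib power_divide)
  have "w_low a \<xi> \<le> (LINT t|lborel. gs (1/2) \<xi> * (kern a t * gs t \<eta>))"
    unfolding w_low_def
  proof (rule integral_mono)
    show "integrable lborel (\<lambda>t. gs (1/2) \<xi> * (kern a t * gs t \<eta>))" using kern_integrable[OF a \<eta>] by simp
    fix t :: real
    show "indicator {1..} t * kern a t * gs t \<xi> \<le> gs (1/2) \<xi> * (kern a t * gs t \<eta>)"
    proof (cases "t \<ge> 1")
      case True
      have "gs t \<xi> = gs (t/2) \<xi> * gs (1/2) \<xi> * gs ((t - 1)/2) \<xi>"
        unfolding gs_add[symmetric] by (simp add: add_divide_distrib[symmetric])
      also have "\<dots> \<le> gs (t/2) \<xi> * gs (1/2) \<xi> * 1" using True by (intro mult_left_mono gs_le_1) auto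
      finally have "kern a t * gs t \<xi> \<le> kern a t * (gs (t/2) \<xi> * gs (1/2) \<xi>)" using k by (intro mult_left_mono) auto
      then show ?thesis using True by (simp add: g ac_simps)
    qed (use k in simp)
  qed (rule i, simp)
  also have "\<dots> = gs (1/2) \<xi> * fweight (- a) \<eta>" by (simp add: kern_integral[OF a \<eta>])
  also have "fweight (- a) \<eta> = 2 powr (a/2) * fweight (- a) \<xi>"
  proof -
    have "1 / sqrt 2 = 2 powr (- (1/2))"
      by (subst powr_minus, subst powr_half_sqrt) (simp_all only: inverse_eq_divide zero_le_numeral)
    then have "2 * pi * norm \<eta> = (2 * pi * norm \<xi>) * 2 powr (- (1/2))" by (simp add: \<eta>_def)
    then have "fweight (- a) \<eta> = (2 * pi * norm \<xi>) powr (- a) * (2 powr (- (1/2))) powr (- a)"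
      unfolding fweight_def by (simp only: powr_mult)
    also have "(2 powr (- (1/2))) powr (- a) = 2 powr (a/2)" by (simp add: powr_powr)
    finally show ?thesis unfolding fweight_def by simp
  qed
  finally show "w_low a \<xi> \<le> 2 powr (a/2) * (fweight (- a) \<xi> * gs (1/2) \<xi>)" by (simp add: ac_simps)
qed

section \<open>The Euler--Lagrange equation\<close>

lemma is_dist_FT_loc: "is_dist_FT F f \<Longrightarrow> loc_integrable f" unfolding is_dist_FT_def by simp

lemma is_dist_FT_measurable: "is_dist_FT F f \<Longrightarrow> f \<in> borel_measurable borel"
  unfolding is_dist_FT_def loc_integrable_def by simp

lemma loc_integrable_lin:
  assumes "loc_integrable f" "loc_integrable g"
  shows "loc_integrable (\<lambda>x. f x + c * g x)"
  unfolding loc_integrable_def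
proof (intro conjI allI impI)
  show "(\<lambda>x. f x + c * g x) \<in> borel_measurable lborel" using assms unfolding loc_integrable_def by auto
  fix K :: "'a set" assume "compact K"
  with assms have "integrable lborel (\<lambda>x. indicator K x *\<^sub>R f x)" "integrable lborel (\<lambda>x. indicator K x *\<^sub>R g x)"
    unfolding loc_integrable_def set_integrable_def by auto
  then have "integrable lborel (\<lambda>x. indicator K x *\<^sub>R f x + c * (indicator K x *\<^sub>R g x))"
    by (intro Bochner_Integration.integrable_add integrable_mult_right)
  then show "set_integrable lborel K (\<lambda>x. f x + c * g x)"
    unfolding set_integrable_def by (simp add: scaleR_add_right)
qed

lemma is_dist_FT_unique:
  assumes "is_dist_FT F f" "is_dist_FT F g"
  shows "AE x in lborel. f x = g x"
proof -
  have "AE x in lborel. f x + (-1) * g x = 0"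
  proof (rule AE_zero_if_test)
    show "loc_integrable (\<lambda>x. f x + (-1) * g x)" using assms by (intro loc_integrable_lin is_dist_FT_loc)
    fix \<phi> :: "'a \<Rightarrow> real" assume t: "test_fn \<phi>"
    have "(LINT x|lborel. f x * complex_of_real (\<phi> x)) = (LINT x|lborel. g x * complex_of_real (\<phi> x))"
      using assms t unfolding is_dist_FT_def by metis
    then show "(LINT x|lborel. (f x + (-1) * g x) * complex_of_real (\<phi> x)) = 0"
      using loc_integrable_test[OF is_dist_FT_loc[OF assms(1)] t] loc_integrable_test[OF is_dist_FT_loc[OF assms(2)] t]
      by (simp add: left_diff_distrib)
  qed
  then show ?thesis by eventually_elim simp
qed

lemma is_dist_FT_dist_FT: "is_dist_FT F f \<Longrightarrow> is_dist_FT F (dist_FT F)"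
  unfolding dist_FT_def by (erule someI[of "is_dist_FT F"])

text \<open>The energy is written with the chosen transform \<open>dist_FT\<close>, so every
  computation with an explicit transform passes through this equality.\<close>

lemma dist_FT_AE: "is_dist_FT F f \<Longrightarrow> AE x in lborel. dist_FT F x = f x"
  using is_dist_FT_unique is_dist_FT_dist_FT by blast

lemma dist_FT_weight:
  fixes f :: "'a::euclidean_space \<Rightarrow> complex"
  assumes f: "is_dist_FT F f" and i: "integrable lborel (\<lambda>\<xi>. fweight s \<xi> * (cmod (f \<xi>))\<^sup>2)"
  shows "integrable lborel (\<lambda>\<xi>. fweight s \<xi> * (cmod (dist_FT F \<xi>))\<^sup>2)"
proof -
  note [measurable] = is_dist_FT_measurable[OF f] is_dist_FT_measurable[OF is_dist_FT_dist_FT[OF f]]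
  have "AE \<xi> in lborel. fweight s \<xi> * (cmod (f \<xi>))\<^sup>2 = fweight s \<xi> * (cmod (dist_FT F \<xi>))\<^sup>2"
    using dist_FT_AE[OF f] by eventually_elim simp
  from integrable_cong_AE_imp[OF i _ this] show ?thesis unfolding fweight_def by simp
qed

lemma Hneg_dist_FT:
  assumes "\<rho> \<in> Hneg a"
  shows "is_dist_FT \<rho> (dist_FT \<rho>)" "integrable lborel (\<lambda>\<xi>. fweight (- a) \<xi> * (cmod (dist_FT \<rho> \<xi>))\<^sup>2)"
  using assms is_dist_FT_dist_FT dist_FT_weight unfolding Hneg_def by blast+

lemma Hpos_dist_FT:
  fixes V :: "'a::euclidean_space \<Rightarrow> real"
  assumes V: "V \<in> Hpos a" and a: "0 \<le> a"
  shows "is_dist_FT V (dist_FT V)" "integrable lborel (\<lambda>\<xi>. fweight a \<xi> * (cmod (dist_FT V \<xi>))\<^sup>2)"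
proof -
  let ?X = "\<lambda>\<phi>. fourier (\<lambda>y::'a. complex_of_real (\<phi> y))"
  obtain g \<phi>s where g: "is_dist_FT V g" and t: "\<And>n. test_fn (\<phi>s n)"
    and lim: "(\<lambda>n. \<integral>\<^sup>+\<xi>. ennreal (fweight a \<xi> * (cmod (?X (\<phi>s n) \<xi> - g \<xi>))\<^sup>2) \<partial>lborel) \<longlonglongrightarrow> 0"
    using V unfolding Hpos_def by blast
  show "is_dist_FT V (dist_FT V)" by (rule is_dist_FT_dist_FT[OF g])
  have [measurable]: "g \<in> borel_measurable borel" by (rule is_dist_FT_measurable[OF g])
  have "\<forall>\<^sub>F n in sequentially. (\<integral>\<^sup>+\<xi>. ennreal (fweight a \<xi> * (cmod (?X (\<phi>s n) \<xi> - g \<xi>))\<^sup>2) \<partial>lborel) < 1"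
    using lim by (rule order_tendstoD) simp
  \<comment> \<open>A single approximant at finite weighted distance suffices, because it has finite
    weighted norm itself.\<close>
  then obtain n where n: "(\<integral>\<^sup>+\<xi>. ennreal (fweight a \<xi> * (cmod (?X (\<phi>s n) \<xi> - g \<xi>))\<^sup>2) \<partial>lborel) < 1"
    by (auto simp: eventually_sequentially)
  have [measurable]: "?X (\<phi>s n) \<in> borel_measurable borel" using fourier_test_integrable[OF t] by auto
  have i1: "integrable lborel (\<lambda>\<xi>. fweight a \<xi> * (cmod (?X (\<phi>s n) \<xi> - g \<xi>))\<^sup>2)"
  proof (rule integrableI_nonneg)
    show "(\<lambda>\<xi>. fweight a \<xi> * (cmod (?X (\<phi>s n) \<xi> - g \<xi>))\<^sup>2) \<in> borel_measurable lborel" unfolding fweight_def by measurable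
    show "(\<integral>\<^sup>+\<xi>. ennreal (fweight a \<xi> * (cmod (?X (\<phi>s n) \<xi> - g \<xi>))\<^sup>2) \<partial>lborel) < \<infinity>"
      using n by (rule order_less_trans) simp
  qed (simp add: fweight_def)
  have i2: "integrable lborel (\<lambda>\<xi>. fweight a \<xi> * (cmod (?X (\<phi>s n) \<xi>))\<^sup>2)"
    using fourier_test_weight[OF t a] by simp
  have "integrable lborel (\<lambda>\<xi>. fweight a \<xi> * (cmod (g \<xi>))\<^sup>2)"
  proof (rule Bochner_Integration.integrable_bound)
    show "integrable lborel (\<lambda>\<xi>. 2 * (fweight a \<xi> * (cmod (?X (\<phi>s n) \<xi> - g \<xi>))\<^sup>2) + 2 * (fweight a \<xi> * (cmod (?X (\<phi>s n) \<xi>))\<^sup>2))"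
      using i1 i2 by auto
    show "AE \<xi> in lborel. norm (fweight a \<xi> * (cmod (g \<xi>))\<^sup>2) \<le>
      norm (2 * (fweight a \<xi> * (cmod (?X (\<phi>s n) \<xi> - g \<xi>))\<^sup>2) + 2 * (fweight a \<xi> * (cmod (?X (\<phi>s n) \<xi>))\<^sup>2))"
    proof (rule AE_I2, goal_cases)
      case (1 \<xi>)
      let ?x = "cmod (?X (\<phi>s n) \<xi> - g \<xi>)" and ?y = "cmod (?X (\<phi>s n) \<xi>)"
      have w: "0 \<le> fweight a \<xi>" by (simp add: fweight_def)
      have "cmod (g \<xi>) \<le> ?x + ?y" using norm_triangle_ineq4[of "?X (\<phi>s n) \<xi>" "?X (\<phi>s n) \<xi> - g \<xi>"] by simp
      then have "(cmod (g \<xi>))\<^sup>2 \<le> (?x + ?y)\<^sup>2" by (intro power_mono) auto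
      also have "\<dots> \<le> 2 * ?x\<^sup>2 + 2 * ?y\<^sup>2" using sum_squares_bound[of ?x ?y] by (simp add: power2_sum)
      finally have "fweight a \<xi> * (cmod (g \<xi>))\<^sup>2 \<le> fweight a \<xi> * (2 * ?x\<^sup>2 + 2 * ?y\<^sup>2)" using w by (rule mult_left_mono)
      then show ?case
        using w by (simp add: algebra_simps)
    qed
  qed (simp add: fweight_def)
  from dist_FT_weight[OF g this] show "integrable lborel (\<lambda>\<xi>. fweight a \<xi> * (cmod (dist_FT V \<xi>))\<^sup>2)" .
qed

section \<open>Gaussian perturbations and their transforms\<close>

definition heat_FT :: "real \<Rightarrow> 'a::euclidean_space \<Rightarrow> 'a \<Rightarrow> complex" where
  "heat_FT e y \<xi> = cis (- 2 * pi * (y \<bullet> \<xi>)) * complex_of_real (gs e \<xi>)"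

lemma heat_FT_measurable[measurable]: "heat_FT e y \<in> borel_measurable borel"
  unfolding heat_FT_def[abs_def] by measurable

lemma heat_FT_integrable: "e > 0 \<Longrightarrow> integrable lborel (heat_FT e y)"
  unfolding heat_FT_def[abs_def] by (intro integrable_cis_mult integrable_of_real gs_integrable) measurable

lemma cmod_heat_FT: "cmod (heat_FT e y \<xi>) = gs e \<xi>"
  unfolding heat_FT_def by (simp add: norm_mult)

lemma is_dist_FT_heat:
  fixes y :: "'a::euclidean_space"
  assumes e: "e > 0"
  shows "is_dist_FT (\<lambda>x. heat e (x - y)) (heat_FT e y)"
  unfolding is_dist_FT_def
proof (intro conjI allI impI)
  show "loc_integrable (heat_FT e y)"
    unfolding loc_integrable_def set_integrable_def
    using heat_FT_integrable[OF e, of y] by (auto intro!: integrable_mult_indicator borel_compact)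
  fix \<phi> :: "'a \<Rightarrow> real" assume t: "test_fn \<phi>"
  note i = test_fn_integrable[OF t]
  note [measurable] = test_fn_measurable[OF t]
  have "(LINT x|lborel. complex_of_real (heat e (x - y)) * fourier (\<lambda>y. complex_of_real (\<phi> y)) x) =
    (LINT x|lborel. (LINT \<xi>|lborel. complex_of_real (heat e (x - y)) * (cis (- 2 * pi * (\<xi> \<bullet> x)) * complex_of_real (\<phi> \<xi>))))"
    unfolding fourier_def by simp
  also have "\<dots> = (LINT \<xi>|lborel. (LINT x|lborel. complex_of_real (heat e (x - y)) * (cis (- 2 * pi * (\<xi> \<bullet> x)) * complex_of_real (\<phi> \<xi>))))"
  proof (rule lborel_Fubini[where g="\<lambda>x. heat e (x - y) * (LINT \<xi>|lborel. \<bar>\<phi> \<xi>\<bar>)"])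
    show "integrable lborel (\<lambda>\<xi>. complex_of_real (heat e (x - y)) * (cis (- 2 * pi * (\<xi> \<bullet> x)) * complex_of_real (\<phi> \<xi>)))" for x
      by (intro integrable_mult_right integrable_cis_mult) (use i in auto)
    show "integrable lborel (\<lambda>x. heat e (x - y) * (LINT \<xi>|lborel. \<bar>\<phi> \<xi>\<bar>))"
      using heat_shift_integrable'[OF e, of y] by simp
  qed (auto simp: norm_mult)
  also have "\<dots> = (LINT \<xi>|lborel. heat_FT e y \<xi> * complex_of_real (\<phi> \<xi>))"
  proof (rule Bochner_Integration.integral_cong[OF refl], goal_cases)
    case (1 \<xi>)
    have "(LINT x|lborel. complex_of_real (heat e (x - y)) * (cis (- 2 * pi * (\<xi> \<bullet> x)) * complex_of_real (\<phi> \<xi>))) =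
      (LINT x|lborel. complex_of_real (heat e (y - x)) * cis (2 * pi * (x \<bullet> - \<xi>))) * complex_of_real (\<phi> \<xi>)"
      unfolding integral_mult_left_zero[symmetric]
      by (intro Bochner_Integration.integral_cong) (simp_all add: ac_simps inner_commute[of \<xi>] heat_commute[of e _ y])
    also have "(LINT x|lborel. complex_of_real (heat e (y - x)) * cis (2 * pi * (x \<bullet> - \<xi>))) = heat_FT e y \<xi>"
      by (subst heat_shift_cis_integral[OF e]) (simp add: heat_FT_def gs_def)
    finally show ?case .
  qed
  finally show "(LINT x|lborel. complex_of_real (heat e (x - y)) * fourier (\<lambda>y. complex_of_real (\<phi> y)) x) =
    (LINT \<xi>|lborel. heat_FT e y \<xi> * complex_of_real (\<phi> \<xi>))" .
qed

lemma is_dist_FT_lin: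
  fixes F G :: "'a::euclidean_space \<Rightarrow> real"
  assumes F: "L1_Linf F" "is_dist_FT F f" and G: "L1_Linf G" "is_dist_FT G g"
  shows "is_dist_FT (\<lambda>x. F x + c * G x) (\<lambda>\<xi>. f \<xi> + complex_of_real c * g \<xi>)"
  unfolding is_dist_FT_def
proof (intro conjI allI impI)
  show "loc_integrable (\<lambda>\<xi>. f \<xi> + complex_of_real c * g \<xi>)"
    using F G by (intro loc_integrable_lin is_dist_FT_loc)
  fix \<phi> :: "'a \<Rightarrow> real" assume t: "test_fn \<phi>"
  let ?X = "fourier (\<lambda>y. complex_of_real (\<phi> y))"
  have iF: "integrable lborel (\<lambda>x. complex_of_real (F x) * ?X x)" and iG: "integrable lborel (\<lambda>x. complex_of_real (G x) * ?X x)"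
    by (rule L1_Linf_mult_integrable[OF _ fourier_test_integrable[OF t] fourier_norm_le], fact)+
  have "(LINT x|lborel. complex_of_real (F x + c * G x) * ?X x) =
    (LINT x|lborel. complex_of_real (F x) * ?X x + complex_of_real c * (complex_of_real (G x) * ?X x))"
    by (simp add: algebra_simps)
  also have "\<dots> = (LINT x|lborel. complex_of_real (F x) * ?X x) + complex_of_real c * (LINT x|lborel. complex_of_real (G x) * ?X x)"
    using iF iG by (subst Bochner_Integration.integral_add) auto
  also have "\<dots> = (LINT \<xi>|lborel. f \<xi> * complex_of_real (\<phi> \<xi>)) + complex_of_real c * (LINT \<xi>|lborel. g \<xi> * complex_of_real (\<phi> \<xi>))"
    using F(2) G(2) t unfolding is_dist_FT_def by simp
  also have "\<dots> = (LINT \<xi>|lborel. f \<xi> * complex_of_real (\<phi> \<xi>) + complex_of_real c * (g \<xi> * complex_of_real (\<phi> \<xi>)))"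
    using loc_integrable_test[OF is_dist_FT_loc[OF F(2)] t] loc_integrable_test[OF is_dist_FT_loc[OF G(2)] t]
    by (subst Bochner_Integration.integral_add) auto
  also have "\<dots> = (LINT \<xi>|lborel. (f \<xi> + complex_of_real c * g \<xi>) * complex_of_real (\<phi> \<xi>))"
    by (simp add: algebra_simps)
  finally show "(LINT x|lborel. complex_of_real (F x + c * G x) * ?X x) =
    (LINT \<xi>|lborel. (f \<xi> + complex_of_real c * g \<xi>) * complex_of_real (\<phi> \<xi>))" .
qed

text \<open>The odd power |s|^(r-1) s. For r = q - 1 it is the derivative of |s|^q / q, and its
  continuous inverse \<open>spow (1 / r)\<close> recovers the minimizer from the equation.\<close>

definition spow :: "real \<Rightarrow> real \<Rightarrow> real" where
  "spow r s = sgn s * \<bar>s\<bar> powr r"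

lemma abs_spow: "\<bar>spow r s\<bar> = \<bar>s\<bar> powr r"
  unfolding spow_def by (auto simp: abs_mult sgn_if)

lemma spow_mult: "r > 0 \<Longrightarrow> spow r s * s = \<bar>s\<bar> powr (r + 1)"
  unfolding spow_def by (cases "s = 0") (auto simp: powr_add sgn_if)

lemma spow_inverse: "r > 0 \<Longrightarrow> spow (1 / r) (spow r s) = s"
  unfolding spow_def[of "1/r"] abs_spow unfolding spow_def by (auto simp: powr_powr sgn_mult sgn_if)

lemma borel_measurable_spow[measurable]: "spow r \<in> borel_measurable borel"
  unfolding spow_def[abs_def] by measurable

lemma isCont_spow: "r > 0 \<Longrightarrow> isCont (spow r) s"
proof -
  assume r: "r > 0"
  have eq: "spow r = (\<lambda>s. (max 0 s) powr r - (max 0 (- s)) powr r)"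
    using r by (auto simp: spow_def fun_eq_iff sgn_if max_def)
  show "isCont (spow r) s" unfolding eq using r
    by (intro continuous_intros) auto
qed

text \<open>Convexity of the power q, obtained from Young's inequality with exponents q and q/(q-1).
  It replaces differentiation under the integral in the first variation.\<close>

lemma spow_tangent:
  assumes q: "q > 1"
  shows "\<bar>c\<bar> powr q - \<bar>a\<bar> powr q \<le> q * (spow (q - 1) c * (c - a))"
proof -
  have "\<bar>a\<bar> * \<bar>c\<bar> powr (q - 1) \<le> \<bar>a\<bar> powr q / q + (\<bar>c\<bar> powr (q - 1)) powr (q / (q - 1)) / (q / (q - 1))"
    by (rule Youngs_inequality) (use q in \<open>auto simp: field_simps\<close>)
  also have "(\<bar>c\<bar> powr (q - 1)) powr (q / (q - 1)) = \<bar>c\<bar> powr q" using q by (simp add: powr_powr)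
  finally have "q * (\<bar>a\<bar> * \<bar>c\<bar> powr (q - 1)) \<le> q * (\<bar>a\<bar> powr q / q + \<bar>c\<bar> powr q / (q / (q - 1)))"
    using q by (intro mult_left_mono) auto
  also have "\<dots> = \<bar>a\<bar> powr q + (q - 1) * \<bar>c\<bar> powr q" using q by (simp add: field_simps)
  finally have 1: "q * (\<bar>a\<bar> * \<bar>c\<bar> powr (q - 1)) \<le> \<bar>a\<bar> powr q + (q - 1) * \<bar>c\<bar> powr q" .
  have "spow (q - 1) c * a \<le> \<bar>a\<bar> * \<bar>c\<bar> powr (q - 1)"
    using abs_ge_self[of "spow (q - 1) c * a"] by (simp add: abs_mult abs_spow mult.commute)
  then have "q * (spow (q - 1) c * a) \<le> q * (\<bar>a\<bar> * \<bar>c\<bar> powr (q - 1))" using q by (intro mult_left_mono) auto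
  with 1 have "q * (spow (q - 1) c * a) \<le> \<bar>a\<bar> powr q + (q - 1) * \<bar>c\<bar> powr q" by linarith
  moreover have "spow (q - 1) c * c = \<bar>c\<bar> powr q" using spow_mult[of "q - 1" c] q by simp
  ultimately show ?thesis by (simp add: right_diff_distrib) (simp add: algebra_simps)
qed

lemma powr_add_le:
  assumes "q > 0" "0 \<le> x" "0 \<le> (y::real)"
  shows "(x + y) powr q \<le> 2 powr q * (x powr q + y powr q)"
proof -
  have "(x + y) powr q \<le> (2 * max x y) powr q" using assms by (intro powr_mono2) auto
  also have "\<dots> = 2 powr q * (max x y) powr q" using assms by (simp add: powr_mult)
  also have "\<dots> \<le> 2 powr q * (x powr q + y powr q)" by (intro mult_left_mono) (auto simp: max_def)
  finally show ?thesis .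
qed

text \<open>Values above 1 are bounded by their power q, the others by 1. The cases
  \<open>s = 1\<close> and \<open>s = q - 1\<close> place the minimizer and its signed power in the
  working class.\<close>

lemma Lq_L1_Linf:
  fixes \<rho> :: "'a::euclidean_space \<Rightarrow> real"
  assumes "\<rho> \<in> Lq q" and s: "0 \<le> s" "s \<le> q"
  shows "L1_Linf (\<lambda>x. \<bar>\<rho> x\<bar> powr s)"
proof (rule L1_LinfI[of _ "\<lambda>x. \<bar>\<rho> x\<bar> powr q" 1])
  show "(\<lambda>x. \<bar>\<rho> x\<bar> powr s) \<in> borel_measurable borel" "integrable lborel (\<lambda>x. \<bar>\<rho> x\<bar> powr q)"
    using assms unfolding Lq_def by auto
  fix x
  show "\<bar>\<bar>\<rho> x\<bar> powr s\<bar> \<le> \<bar>\<rho> x\<bar> powr q + 1"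
  proof (cases "\<bar>\<rho> x\<bar> \<le> 1")
    case True
    then have "\<bar>\<rho> x\<bar> powr s \<le> 1" using s powr_mono2[of s "\<bar>\<rho> x\<bar>" 1] by simp
    then show ?thesis by (simp add: add_increasing)
  next
    case False
    then have "\<bar>\<rho> x\<bar> powr s \<le> \<bar>\<rho> x\<bar> powr q" using s by (intro powr_mono) auto
    then show ?thesis by simp
  qed
qed

lemma L1_Linf_from_abs: "F \<in> borel_measurable borel \<Longrightarrow> L1_Linf (\<lambda>x. \<bar>F x\<bar>) \<Longrightarrow> L1_Linf F"
  unfolding L1_Linf_def by auto

lemma borel_measurable_cnj[measurable (raw)]:
  "f \<in> borel_measurable M \<Longrightarrow> (\<lambda>x. cnj (f x)) \<in> borel_measurable M"
  by (rule measurable_compose[where g=cnj]) (auto intro!: borel_measurable_continuous_onI continuous_intros)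

lemma Re_cnj_expand:
  "(cmod (z + complex_of_real t * u))\<^sup>2 = (cmod z)\<^sup>2 + 2 * t * Re (z * cnj u) + t\<^sup>2 * (cmod u)\<^sup>2"
  unfolding cmod_power2 by (simp add: power2_eq_square algebra_simps)

text \<open>First variation in the direction of a heat kernel centred at \<open>y\<close>: testing
  with this direction evaluates the average at \<open>y\<close>, so the equation appears already
  averaged. The power term is handled by its tangent inequality and a limit from both sides.\<close>

theorem euler_lagrange:
  fixes V \<rho> :: "'a::euclidean_space \<Rightarrow> real"
  assumes a: "0 < a" "a < real DIM('a)" and q: "q > 1"
    and min: "is_minimizer q a V \<rho>" and V: "V \<in> Hpos a" "V \<in> Cb" and e: "e > 0"
  shows "heat_conv e (\<lambda>x. spow (q - 1) (\<rho> x)) y = heat_conv e V y -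
    Re (LINT \<xi>|lborel. complex_of_real (fweight (- a) \<xi>) * (cis (2 * pi * (y \<bullet> \<xi>)) * (complex_of_real (gs e \<xi>) * dist_FT \<rho> \<xi>)))"
proof -
  define \<psi> where "\<psi> x = heat e (x - y)" for x :: 'a
  define p where "p = heat_FT e y"
  define g where "g = dist_FT \<rho>"
  define h where "h = dist_FT V"
  define w :: "'a \<Rightarrow> real" where "w = fweight (- a)"
  have [measurable]: "w \<in> borel_measurable borel" unfolding w_def fweight_def[abs_def] by measurable
  have [measurable]: "\<psi> \<in> borel_measurable borel" unfolding \<psi>_def[abs_def] by measurable
  have [measurable]: "p \<in> borel_measurable borel" unfolding p_def by measurable
  have \<rho>: "\<rho> \<in> Lq q" "\<rho> \<in> Hneg a" using min unfolding is_minimizer_def H_alpha_def by auto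
  then have [measurable]: "\<rho> \<in> borel_measurable borel" unfolding Lq_def by simp
  have i\<rho>: "integrable lborel (\<lambda>x. \<bar>\<rho> x\<bar> powr q)" using \<rho> unfolding Lq_def by simp
  have L\<rho>: "L1_Linf \<rho>"
    by (rule L1_Linf_from_abs) (use Lq_L1_Linf[OF \<rho>(1), of 1] q in auto)
  have i\<psi>: "integrable lborel \<psi>" unfolding \<psi>_def[abs_def] by (rule heat_shift_integrable'[OF e])
  have \<psi>0: "0 \<le> \<psi> x" for x unfolding \<psi>_def by simp
  have L\<psi>: "L1_Linf \<psi>" by (rule L1_LinfI[OF _ i\<psi>, of _ 0]) (auto simp: \<psi>0)
  have VL: "L1_Linf V"
    using V(2) unfolding Cb_def bounded_iff
    by (auto intro!: L1_Linf_bounded borel_measurable_continuous_onI)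
  have ftg: "is_dist_FT \<rho> g" and iwg: "integrable lborel (\<lambda>\<xi>. w \<xi> * (cmod (g \<xi>))\<^sup>2)"
    using Hneg_dist_FT[OF \<rho>(2)] unfolding g_def w_def by auto
  have fth: "is_dist_FT V h" and iwh: "integrable lborel (\<lambda>\<xi>. fweight a \<xi> * (cmod (h \<xi>))\<^sup>2)"
    using Hpos_dist_FT[OF V(1)] a unfolding h_def by auto
  have ftp: "is_dist_FT \<psi> p" unfolding \<psi>_def[abs_def] p_def by (rule is_dist_FT_heat[OF e])
  note [measurable] = is_dist_FT_measurable[OF ftg] is_dist_FT_measurable[OF fth]
  have gs2: "(gs e \<xi>)\<^sup>2 = gs (e + e) \<xi>" for \<xi> :: 'a by (simp only: gs_add power2_eq_square)
  have cp: "cmod (p \<xi>) = gs e \<xi>" for \<xi> unfolding p_def by (rule cmod_heat_FT)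
  have iwp: "integrable lborel (\<lambda>\<xi>. w \<xi> * (cmod (p \<xi>))\<^sup>2)"
    unfolding cp gs2 w_def by (rule fweight_gs_integrable) (use a e in auto)
  have iwp': "integrable lborel (\<lambda>\<xi>. fweight a \<xi> * (cmod (p \<xi>))\<^sup>2)"
    unfolding cp gs2 by (rule fweight_pos_gs_integrable) (use a e in auto)
  have iwgp: "integrable lborel (\<lambda>\<xi>. complex_of_real (w \<xi>) * (g \<xi> * cnj (p \<xi>)))"
    using fweight_product_integrable[of g "\<lambda>\<xi>. cnj (p \<xi>)" "- a"] iwg iwp unfolding w_def by simp
  have igh: "integrable lborel (\<lambda>\<xi>. g \<xi> * cnj (h \<xi>))"
    using fweight_mult_integrable[of g "\<lambda>\<xi>. cnj (h \<xi>)" a] iwg iwh unfolding w_def by simp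
  have iph: "integrable lborel (\<lambda>\<xi>. p \<xi> * cnj (h \<xi>))"
    using fweight_mult_integrable[of p "\<lambda>\<xi>. cnj (h \<xi>)" a] iwp iwh unfolding w_def by simp
  \<comment> \<open>Coefficients of the energy along the perturbation: \<open>P\<close> is the slope
    of the pairing, \<open>Q\<close> the slope of half the squared norm, and \<open>S\<close> its
    second-order coefficient.\<close>
  define P where "P = Re (LINT \<xi>|lborel. p \<xi> * cnj (h \<xi>))"
  define Q where "Q = Re (LINT \<xi>|lborel. complex_of_real (w \<xi>) * (g \<xi> * cnj (p \<xi>)))"
  define S where "S = (LINT \<xi>|lborel. w \<xi> * (cmod (p \<xi>))\<^sup>2)"
  define \<sigma> where "\<sigma> t x = \<rho> x + t * \<psi> x" for t x
  have [measurable]: "\<sigma> t \<in> borel_measurable borel" for t unfolding \<sigma>_def[abs_def] by measurable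
  have \<sigma>0: "\<sigma> 0 = \<rho>" unfolding \<sigma>_def by simp
  have ft\<sigma>: "is_dist_FT (\<sigma> t) (\<lambda>\<xi>. g \<xi> + complex_of_real t * p \<xi>)" for t
    unfolding \<sigma>_def[abs_def] by (rule is_dist_FT_lin[OF L\<rho> ftg L\<psi> ftp])
  have wexp: "w \<xi> * (cmod (g \<xi> + complex_of_real t * p \<xi>))\<^sup>2 =
    w \<xi> * (cmod (g \<xi>))\<^sup>2 + (2 * t) * Re (complex_of_real (w \<xi>) * (g \<xi> * cnj (p \<xi>))) + t\<^sup>2 * (w \<xi> * (cmod (p \<xi>))\<^sup>2)" for t \<xi>
    unfolding Re_cnj_expand by (simp add: algebra_simps)
  have iw\<sigma>: "integrable lborel (\<lambda>\<xi>. w \<xi> * (cmod (g \<xi> + complex_of_real t * p \<xi>))\<^sup>2)" for t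
    unfolding wexp using iwg iwp integrable_Re[OF iwgp]
    by (intro Bochner_Integration.integrable_add integrable_mult_right)
  have \<psi>q: "integrable lborel (\<lambda>x. \<psi> x powr q)"
  proof -
    define B where "B = e powr (- real DIM('a) / 2)"
    have "integrable lborel (\<lambda>x. B powr (q - 1) * \<psi> x)" using i\<psi> by simp
    then show ?thesis
    proof (rule Bochner_Integration.integrable_bound)
      show "AE x in lborel. norm (\<psi> x powr q) \<le> norm (B powr (q - 1) * \<psi> x)"
      proof (rule AE_I2, goal_cases)
        case (1 x)
        have "\<psi> x powr q = \<psi> x powr (q - 1) * \<psi> x"
          using powr_add[of "\<psi> x" "q - 1" 1] \<psi>0[of x] by simp
        also have "\<dots> \<le> B powr (q - 1) * \<psi> x"
          using q \<psi>0[of x] heat_le[OF e, of "x - y"] unfolding B_def \<psi>_def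
          by (intro mult_right_mono powr_mono2) auto
        finally show ?case by simp
      qed
    qed measurable
  qed
  \<comment> \<open>One majorant for |t| \<le> 1: it serves both the power q of the perturbed
    function and the integrand of the first variation.\<close>
  define D where "D x = 2 powr q * (\<bar>\<rho> x\<bar> powr q + \<psi> x powr q)" for x
  have iD: "integrable lborel D" unfolding D_def[abs_def] using i\<rho> \<psi>q by auto
  have \<sigma>_le: "\<bar>\<sigma> t x\<bar> \<le> \<bar>\<rho> x\<bar> + \<psi> x" if "\<bar>t\<bar> \<le> 1" for t x
  proof -
    have "\<bar>\<sigma> t x\<bar> \<le> \<bar>\<rho> x\<bar> + \<bar>t\<bar> * \<psi> x"
      unfolding \<sigma>_def using \<psi>0[of x] by (metis abs_mult abs_of_nonneg abs_triangle_ineq)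
    also have "\<bar>t\<bar> * \<psi> x \<le> 1 * \<psi> x" using that \<psi>0 by (intro mult_right_mono)
    finally show ?thesis by simp
  qed
  have bd1: "\<bar>\<sigma> t x\<bar> powr q \<le> D x" if "\<bar>t\<bar> \<le> 1" for t x
  proof -
    have "\<bar>\<sigma> t x\<bar> powr q \<le> (\<bar>\<rho> x\<bar> + \<psi> x) powr q" using \<sigma>_le[OF that] q by (intro powr_mono2) auto
    also have "\<dots> \<le> D x" unfolding D_def using q \<psi>0 by (intro powr_add_le) auto
    finally show ?thesis .
  qed
  have bd2: "\<bar>spow (q - 1) (\<sigma> t x) * \<psi> x\<bar> \<le> D x" if "\<bar>t\<bar> \<le> 1" for t x
  proof -
    have "\<bar>spow (q - 1) (\<sigma> t x) * \<psi> x\<bar> \<le> (\<bar>\<rho> x\<bar> + \<psi> x) powr (q - 1) * (\<bar>\<rho> x\<bar> + \<psi> x)"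
      unfolding abs_mult abs_spow using \<sigma>_le[OF that, of x] q \<psi>0[of x] by (intro mult_mono powr_mono2) auto
    also have "\<dots> = (\<bar>\<rho> x\<bar> + \<psi> x) powr q"
      using powr_add[of "\<bar>\<rho> x\<bar> + \<psi> x" "q - 1" 1] \<psi>0[of x] by simp
    also have "\<dots> \<le> D x" unfolding D_def using q \<psi>0 by (intro powr_add_le) auto
    finally show ?thesis .
  qed
  have D0: "0 \<le> D x" for x unfolding D_def by simp
  have i\<sigma>: "integrable lborel (\<lambda>x. \<bar>\<sigma> t x\<bar> powr q)" if "\<bar>t\<bar> \<le> 1" for t
    by (rule Bochner_Integration.integrable_bound[OF iD]) (use bd1[OF that] D0 in auto)
  have is\<sigma>: "integrable lborel (\<lambda>x. spow (q - 1) (\<sigma> t x) * \<psi> x)" if "\<bar>t\<bar> \<le> 1" for t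
    by (rule Bochner_Integration.integrable_bound[OF iD]) (use bd2[OF that] D0 in auto)
  have \<sigma>H: "\<sigma> t \<in> H_alpha q a" if "\<bar>t\<bar> \<le> 1" for t
    using i\<sigma>[OF that] ft\<sigma> iw\<sigma> unfolding H_alpha_def Lq_def Hneg_def w_def by auto
  have N: "Hneg_norm_sq a (\<sigma> t) = (LINT \<xi>|lborel. w \<xi> * (cmod (g \<xi>))\<^sup>2) + 2 * t * Q + t\<^sup>2 * S" for t
  proof -
    have "Hneg_norm_sq a (\<sigma> t) = (LINT \<xi>|lborel. w \<xi> * (cmod (g \<xi> + complex_of_real t * p \<xi>))\<^sup>2)"
      unfolding Hneg_norm_sq_def w_def[symmetric]
    proof (rule integral_cong_AE)
      show "AE \<xi> in lborel. w \<xi> * (cmod (dist_FT (\<sigma> t) \<xi>))\<^sup>2 = w \<xi> * (cmod (g \<xi> + complex_of_real t * p \<xi>))\<^sup>2"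
        using dist_FT_AE[OF ft\<sigma>[of t]] by eventually_elim simp
    qed (use is_dist_FT_measurable[OF is_dist_FT_dist_FT[OF ft\<sigma>[of t]]] in auto)
    also have "\<dots> = (LINT \<xi>|lborel. w \<xi> * (cmod (g \<xi>))\<^sup>2) + (LINT \<xi>|lborel. (2 * t) * Re (complex_of_real (w \<xi>) * (g \<xi> * cnj (p \<xi>)))) + (LINT \<xi>|lborel. t\<^sup>2 * (w \<xi> * (cmod (p \<xi>))\<^sup>2))"
      unfolding wexp Bochner_Integration.integral_add[OF Bochner_Integration.integrable_add[OF iwg
          integrable_mult_right[OF integrable_Re[OF iwgp]]] integrable_mult_right[OF iwp]]
        Bochner_Integration.integral_add[OF iwg integrable_mult_right[OF integrable_Re[OF iwgp]]] ..
    also have "(LINT \<xi>|lborel. (2 * t) * Re (complex_of_real (w \<xi>) * (g \<xi> * cnj (p \<xi>)))) = 2 * t * Q"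
      unfolding Q_def integral_Re[OF iwgp, symmetric] by (rule integral_mult_right_zero)
    also have "(LINT \<xi>|lborel. t\<^sup>2 * (w \<xi> * (cmod (p \<xi>))\<^sup>2)) = t\<^sup>2 * S"
      unfolding S_def by (rule integral_mult_right_zero)
    finally show ?thesis .
  qed
  have pair: "pairing (\<sigma> t) V = Re (LINT \<xi>|lborel. g \<xi> * cnj (h \<xi>)) + t * P" for t
  proof -
    have "(LINT \<xi>|lborel. dist_FT (\<sigma> t) \<xi> * cnj (h \<xi>)) = (LINT \<xi>|lborel. g \<xi> * cnj (h \<xi>) + complex_of_real t * (p \<xi> * cnj (h \<xi>)))"
    proof (rule integral_cong_AE)
      show "AE \<xi> in lborel. dist_FT (\<sigma> t) \<xi> * cnj (h \<xi>) = g \<xi> * cnj (h \<xi>) + complex_of_real t * (p \<xi> * cnj (h \<xi>))"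
        using dist_FT_AE[OF ft\<sigma>[of t]] by eventually_elim (simp add: algebra_simps)
    qed (use is_dist_FT_measurable[OF is_dist_FT_dist_FT[OF ft\<sigma>[of t]]] in auto)
    also have "\<dots> = (LINT \<xi>|lborel. g \<xi> * cnj (h \<xi>)) + complex_of_real t * (LINT \<xi>|lborel. p \<xi> * cnj (h \<xi>))"
      using igh iph by (subst Bochner_Integration.integral_add) auto
    finally show ?thesis unfolding pairing_def P_def h_def[symmetric] by simp
  qed
  define A where "A t = (LINT x|lborel. spow (q - 1) (\<sigma> t x) * \<psi> x)" for t
  \<comment> \<open>The tangent is taken at the perturbed function, not at \<open>\<rho>\<close>:
    this bounds the increment of the power term from above for both signs of \<open>t\<close>, which
    is the direction minimality can use.\<close>
  have key: "0 \<le> t * (A t - P + Q + t / 2 * S)" if t: "\<bar>t\<bar> \<le> 1" for t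
  proof -
    have "energy q a V (\<sigma> 0) \<le> energy q a V (\<sigma> t)"
      using min \<sigma>H[OF t] unfolding is_minimizer_def \<sigma>0 by blast
    then have 1: "(1 / q) * (LINT x|lborel. \<bar>\<sigma> 0 x\<bar> powr q) \<le> (1 / q) * (LINT x|lborel. \<bar>\<sigma> t x\<bar> powr q) - t * P + t * Q + t\<^sup>2 / 2 * S"
      unfolding energy_def N pair by (simp add: algebra_simps)
    have "(LINT x|lborel. \<bar>\<sigma> t x\<bar> powr q) - (LINT x|lborel. \<bar>\<sigma> 0 x\<bar> powr q) = (LINT x|lborel. \<bar>\<sigma> t x\<bar> powr q - \<bar>\<sigma> 0 x\<bar> powr q)"
      by (rule Bochner_Integration.integral_diff[symmetric]) (use i\<sigma> t in auto)
    also have "\<dots> \<le> (LINT x|lborel. q * t * (spow (q - 1) (\<sigma> t x) * \<psi> x))"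
    proof (rule integral_mono)
      show "integrable lborel (\<lambda>x. \<bar>\<sigma> t x\<bar> powr q - \<bar>\<sigma> 0 x\<bar> powr q)" using i\<sigma>[OF t] i\<sigma>[of 0] by auto
      show "integrable lborel (\<lambda>x. q * t * (spow (q - 1) (\<sigma> t x) * \<psi> x))" using is\<sigma>[OF t] by (rule integrable_mult_right)
      show "\<bar>\<sigma> t x\<bar> powr q - \<bar>\<sigma> 0 x\<bar> powr q \<le> q * t * (spow (q - 1) (\<sigma> t x) * \<psi> x)" for x
        using spow_tangent[OF q, of "\<sigma> t x" "\<sigma> 0 x"] by (simp add: \<sigma>_def ac_simps)
    qed
    also have "\<dots> = q * t * A t" unfolding A_def by (rule integral_mult_right_zero)
    finally have "(1 / q) * ((LINT x|lborel. \<bar>\<sigma> t x\<bar> powr q) - (LINT x|lborel. \<bar>\<sigma> 0 x\<bar> powr q)) \<le> (1 / q) * (q * t * A t)"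
      using q by (intro mult_left_mono) auto
    then have "(1 / q) * (LINT x|lborel. \<bar>\<sigma> t x\<bar> powr q) - (1 / q) * (LINT x|lborel. \<bar>\<sigma> 0 x\<bar> powr q) \<le> t * A t"
      using q by (simp add: right_diff_distrib)
    with 1 have "0 \<le> t * A t - t * P + t * Q + t\<^sup>2 / 2 * S" by linarith
    then show ?thesis by (simp add: algebra_simps power2_eq_square)
  qed
  have Alim: "(\<lambda>n. A (s n) - P + Q + s n / 2 * S) \<longlonglongrightarrow> A 0 - P + Q + 0 / 2 * S"
    if s: "s \<longlonglongrightarrow> 0" "\<And>n. \<bar>s n\<bar> \<le> 1" for s
  proof (intro tendsto_intros s)
    show "(\<lambda>n. A (s n)) \<longlonglongrightarrow> A 0" unfolding A_def
    proof (rule integral_dominated_convergence[where w=D])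
      show "AE x in lborel. (\<lambda>n. spow (q - 1) (\<sigma> (s n) x) * \<psi> x) \<longlonglongrightarrow> spow (q - 1) (\<sigma> 0 x) * \<psi> x"
      proof (intro AE_I2 tendsto_mult tendsto_const)
        fix x
        have "(\<lambda>n. \<sigma> (s n) x) \<longlonglongrightarrow> \<sigma> 0 x" unfolding \<sigma>_def by (intro tendsto_intros s)
        then show "(\<lambda>n. spow (q - 1) (\<sigma> (s n) x)) \<longlonglongrightarrow> spow (q - 1) (\<sigma> 0 x)"
          using q by (intro isCont_tendsto_compose[OF isCont_spow]) auto
      qed
      show "AE x in lborel. norm (spow (q - 1) (\<sigma> (s n) x) * \<psi> x) \<le> D x" for n
        using bd2[OF s(2)] by (intro AE_I2) simp
    qed (use iD in auto)
  qed auto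
  define s where "s n = 1 / real (Suc n)" for n
  have s: "s \<longlonglongrightarrow> 0" "\<And>n. s n > 0" "\<And>n. s n \<le> 1"
    unfolding s_def using LIMSEQ_inverse_real_of_nat by (auto simp: inverse_eq_divide)
  have "0 \<le> A 0 - P + Q + 0 / 2 * S"
  proof (rule LIMSEQ_le_const[OF Alim[OF s(1)]])
    show "\<bar>s n\<bar> \<le> 1" for n using s(2,3)[of n] by simp
    have "0 \<le> A (s n) - P + Q + s n / 2 * S" for n
    proof -
      have "0 \<le> s n * (A (s n) - P + Q + s n / 2 * S)" using key[of "s n"] s(2,3)[of n] by simp
      then show ?thesis using s(2)[of n] by (simp only: zero_le_mult_iff) linarith
    qed
    then show "\<exists>N. \<forall>n\<ge>N. 0 \<le> A (s n) - P + Q + s n / 2 * S" by blast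
  qed
  moreover have "A 0 - P + Q + 0 / 2 * S \<le> 0"
  proof (rule LIMSEQ_le_const2[OF Alim[of "\<lambda>n. - s n"]])
    show "(\<lambda>n. - s n) \<longlonglongrightarrow> 0" using tendsto_minus[OF s(1)] by simp
    show "\<bar>- s n\<bar> \<le> 1" for n using s(2,3)[of n] by simp
    have "A (- s n) - P + Q + - s n / 2 * S \<le> 0" for n
    proof -
      have "0 \<le> - s n * (A (- s n) - P + Q + - s n / 2 * S)" using key[of "- s n"] s(2,3)[of n] by simp
      then show ?thesis using s(2)[of n] by (simp only: zero_le_mult_iff) linarith
    qed
    then show "\<exists>N. \<forall>n\<ge>N. A (- s n) - P + Q + - s n / 2 * S \<le> 0" by blast
  qed
  ultimately have "A 0 = P - Q" by simp
  moreover have "A 0 = heat_conv e (\<lambda>x. spow (q - 1) (\<rho> x)) y"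
    unfolding A_def heat_conv_def \<sigma>0 \<psi>_def by (simp add: heat_commute[of e _ y] mult.commute)
  \<comment> \<open>To apply \<open>heat_conv_dist_FT\<close> to \<open>V\<close>, integrability of
    \<open>h\<close> times the Gaussian is recovered from that of the pairing integrand by
    conjugating and removing the unimodular phase.\<close>
  moreover have "P = heat_conv e V y"
  proof -
    have cn: "cnj (p \<xi> * cnj (h \<xi>)) = cis (2 * pi * (y \<bullet> \<xi>)) * (h \<xi> * complex_of_real (gs e \<xi>))" for \<xi>
      unfolding p_def heat_FT_def by (simp add: cis_cnj ac_simps)
    have "integrable lborel (\<lambda>\<xi>. cnj (p \<xi> * cnj (h \<xi>)))" using iph by (simp only: integrable_cnj)
    then have "integrable lborel (\<lambda>\<xi>. cis (- (2 * pi * (y \<bullet> \<xi>))) * cnj (p \<xi> * cnj (h \<xi>)))"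
      by (rule integrable_cis_mult) measurable
    moreover have "cis (- (2 * pi * (y \<bullet> \<xi>))) * cnj (p \<xi> * cnj (h \<xi>)) = h \<xi> * complex_of_real (gs e \<xi>)" for \<xi>
      unfolding cn by (simp add: mult.assoc[symmetric] cis_mult)
    ultimately have "integrable lborel (\<lambda>\<xi>. h \<xi> * complex_of_real (gs e \<xi>))" by (simp only:)
    from heat_conv_dist_FT[OF VL fth e this, of y]
    have "complex_of_real (heat_conv e V y) = (LINT \<xi>|lborel. cnj (p \<xi> * cnj (h \<xi>)))" unfolding cn .
    also have "\<dots> = cnj (LINT \<xi>|lborel. p \<xi> * cnj (h \<xi>))" by (rule integral_bounded_linear[OF bounded_linear_cnj iph])
    finally have "Re (complex_of_real (heat_conv e V y)) = Re (cnj (LINT \<xi>|lborel. p \<xi> * cnj (h \<xi>)))" by simp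
    then show ?thesis unfolding P_def by simp
  qed
  moreover have "Q = Re (LINT \<xi>|lborel. complex_of_real (fweight (- a) \<xi>) * (cis (2 * pi * (y \<bullet> \<xi>)) * (complex_of_real (gs e \<xi>) * dist_FT \<rho> \<xi>)))"
    unfolding Q_def w_def g_def p_def heat_FT_def by (simp add: cis_cnj ac_simps)
  ultimately show ?thesis by simp
qed

section \<open>Superpositions of heat averages over time\<close>

definition weight :: "(real \<Rightarrow> real) \<Rightarrow> bool" where
  "weight \<kappa> \<longleftrightarrow> integrable lborel \<kappa> \<and> (\<forall>t. 0 \<le> \<kappa> t) \<and> (\<forall>t\<le>0. \<kappa> t = 0)"

text \<open>The integral is \<open>0\<close> at those (almost everywhere absent) points where the integrand is not integrable in \<open>t\<close>.\<close>

definition heat_mix :: "(real \<Rightarrow> real) \<Rightarrow> ('a::euclidean_space \<Rightarrow> real) \<Rightarrow> 'a \<Rightarrow> real" where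
  "heat_mix \<kappa> F x = (LINT t|lborel. \<kappa> t * heat_conv t F x)"

lemma weightD:
  assumes "weight \<kappa>"
  shows "integrable lborel \<kappa>" "\<kappa> \<in> borel_measurable borel" "0 \<le> \<kappa> t" "t \<le> 0 \<Longrightarrow> \<kappa> t = 0"
  using assms unfolding weight_def by auto

lemma borel_measurable_heat_mix:
  assumes "weight \<kappa>" "F \<in> borel_measurable borel"
  shows "heat_mix \<kappa> F \<in> borel_measurable borel"
proof -
  note [measurable] = weightD(2)[OF assms(1)] assms(2)
  show ?thesis unfolding heat_mix_def[abs_def] by measurable
qed

text \<open>The semigroup preserves the mass of a non-negative function, so the inner integral is
  \<open>\<kappa> t\<close> times a constant.\<close>

lemma heat_mix_pair_integrable:
  fixes f :: "'a::euclidean_space \<Rightarrow> real"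
  assumes \<kappa>: "weight \<kappa>" and f: "integrable lborel f" "\<And>x. 0 \<le> f x"
  shows "integrable (lborel \<Otimes>\<^sub>M lborel) (\<lambda>(t, x). \<kappa> t * heat_conv t f x)"
proof (rule lborel_pair_integrable[where g="\<lambda>t. \<kappa> t * (LINT x|lborel. f x)"])
  note [measurable] = weightD(2)[OF \<kappa>] borel_measurable_integrable[OF f(1)]
  show "(\<lambda>(t, x). \<kappa> t * heat_conv t f x) \<in> borel_measurable (lborel \<Otimes>\<^sub>M lborel)" by measurable
  show "integrable lborel (\<lambda>x. \<kappa> t * heat_conv t f x)" for t
    using heat_conv_L1[OF _ f(1), of t] weightD(4)[OF \<kappa>, of t] by (cases "t > 0") auto
  show "(LINT x|lborel. norm (\<kappa> t * heat_conv t f x)) \<le> \<kappa> t * (LINT x|lborel. f x)" for t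
    using heat_conv_integral[OF _ f(1), of t] weightD(3,4)[OF \<kappa>, of t]
    by (cases "t > 0") (auto simp: abs_mult heat_conv_nonneg[OF f(2)])
  show "integrable lborel (\<lambda>t. \<kappa> t * (LINT x|lborel. f x))" using weightD(1)[OF \<kappa>] by simp
qed

lemma
  fixes f :: "'a::euclidean_space \<Rightarrow> real"
  assumes \<kappa>: "weight \<kappa>" and f: "integrable lborel f" "\<And>x. 0 \<le> f x"
  shows heat_mix_L1: "integrable lborel (heat_mix \<kappa> f)"
    and heat_mix_L1_AE: "AE x in lborel. integrable lborel (\<lambda>t. \<kappa> t * heat_conv t f x)"
  using lborel_pair.integrable_snd[OF heat_mix_pair_integrable[OF assms]]
    lborel_pair.AE_integrable_snd[OF heat_mix_pair_integrable[OF assms]]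
  unfolding heat_mix_def[abs_def] by auto

lemma heat_mix_bound:
  fixes F :: "'a::euclidean_space \<Rightarrow> real"
  assumes \<kappa>: "weight \<kappa>" and F: "F \<in> borel_measurable borel" "integrable lborel f" "\<And>x. \<bar>F x\<bar> \<le> f x + M" "\<And>x. 0 \<le> f x"
    and i: "integrable lborel (\<lambda>t. \<kappa> t * heat_conv t f x)"
  shows "integrable lborel (\<lambda>t. \<kappa> t * heat_conv t F x)" "\<bar>heat_mix \<kappa> F x\<bar> \<le> heat_mix \<kappa> f x + M * (LINT t|lborel. \<kappa> t)"
proof -
  note [measurable] = weightD(2)[OF \<kappa>] F(1)
  have i2: "integrable lborel (\<lambda>t. \<kappa> t * heat_conv t f x + M * \<kappa> t)" using i weightD(1)[OF \<kappa>] by auto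
  have bd: "\<bar>\<kappa> t * heat_conv t F x\<bar> \<le> \<kappa> t * heat_conv t f x + M * \<kappa> t" for t
  proof (cases "t > 0")
    case True
    from mult_left_mono[OF heat_conv_dominated[OF True F, of x] weightD(3)[OF \<kappa>, of t]] weightD(3)[OF \<kappa>, of t]
    show ?thesis by (simp add: abs_mult algebra_simps)
  next
    case False
    then show ?thesis using weightD(4)[OF \<kappa>, of t] by simp
  qed
  show i3: "integrable lborel (\<lambda>t. \<kappa> t * heat_conv t F x)"
    by (rule Bochner_Integration.integrable_bound[OF i2]) (auto intro!: AE_I2 order_trans[OF bd])
  have "\<bar>heat_mix \<kappa> F x\<bar> \<le> (LINT t|lborel. \<bar>\<kappa> t * heat_conv t F x\<bar>)"
    unfolding heat_mix_def by (rule integral_abs_bound)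
  also have "\<dots> \<le> (LINT t|lborel. \<kappa> t * heat_conv t f x + M * \<kappa> t)"
    by (intro integral_mono i2 bd) (use i3 in auto)
  also have "\<dots> = heat_mix \<kappa> f x + M * (LINT t|lborel. \<kappa> t)"
    unfolding heat_mix_def using i weightD(1)[OF \<kappa>] by (subst Bochner_Integration.integral_add) auto
  finally show "\<bar>heat_mix \<kappa> F x\<bar> \<le> heat_mix \<kappa> f x + M * (LINT t|lborel. \<kappa> t)" .
qed

lemma heat_mix_L1_Linf:
  fixes F :: "'a::euclidean_space \<Rightarrow> real"
  assumes \<kappa>: "weight \<kappa>" and F: "L1_Linf F"
  shows "L1_Linf (heat_mix \<kappa> F)"
proof -
  obtain f M where F': "F \<in> borel_measurable borel" "f \<in> borel_measurable borel" "integrable lborel f"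
    "0 \<le> M" "\<And>x. 0 \<le> f x" "\<And>x. \<bar>F x\<bar> \<le> f x + M"
    using F by (rule L1_LinfE) (rule that)
  define M' where "M' = M * (LINT t|lborel. \<kappa> t)"
  note [measurable] = borel_measurable_heat_mix[OF \<kappa> F'(1)] borel_measurable_heat_mix[OF \<kappa> F'(2)]
  show ?thesis
  \<comment> \<open>\<open>L1_LinfI\<close> wants a bound at every point, whereas
    \<open>heat_mix_bound\<close> holds only where the time integral of the averages of
    \<open>f\<close> exists. The maximum enforces the bound everywhere and equals
    \<open>heat_mix \<kappa> f\<close> almost everywhere.\<close>
  proof (rule L1_LinfI[of _ "\<lambda>x. max (heat_mix \<kappa> f x) (\<bar>heat_mix \<kappa> F x\<bar> - M')" M'])
    have "AE x in lborel. heat_mix \<kappa> f x = max (heat_mix \<kappa> f x) (\<bar>heat_mix \<kappa> F x\<bar> - M')"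
      using heat_mix_L1_AE[OF \<kappa> F'(3,5)]
    proof eventually_elim
      case (elim x)
      show ?case using heat_mix_bound(2)[OF \<kappa> F'(1,3,6,5) elim] unfolding M'_def by simp
    qed
    from integrable_cong_AE_imp[OF heat_mix_L1[OF \<kappa> F'(3,5)] _ this]
    show "integrable lborel (\<lambda>x. max (heat_mix \<kappa> f x) (\<bar>heat_mix \<kappa> F x\<bar> - M'))" by simp
  qed auto
qed

lemma heat_conv_L1_Linf:
  fixes F :: "'a::euclidean_space \<Rightarrow> real"
  assumes t: "t > 0" and F: "L1_Linf F"
  shows "L1_Linf (heat_conv t F)"
proof -
  obtain f M where F': "F \<in> borel_measurable borel" "f \<in> borel_measurable borel" "integrable lborel f"
    "0 \<le> M" "\<And>x. 0 \<le> f x" "\<And>x. \<bar>F x\<bar> \<le> f x + M"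
    using F by (rule L1_LinfE) (rule that)
  note [measurable] = F'(1)
  show ?thesis
    by (rule L1_LinfI[OF _ heat_conv_L1[OF t F'(3)], of _ M]) (auto intro: heat_conv_dominated[OF t F'(1,3,6,5)])
qed

lemma heat_conv_heat_mix:
  fixes F :: "'a::euclidean_space \<Rightarrow> real"
  assumes \<kappa>: "weight \<kappa>" and F: "L1_Linf F" and e: "e > 0"
  shows "heat_conv e (heat_mix \<kappa> F) y = (LINT t|lborel. \<kappa> t * heat_conv e (heat_conv t F) y)"
proof -
  obtain f M where F': "F \<in> borel_measurable borel" "f \<in> borel_measurable borel" "integrable lborel f"
    "0 \<le> M" "\<And>x. 0 \<le> f x" "\<And>x. \<bar>F x\<bar> \<le> f x + M"
    using F by (rule L1_LinfE) (rule that)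
  note [measurable] = F'(1) weightD(2)[OF \<kappa>]
  define c where "c = e powr (- real DIM('a) / 2) * (LINT z|lborel. f z) + M"
  have "(LINT t|lborel. (LINT z|lborel. \<kappa> t * (heat e (y - z) * heat_conv t F z))) =
    (LINT z|lborel. (LINT t|lborel. \<kappa> t * (heat e (y - z) * heat_conv t F z)))"
  proof (rule lborel_Fubini[where g="\<lambda>t. \<kappa> t * c"])
    show "integrable lborel (\<lambda>z. \<kappa> t * (heat e (y - z) * heat_conv t F z))" for t
      using heat_conv_integrable[OF heat_conv_L1_Linf[OF _ F] e] weightD(4)[OF \<kappa>, of t] by (cases "t > 0") auto
    show "(LINT z|lborel. norm (\<kappa> t * (heat e (y - z) * heat_conv t F z))) \<le> \<kappa> t * c" for t
    proof (cases "t > 0")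
      case True
      have "(LINT z|lborel. norm (\<kappa> t * (heat e (y - z) * heat_conv t F z))) = \<kappa> t * heat_conv e (\<lambda>z. \<bar>heat_conv t F z\<bar>) y"
        unfolding heat_conv_def[of e] using weightD(3)[OF \<kappa>, of t] by (simp add: abs_mult)
      also have "heat_conv e (\<lambda>z. \<bar>heat_conv t F z\<bar>) y \<le> e powr (- real DIM('a) / 2) * (LINT z|lborel. heat_conv t f z) + M"
        by (rule order_trans[OF abs_ge_self heat_conv_le])
           (use e heat_conv_L1[OF True F'(3)] heat_conv_dominated[OF True F'(1,3,6,5)] heat_conv_nonneg[OF F'(5)] in auto)
      also have "(LINT z|lborel. heat_conv t f z) = (LINT z|lborel. f z)" by (rule heat_conv_integral[OF True F'(3)])
      finally show ?thesis unfolding c_def using weightD(3)[OF \<kappa>, of t] by (simp add: mult_left_mono)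
    qed (use weightD(4)[OF \<kappa>, of t] in simp)
    show "integrable lborel (\<lambda>t. \<kappa> t * c)" using weightD(1)[OF \<kappa>] by simp
  qed measurable
  moreover have "(LINT t|lborel. \<kappa> t * (heat e (y - z) * heat_conv t F z)) = heat e (y - z) * heat_mix \<kappa> F z" for z
    unfolding heat_mix_def integral_mult_right_zero[symmetric] by (simp add: ac_simps)
  ultimately show ?thesis unfolding heat_conv_def[of e] by simp
qed

text \<open>Restriction to times below 1 makes the kernel integrable, hence a \<open>weight\<close>;
  the tail t^(a/2-1) of \<open>kern\<close> has infinite integral.\<close>

definition kern01 :: "real \<Rightarrow> real \<Rightarrow> real" where
  "kern01 a t = indicator {0<..<1} t * kern a t"

lemma kern01_eq: "kern01 a t = pi powr (a/2) * (2 * pi) powr (- a) / Gamma (a/2) * (indicator {0<..<1} t * t powr (a/2 - 1))"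
  unfolding kern01_def kern_def by (auto simp: indicator_def)

lemma weight_kern01: "a > 0 \<Longrightarrow> weight (kern01 a)"
  unfolding weight_def using integrable_powr_01[of "a/2"] kern_nonneg[of a]
  by (auto simp: kern01_eq[abs_def])

text \<open>Every term is compared after averaging, where each has an absolutely convergent Fourier
  integral; the multipliers \<open>w_low\<close> and \<open>w_high\<close> add up to the full
  weight. As the averages agree at all times and points, \<open>AE_zero_if_heat_conv\<close> strips
  them off.\<close>

theorem euler_lagrange_AE:
  fixes V \<rho> :: "'a::euclidean_space \<Rightarrow> real"
  assumes a: "0 < a" "a < real DIM('a)" and q: "q > 1"
    and min: "is_minimizer q a V \<rho>" and V: "V \<in> Hpos a" "V \<in> Cb"
  shows "\<exists>G. continuous_on UNIV G \<and> bounded (range G) \<and>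
    (AE x in lborel. spow (q - 1) (\<rho> x) = G x - heat_mix (kern01 a) \<rho> x)"
proof -
  define g where "g = dist_FT \<rho>"
  define w :: "'a \<Rightarrow> real" where "w = fweight (- a)"
  define \<kappa> where "\<kappa> = kern01 a"
  have \<kappa>: "weight \<kappa>" unfolding \<kappa>_def by (rule weight_kern01[OF a(1)])
  have [measurable]: "w \<in> borel_measurable borel" unfolding w_def fweight_def[abs_def] by measurable
  have \<rho>: "\<rho> \<in> Lq q" "\<rho> \<in> Hneg a" using min unfolding is_minimizer_def H_alpha_def by auto
  then have [measurable]: "\<rho> \<in> borel_measurable borel" unfolding Lq_def by simp
  have L\<rho>: "L1_Linf \<rho>"
    by (rule L1_Linf_from_abs) (use Lq_L1_Linf[OF \<rho>(1), of 1] q in auto)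
  have Lu: "L1_Linf (\<lambda>x. spow (q - 1) (\<rho> x))"
    by (rule L1_Linf_from_abs) (use Lq_L1_Linf[OF \<rho>(1), of "q - 1"] q in \<open>auto simp: abs_spow\<close>)
  have cV: "continuous_on UNIV V" and bV: "bounded (range V)" using V(2) unfolding Cb_def by auto
  have VL: "L1_Linf V"
    using V(2) unfolding Cb_def bounded_iff
    by (auto intro!: L1_Linf_bounded borel_measurable_continuous_onI)
  have ftg: "is_dist_FT \<rho> g" and iwg: "integrable lborel (\<lambda>\<xi>. w \<xi> * (cmod (g \<xi>))\<^sup>2)"
    using Hneg_dist_FT[OF \<rho>(2)] unfolding g_def w_def by auto
  note [measurable] = is_dist_FT_measurable[OF ftg] weightD(2)[OF \<kappa>]
  have gs2: "(gs e \<xi>)\<^sup>2 = gs (e + e) \<xi>" for e and \<xi> :: 'a by (simp only: gs_add power2_eq_square)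
  have igg: "integrable lborel (\<lambda>\<xi>. g \<xi> * complex_of_real (gs t \<xi>))" if "t > 0" for t
    by (rule fweight_mult_integrable[where a=a])
       (use iwg fweight_pos_gs_integrable[of a "t + t", where 'a='a] a that in \<open>auto simp: gs2 w_def\<close>)
  have iwgg: "integrable lborel (\<lambda>\<xi>. complex_of_real (w \<xi>) * (g \<xi> * complex_of_real (gs t \<xi>)))" if "t > 0" for t
    unfolding w_def
    by (rule fweight_product_integrable)
       (use iwg fweight_gs_integrable[of a "t + t", where 'a='a] a that in \<open>auto simp: gs2 w_def\<close>)
  \<comment> \<open>The large-time part of the potential on the Fourier side. The Gaussian decay of
    \<open>w_low\<close> makes it integrable, so its inverse transform \<open>G1\<close> is a
    bounded continuous function.\<close>
  define m where "m \<xi> = complex_of_real (w_low a \<xi>) * g \<xi>" for \<xi>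
  have im: "integrable lborel m"
  proof (rule Bochner_Integration.integrable_bound)
    show "integrable lborel (\<lambda>\<xi>. 2 powr (a/2) *\<^sub>R (complex_of_real (w \<xi>) * (g \<xi> * complex_of_real (gs (1/2) \<xi>))))"
      by (intro integrable_scaleR_right iwgg) simp
    show "AE \<xi> in lborel. norm (m \<xi>) \<le> norm (2 powr (a/2) *\<^sub>R (complex_of_real (w \<xi>) * (g \<xi> * complex_of_real (gs (1/2) \<xi>))))"
    proof (rule AE_mp[OF AE_lborel_singleton[of 0]], intro AE_I2 impI)
      fix \<xi> :: 'a assume \<xi>: "\<xi> \<noteq> 0"
      have "norm (m \<xi>) = w_low a \<xi> * cmod (g \<xi>)" unfolding m_def using w_low_nonneg[OF a(1) \<xi>] by (simp add: norm_mult)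
      also have "\<dots> \<le> 2 powr (a/2) * (w \<xi> * gs (1/2) \<xi>) * cmod (g \<xi>)"
        unfolding w_def using w_low_le[OF a(1) \<xi>] by (intro mult_right_mono) auto
      also have "\<dots> = norm (2 powr (a/2) *\<^sub>R (complex_of_real (w \<xi>) * (g \<xi> * complex_of_real (gs (1/2) \<xi>))))"
        unfolding w_def by (simp add: norm_mult fweight_def)
      finally show "norm (m \<xi>) \<le> norm (2 powr (a/2) *\<^sub>R (complex_of_real (w \<xi>) * (g \<xi> * complex_of_real (gs (1/2) \<xi>))))" .
    qed
  qed (auto simp: m_def[abs_def])
  define G1 where "G1 x = Re (LINT \<xi>|lborel. cis (2 * pi * (\<xi> \<bullet> x)) * m \<xi>)" for x
  have cG1: "continuous_on UNIV G1" unfolding G1_def[abs_def]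
    by (intro continuous_intros continuous_fourier_integral im)
  have bG1: "\<bar>G1 x\<bar> \<le> (LINT \<xi>|lborel. norm (m \<xi>))" for x
    unfolding G1_def
    by (rule order_trans[OF abs_Re_le_cmod order_trans[OF integral_norm_bound]]) (simp add: norm_mult)
  have LG1: "L1_Linf G1" by (rule L1_Linf_bounded[OF borel_measurable_continuous_onI[OF cG1] bG1])
  let ?u = "\<lambda>x. spow (q - 1) (\<rho> x)"
  let ?K = "heat_mix \<kappa> \<rho>"
  have LK: "L1_Linf ?K" by (rule heat_mix_L1_Linf[OF \<kappa> L\<rho>])
  have P\<rho>: "heat_conv t \<rho> x = Re (LINT \<xi>|lborel. cis (2 * pi * (\<xi> \<bullet> x)) * (g \<xi> * complex_of_real (gs t \<xi>)))" if "t > 0" for t x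
    using arg_cong[OF heat_conv_dist_FT[OF L\<rho> ftg that igg[OF that], of x], of Re]
    by (simp only: Re_complex_of_real inner_commute[of x])
  have PP\<rho>: "heat_conv e (heat_conv t \<rho>) y = Re (LINT \<xi>|lborel. cis (2 * pi * (\<xi> \<bullet> y)) * (complex_of_real (gs e \<xi>) * (g \<xi> * complex_of_real (gs t \<xi>))))"
    if "t > 0" "e > 0" for t e y
    using inverse_fourier_heat_conv[OF igg[OF that(1)] that(2), of y] P\<rho>[OF that(1)] by (simp add: heat_conv_def[of e])
  \<comment> \<open>The product of \<open>w_high\<close> with \<open>g\<close> is not known to be
    integrable, so the small-time part gets its Fourier formula only with the extra factor
    \<open>gs e\<close>. Fubini in time and frequency then assembles \<open>w_high\<close>.\<close>
  have PK: "heat_conv e ?K y = Re (LINT \<xi>|lborel. complex_of_real (w_high a \<xi>) * (cis (2 * pi * (\<xi> \<bullet> y)) * (complex_of_real (gs e \<xi>) * g \<xi>)))"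
    if e: "e > 0" for e y
  proof -
    let ?c = "\<lambda>\<xi>. cis (2 * pi * (\<xi> \<bullet> y)) * (complex_of_real (gs e \<xi>) * g \<xi>)"
    have ic: "integrable lborel ?c" using igg[OF e] by (intro integrable_cis_mult) (simp_all add: mult.commute)
    have ict: "integrable lborel (\<lambda>\<xi>. complex_of_real (\<kappa> t * gs t \<xi>) * ?c \<xi>)" for t
    proof (cases "t > 0")
      case True
      show ?thesis
      proof (rule Bochner_Integration.integrable_bound)
        show "integrable lborel (\<lambda>\<xi>. \<kappa> t *\<^sub>R ?c \<xi>)" using ic by (rule integrable_scaleR_right)
        show "AE \<xi> in lborel. norm (complex_of_real (\<kappa> t * gs t \<xi>) * ?c \<xi>) \<le> norm (\<kappa> t *\<^sub>R ?c \<xi>)"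
        proof (rule AE_I2, goal_cases)
          case (1 \<xi>)
          have "gs t \<xi> * norm (?c \<xi>) \<le> 1 * norm (?c \<xi>)" using True by (intro mult_right_mono gs_le_1) auto
          from mult_left_mono[OF this weightD(3)[OF \<kappa>, of t]] weightD(3)[OF \<kappa>, of t]
          show ?case
            by (simp add: norm_mult abs_mult mult.assoc)
        qed
      qed measurable
    qed (use weightD(4)[OF \<kappa>, of t] in simp)
    have pi': "integrable (lborel \<Otimes>\<^sub>M lborel) (\<lambda>(t, \<xi>). complex_of_real (\<kappa> t * gs t \<xi>) * ?c \<xi>)"
    proof (rule lborel_pair_integrable[where g="\<lambda>t. \<kappa> t * (LINT \<xi>|lborel. norm (?c \<xi>))"])
      show "(LINT \<xi>|lborel. norm (complex_of_real (\<kappa> t * gs t \<xi>) * ?c \<xi>)) \<le> \<kappa> t * (LINT \<xi>|lborel. norm (?c \<xi>))" for t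
      proof (cases "t > 0")
        case True
        have "(LINT \<xi>|lborel. norm (complex_of_real (\<kappa> t * gs t \<xi>) * ?c \<xi>)) \<le> (LINT \<xi>|lborel. \<kappa> t * norm (?c \<xi>))"
        proof (rule integral_mono)
          show "integrable lborel (\<lambda>\<xi>. norm (complex_of_real (\<kappa> t * gs t \<xi>) * ?c \<xi>))" using ict by (rule integrable_norm)
          show "integrable lborel (\<lambda>\<xi>. \<kappa> t * norm (?c \<xi>))" using ic by (intro integrable_mult_right integrable_norm)
          fix \<xi> :: 'a
          have "gs t \<xi> * norm (?c \<xi>) \<le> 1 * norm (?c \<xi>)" using True by (intro mult_right_mono gs_le_1) auto
          from mult_left_mono[OF this weightD(3)[OF \<kappa>, of t]] weightD(3)[OF \<kappa>, of t]
          show "norm (complex_of_real (\<kappa> t * gs t \<xi>) * ?c \<xi>) \<le> \<kappa> t * norm (?c \<xi>)"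
            by (simp add: norm_mult abs_mult mult.assoc)
        qed
        then show ?thesis by simp
      qed (use weightD(4)[OF \<kappa>, of t] in simp)
      show "integrable lborel (\<lambda>t. \<kappa> t * (LINT \<xi>|lborel. norm (?c \<xi>)))" using weightD(1)[OF \<kappa>] by simp
    qed (use ict in auto)
    have "heat_conv e ?K y = (LINT t|lborel. \<kappa> t * heat_conv e (heat_conv t \<rho>) y)"
      by (rule heat_conv_heat_mix[OF \<kappa> L\<rho> e])
    also have "\<dots> = (LINT t|lborel. Re (LINT \<xi>|lborel. complex_of_real (\<kappa> t * gs t \<xi>) * ?c \<xi>))"
    proof (rule Bochner_Integration.integral_cong[OF refl], goal_cases)
      case (1 t)
      show ?case
      proof (cases "t > 0")
        case True
        have "\<kappa> t * heat_conv e (heat_conv t \<rho>) y = Re (complex_of_real (\<kappa> t) * (LINT \<xi>|lborel. cis (2 * pi * (\<xi> \<bullet> y)) * (complex_of_real (gs e \<xi>) * (g \<xi> * complex_of_real (gs t \<xi>)))))"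
          unfolding PP\<rho>[OF True e] by simp
        also have "\<dots> = Re (LINT \<xi>|lborel. complex_of_real (\<kappa> t * gs t \<xi>) * ?c \<xi>)"
          unfolding integral_mult_right_zero[symmetric] by (simp add: ac_simps)
        finally show ?thesis .
      qed (use weightD(4)[OF \<kappa>, of t] in simp)
    qed
    also have "\<dots> = Re (LINT t|lborel. (LINT \<xi>|lborel. complex_of_real (\<kappa> t * gs t \<xi>) * ?c \<xi>))"
      by (rule integral_Re[OF lborel_pair.integrable_fst[OF pi']])
    also have "(LINT t|lborel. (LINT \<xi>|lborel. complex_of_real (\<kappa> t * gs t \<xi>) * ?c \<xi>)) = (LINT \<xi>|lborel. (LINT t|lborel. complex_of_real (\<kappa> t * gs t \<xi>) * ?c \<xi>))"
      by (rule lborel_pair.Fubini_integral[OF pi', symmetric])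
    also have "\<dots> = (LINT \<xi>|lborel. complex_of_real (w_high a \<xi>) * ?c \<xi>)"
      unfolding w_high_def \<kappa>_def kern01_def integral_mult_left_zero integral_complex_of_real by simp
    finally show ?thesis .
  qed
  have "AE x in lborel. ?u x + (- (V x + - G1 x) + ?K x) = 0"
  proof (rule AE_zero_if_heat_conv)
    show "L1_Linf (\<lambda>x. ?u x + (- (V x + - G1 x) + ?K x))"
      by (intro L1_Linf_add L1_Linf_minus Lu VL LG1 LK)
    fix e :: real and y :: 'a assume e: "e > 0"
    let ?c = "\<lambda>\<xi>. cis (2 * pi * (\<xi> \<bullet> y)) * (complex_of_real (gs e \<xi>) * g \<xi>)"
    have PG: "heat_conv e G1 y = Re (LINT \<xi>|lborel. complex_of_real (w_low a \<xi>) * ?c \<xi>)"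
    proof -
      have "heat_conv e G1 y = Re (LINT \<xi>|lborel. cis (2 * pi * (\<xi> \<bullet> y)) * (complex_of_real (gs e \<xi>) * m \<xi>))"
        unfolding G1_def[abs_def] by (rule inverse_fourier_heat_conv[OF im e])
      then show ?thesis unfolding m_def by (simp add: ac_simps)
    qed
    have iw: "integrable lborel (\<lambda>\<xi>. complex_of_real (w \<xi>) * ?c \<xi>)"
    proof -
      have "integrable lborel (\<lambda>\<xi>. cis (2 * pi * (\<xi> \<bullet> y)) * (complex_of_real (w \<xi>) * (g \<xi> * complex_of_real (gs e \<xi>))))"
        by (intro integrable_cis_mult iwgg e) measurable
      then show ?thesis by (simp add: ac_simps)
    qed
    have il: "integrable lborel (\<lambda>\<xi>. complex_of_real (w_low a \<xi>) * ?c \<xi>)"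
    proof (rule Bochner_Integration.integrable_bound[OF im])
      show "AE \<xi> in lborel. norm (complex_of_real (w_low a \<xi>) * ?c \<xi>) \<le> norm (m \<xi>)"
      proof (rule AE_I2, goal_cases)
        case (1 \<xi>)
        have "gs e \<xi> * norm (m \<xi>) \<le> 1 * norm (m \<xi>)" using e by (intro mult_right_mono gs_le_1) auto
        then show ?case
          unfolding m_def by (simp add: norm_mult ac_simps)
      qed
    qed measurable
    \<comment> \<open>The splitting of the weight fails at the origin, where
      \<open>fweight (- a)\<close> is 0 by convention; equality almost everywhere suffices.\<close>
    have "(LINT \<xi>|lborel. complex_of_real (w_high a \<xi>) * ?c \<xi>) = (LINT \<xi>|lborel. complex_of_real (w \<xi>) * ?c \<xi> - complex_of_real (w_low a \<xi>) * ?c \<xi>)"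
    proof (rule integral_cong_AE)
      show "AE \<xi> in lborel. complex_of_real (w_high a \<xi>) * ?c \<xi> = complex_of_real (w \<xi>) * ?c \<xi> - complex_of_real (w_low a \<xi>) * ?c \<xi>"
      proof (rule AE_mp[OF AE_lborel_singleton[of 0]], intro AE_I2 impI)
        fix \<xi> :: 'a assume "\<xi> \<noteq> 0"
        from w_split[OF a(1) this] show "complex_of_real (w_high a \<xi>) * ?c \<xi> = complex_of_real (w \<xi>) * ?c \<xi> - complex_of_real (w_low a \<xi>) * ?c \<xi>"
          unfolding w_def by (simp add: distrib_right)
      qed
    qed measurable
    also have "\<dots> = (LINT \<xi>|lborel. complex_of_real (w \<xi>) * ?c \<xi>) - (LINT \<xi>|lborel. complex_of_real (w_low a \<xi>) * ?c \<xi>)"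
      by (rule Bochner_Integration.integral_diff[OF iw il])
    finally have 1: "heat_conv e ?K y = Re (LINT \<xi>|lborel. complex_of_real (w \<xi>) * ?c \<xi>) - heat_conv e G1 y"
      unfolding PK[OF e] PG by simp
    have "heat_conv e ?u y = heat_conv e V y - Re (LINT \<xi>|lborel. complex_of_real (w \<xi>) * ?c \<xi>)"
      using euler_lagrange[OF a q min V e, of y] unfolding w_def g_def by (simp only: inner_commute)
    with 1 show "heat_conv e (\<lambda>x. ?u x + (- (V x + - G1 x) + ?K x)) y = 0"
      using e by (simp only: heat_conv_add heat_conv_minus L1_Linf_add L1_Linf_minus Lu VL LG1 LK)
  qed
  then have "AE x in lborel. ?u x = (V x - G1 x) - ?K x" by eventually_elim simp
  moreover have "continuous_on UNIV (\<lambda>x. V x - G1 x)" using cV cG1 by (intro continuous_intros)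
  moreover have "bounded (range (\<lambda>x. V x - G1 x))"
  proof -
    obtain B where B: "\<And>x. \<bar>V x\<bar> \<le> B" using bV unfolding bounded_iff by auto
    have "\<bar>V x - G1 x\<bar> \<le> B + (LINT \<xi>|lborel. norm (m \<xi>))" for x
      using B[of x] bG1[of x] by linarith
    then show ?thesis unfolding bounded_iff by auto
  qed
  ultimately show ?thesis unfolding \<kappa>_def by (intro exI[of _ "\<lambda>x. V x - G1 x"] conjI)
qed

section \<open>Bootstrap\<close>

text \<open>Chebyshev's truncation at level \<open>s\<close>: above the level the factor (y/s)^(p-1)
  is at least 1 and may be inserted. Averaged in space it bounds \<open>heat_conv\<close> by a level
  plus a heat average of the power p.\<close>

lemma le_split_powr:
  fixes y :: real
  assumes "0 \<le> y" "s > 0" "p \<ge> 1"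
  shows "y \<le> s + s powr (1 - p) * y powr p"
proof (cases "y \<le> s")
  case True
  then show ?thesis by (simp add: add_increasing2)
next
  case False
  then have "y = y powr (1 - p) * y powr p" using assms by (simp add: powr_add[symmetric])
  also have "\<dots> \<le> s powr (1 - p) * y powr p"
    using False assms by (intro mult_right_mono powr_mono2') auto
  finally show ?thesis using assms by simp
qed

lemma heat_conv_split:
  fixes f :: "'a::euclidean_space \<Rightarrow> real"
  assumes f: "L1_Linf f" "\<And>x. 0 \<le> f x" and p: "p \<ge> 1" "integrable lborel (\<lambda>x. f x powr p)"
    and t: "t > 0" and s: "s > 0"
  shows "heat_conv t f x \<le> s + s powr (1 - p) * heat_conv t (\<lambda>x. f x powr p) x"
proof -
  have L: "L1_Linf (\<lambda>x. f x powr p)" by (rule L1_LinfI[OF _ p(2), of _ 0]) (use p in auto)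
  have L2: "L1_Linf (\<lambda>x. s powr (1 - p) * f x powr p)"
    by (rule L1_LinfI[OF _ integrable_mult_right[OF p(2)], of _ _ 0]) (use p in \<open>auto simp: abs_mult\<close>)
  have Ls: "L1_Linf (\<lambda>_::'a. s)" by (rule L1_Linf_bounded[of _ s]) (use s in auto)
  have "heat_conv t f x \<le> heat_conv t (\<lambda>x. s + s powr (1 - p) * f x powr p) x"
    by (intro heat_conv_mono t f L1_Linf_add Ls L2 le_split_powr s p)
  also have "\<dots> = s + heat_conv t (\<lambda>x. s powr (1 - p) * f x powr p) x"
    using heat_conv_add[OF t Ls L2] heat_conv_const[OF t, of s x] by simp
  also have "heat_conv t (\<lambda>x. s powr (1 - p) * f x powr p) x = s powr (1 - p) * heat_conv t (\<lambda>x. f x powr p) x"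
    unfolding heat_conv_def integral_mult_right_zero[symmetric] by (simp add: ac_simps)
  finally show ?thesis .
qed

lemma heat_conv_sup:
  fixes f :: "'a::euclidean_space \<Rightarrow> real"
  assumes f: "L1_Linf f" "\<And>x. 0 \<le> f x" and p: "p \<ge> 1" "integrable lborel (\<lambda>x. f x powr p)" and t: "t > 0"
  shows "heat_conv t f x \<le> (1 + (LINT x|lborel. f x powr p)) * t powr (- (real DIM('a) / (2 * p)))"
proof -
  define b where "b = real DIM('a) / (2 * p)"
  have bp: "real DIM('a) / 2 = b * p" using p by (simp add: b_def)
  \<comment> \<open>The level \<open>t powr (- b)\<close> balances both terms: as d/2 = b p, the
    second exponent is -b (1 - p) - b p = -b.\<close>
  have "heat_conv t f x \<le> t powr (- b) + (t powr (- b)) powr (1 - p) * heat_conv t (\<lambda>x. f x powr p) x"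
    by (rule heat_conv_split[OF f p t]) (use t in simp)
  also have "\<dots> \<le> t powr (- b) + (t powr (- b)) powr (1 - p) * (t powr (- real DIM('a) / 2) * (LINT x|lborel. f x powr p))"
    by (intro add_left_mono mult_left_mono heat_conv_L1_le t p) auto
  also have "(t powr (- b)) powr (1 - p) * (t powr (- real DIM('a) / 2) * (LINT x|lborel. f x powr p)) =
     (LINT x|lborel. f x powr p) * ((t powr (- b)) powr (1 - p) * t powr (- (b * p)))"
    using bp by simp
  also have "(t powr (- b)) powr (1 - p) * t powr (- (b * p)) = t powr (- b)"
    using t by (simp add: powr_powr powr_add[symmetric]) (simp add: algebra_simps)
  finally show ?thesis unfolding b_def by (simp add: algebra_simps)
qed

text \<open>Above the level \<open>s\<close> half of it is absorbed on the left, and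
  \<open>U / s\<close> exceeds 1 there, so any non-negative power of it is a free factor. With
  \<open>m = r - p\<close> this replaces the power 1 - p of the level by 1 - r.\<close>

lemma two_regimes:
  fixes y :: real
  assumes s: "s > 0" and m: "m \<ge> 0" and Z: "Z \<ge> 0" and U: "y \<le> U"
    and split: "y \<le> s / 2 + (s / 2) powr (1 - p) * Z"
  shows "y \<le> s + 2 powr p * s powr (1 - p) * (U / s) powr m * Z"
proof (cases "y \<le> s")
  case True
  moreover have "0 \<le> 2 powr p * s powr (1 - p) * (U / s) powr m * Z" using Z by simp
  ultimately show ?thesis by linarith
next
  case False
  have "(s / 2) powr (1 - p) = s powr (1 - p) * 2 powr (p - 1)"
    using s by (simp add: powr_divide powr_diff)
  then have "2 * (s / 2) powr (1 - p) = s powr (1 - p) * (2 powr 1 * 2 powr (p - 1))" by simp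
  also have "2 powr 1 * 2 powr (p - 1) = (2::real) powr p" by (simp only: powr_add[symmetric]) simp
  finally have 2: "2 * (s / 2) powr (1 - p) = 2 powr p * s powr (1 - p)" by simp
  have "y \<le> 2 * (s / 2) powr (1 - p) * Z" using False split by linarith
  then have "y \<le> 2 powr p * s powr (1 - p) * 1 * Z" unfolding 2 by simp
  also have "\<dots> \<le> 2 powr p * s powr (1 - p) * (U / s) powr m * Z"
  proof (intro mult_right_mono mult_left_mono Z)
    have "1 \<le> U / s" using False U s by simp
    then show "1 \<le> (U / s) powr m" using m by (rule ge_one_powr_ge_zero)
  qed auto
  finally show ?thesis using s by simp
qed

definition pow01 :: "real \<Rightarrow> real \<Rightarrow> real" where
  "pow01 s t = indicator {0<..<1} t * t powr (s - 1)"

lemma weight_pow01: "s > 0 \<Longrightarrow> weight (pow01 s)"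
  unfolding weight_def pow01_def[abs_def] using integrable_powr_01[of s] by auto

text \<open>A pointwise substitute for the Hardy--Littlewood--Sobolev inequality: at each time the average
  \<open>P\<^sub>t f\<close> is either below \<open>A t\<^sup>\<beta>\<^sup>-\<^sup>a\<^sup>/\<^sup>2\<close>, or is controlled by \<open>P\<^sub>t f\<^sup>p\<close> with a factor in which the smoothing
  bound of \<open>heat_conv_sup\<close> enters to the power \<open>r - p\<close>.\<close>

lemma heat_mix_interpolation:
  fixes f :: "'a::euclidean_space \<Rightarrow> real"
  assumes a: "a > 0" and f: "L1_Linf f" "\<And>x. 0 \<le> f x"
    and p: "p \<ge> 1" "integrable lborel (\<lambda>x. f x powr p)" and r: "r \<ge> p"
    and gain: "real DIM('a) / (2 * p) * (r - p) < a * r / 2"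
  obtains c1 c2 \<eta> where "c1 > 0" "c2 \<ge> 0" "\<eta> > 0"
    "AE x in lborel. \<forall>A>0. heat_mix (kern01 a) f x \<le> A * c1 + c2 * A powr (1 - r) * heat_mix (pow01 \<eta>) (\<lambda>x. f x powr p) x"
proof -
  define b where "b = real DIM('a) / (2 * p)"
  define B where "B = 1 + (LINT x|lborel. f x powr p)"
  have B: "B > 0" unfolding B_def by (simp add: add_pos_nonneg integral_nonneg_AE)
  \<comment> \<open>\<open>\<delta>\<close> is the slack in \<open>gain\<close>. The choice of
    \<open>\<beta>\<close> spends at most half of it on making the level integrable in time; the
    remainder \<open>\<eta>\<close> makes the second term integrable.\<close>
  define \<delta> where "\<delta> = a * r / 2 - b * (r - p)"
  have \<delta>: "\<delta> > 0" using gain unfolding \<delta>_def b_def by simp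
  define \<beta> where "\<beta> = \<delta> / (2 * r)"
  have \<beta>: "\<beta> > 0" using \<delta> r p by (simp add: \<beta>_def)
  define \<eta> where "\<eta> = \<delta> - \<beta> * (r - 1)"
  have "\<beta> * (r - 1) \<le> \<beta> * r" using \<beta> by (intro mult_left_mono) auto
  also have "\<beta> * r = \<delta> / 2" using r p by (simp add: \<beta>_def)
  finally have \<eta>: "\<eta> > 0" using \<delta> by (simp add: \<eta>_def)
  define C where "C = pi powr (a/2) * (2 * pi) powr (- a) / Gamma (a/2)"
  have C: "C \<ge> 0" using a unfolding C_def by (auto intro!: divide_nonneg_nonneg Gamma_real_nonneg)
  \<comment> \<open>The summand 1 makes \<open>c1\<close> positive, since the bootstrap divides by
    it.\<close>
  define c1 where "c1 = 1 + C * (LINT t|lborel. pow01 \<beta> t)"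
  define c2 where "c2 = C * 2 powr p * B powr (r - p)"
  note wb = weight_pow01[OF \<beta>]
  note w\<eta> = weight_pow01[OF \<eta>]
  have "0 \<le> (LINT t|lborel. pow01 \<beta> t)" using weightD(3)[OF wb] by (intro integral_nonneg_AE AE_I2)
  then have c1: "c1 > 0" unfolding c1_def using C by (simp add: add_pos_nonneg)
  have c2: "c2 \<ge> 0" unfolding c2_def using C by simp
  let ?P = "\<lambda>t. heat_conv t (\<lambda>x. f x powr p)"
  have "AE x in lborel. integrable lborel (\<lambda>t. pow01 \<eta> t * ?P t x)"
    by (rule heat_mix_L1_AE[OF w\<eta> p(2)]) simp
  then have "AE x in lborel. \<forall>A>0. heat_mix (kern01 a) f x \<le> A * c1 + c2 * A powr (1 - r) * heat_mix (pow01 \<eta>) (\<lambda>x. f x powr p) x"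
  proof eventually_elim
    case (elim x)
    show ?case
    proof (intro allI impI)
      fix A :: real assume A: "A > 0"
      have iR: "integrable lborel (\<lambda>t. A * C * pow01 \<beta> t + c2 * A powr (1 - r) * (pow01 \<eta> t * ?P t x))"
        using elim weightD(1)[OF wb] by auto
      have le: "kern01 a t * heat_conv t f x \<le> A * C * pow01 \<beta> t + c2 * A powr (1 - r) * (pow01 \<eta> t * ?P t x)" for t
      proof (cases "t \<in> {0<..<1}")
        case True
        then have t: "t > 0" by simp
        \<comment> \<open>Against the kernel of order t^(a/2-1) this level leaves t^(\<beta>-1), so
          the sub-level part integrates to a multiple of \<open>A\<close>.\<close>
        define s where "s = A * t powr (\<beta> - a/2)"
        have s: "s > 0" using A t by (simp add: s_def)
        have Z: "0 \<le> ?P t x" by (rule heat_conv_nonneg) simp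
        have "heat_conv t f x \<le> s + 2 powr p * s powr (1 - p) * (B * t powr (- b) / s) powr (r - p) * ?P t x"
        proof (rule two_regimes[OF s _ Z])
          show "heat_conv t f x \<le> B * t powr (- b)" unfolding B_def b_def by (rule heat_conv_sup[OF f p t])
          show "heat_conv t f x \<le> s / 2 + (s / 2) powr (1 - p) * ?P t x"
            by (rule heat_conv_split[OF f p t]) (use s in simp)
        qed (use r in simp)
        also have "2 powr p * s powr (1 - p) * (B * t powr (- b) / s) powr (r - p) =
            2 powr p * B powr (r - p) * A powr (1 - r) * t powr ((\<beta> - a/2) * (1 - r) - b * (r - p))"
        proof -
          have "(B * t powr (- b) / s) powr (r - p) = B powr (r - p) * t powr (- b * (r - p)) * s powr (p - r)"
          proof -
            have "s powr (p - r) = inverse (s powr (r - p))" using powr_minus[of s "r - p"] by simp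
            moreover have "(t powr (- b)) powr (r - p) = t powr (- b * (r - p))" by (rule powr_powr)
            moreover have "(B * t powr (- b) / s) powr (r - p) = B powr (r - p) * (t powr (- b)) powr (r - p) / s powr (r - p)"
              using B t s by (simp add: powr_divide powr_mult)
            ultimately show ?thesis by (simp only: divide_inverse)
          qed
          then have "2 powr p * s powr (1 - p) * (B * t powr (- b) / s) powr (r - p) =
            2 powr p * B powr (r - p) * t powr (- b * (r - p)) * (s powr (1 - p) * s powr (p - r))" by simp
          also have "s powr (1 - p) * s powr (p - r) = s powr (1 - r)" by (simp add: powr_add[symmetric])
          also have "s powr (1 - r) = A powr (1 - r) * t powr ((\<beta> - a/2) * (1 - r))"
            using A t by (simp add: s_def powr_mult powr_powr)
          also have "2 powr p * B powr (r - p) * t powr (- b * (r - p)) * (A powr (1 - r) * t powr ((\<beta> - a/2) * (1 - r))) =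
            2 powr p * B powr (r - p) * A powr (1 - r) * (t powr ((\<beta> - a/2) * (1 - r)) * t powr (- b * (r - p)))" by simp
          also have "t powr ((\<beta> - a/2) * (1 - r)) * t powr (- b * (r - p)) = t powr ((\<beta> - a/2) * (1 - r) - b * (r - p))"
            by (simp add: powr_add[symmetric])
          finally show ?thesis .
        qed
        finally have "C * t powr (a/2 - 1) * heat_conv t f x \<le> C * t powr (a/2 - 1) *
           (s + 2 powr p * B powr (r - p) * A powr (1 - r) * t powr ((\<beta> - a/2) * (1 - r) - b * (r - p)) * ?P t x)"
          using C by (intro mult_left_mono) auto
        also have "\<dots> = A * C * (t powr (a/2 - 1) * t powr (\<beta> - a/2)) +
            c2 * A powr (1 - r) * ((t powr (a/2 - 1) * t powr ((\<beta> - a/2) * (1 - r) - b * (r - p))) * ?P t x)"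
          unfolding s_def c2_def by (simp add: algebra_simps)
        also have "t powr (a/2 - 1) * t powr (\<beta> - a/2) = t powr (\<beta> - 1)" by (simp add: powr_add[symmetric])
        also have "t powr (a/2 - 1) * t powr ((\<beta> - a/2) * (1 - r) - b * (r - p)) = t powr (\<eta> - 1)"
        proof -
          have "(a/2 - 1) + ((\<beta> - a/2) * (1 - r) - b * (r - p)) = \<eta> - 1"
            unfolding \<eta>_def \<delta>_def by (simp add: field_simps)
          then show ?thesis by (simp only: powr_add[symmetric])
        qed
        finally show ?thesis using True unfolding pow01_def kern01_eq C_def[symmetric] by simp
      qed (simp add: pow01_def kern01_def)
      have "heat_mix (kern01 a) f x \<le> (LINT t|lborel. A * C * pow01 \<beta> t + c2 * A powr (1 - r) * (pow01 \<eta> t * ?P t x))"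
        unfolding heat_mix_def
      \<comment> \<open>Only the majorant has to be integrable: were the left integrand not, its
        integral would be 0, which is still below the non-negative right side.\<close>
      proof (rule integral_mono'[OF iR le])
        fix t show "0 \<le> A * C * pow01 \<beta> t + c2 * A powr (1 - r) * (pow01 \<eta> t * ?P t x)"
          by (rule order_trans[OF _ le]) (intro mult_nonneg_nonneg weightD(3)[OF weight_kern01[OF a]] heat_conv_nonneg f)
      qed
      also have "\<dots> = A * C * (LINT t|lborel. pow01 \<beta> t) + c2 * A powr (1 - r) * heat_mix (pow01 \<eta>) (\<lambda>x. f x powr p) x"
        unfolding heat_mix_def using elim weightD(1)[OF wb] by (subst Bochner_Integration.integral_add) auto
      also have "\<dots> \<le> A * c1 + c2 * A powr (1 - r) * heat_mix (pow01 \<eta>) (\<lambda>x. f x powr p) x"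
        using A unfolding c1_def by (simp add: distrib_left)
      finally show "heat_mix (kern01 a) f x \<le> A * c1 + c2 * A powr (1 - r) * heat_mix (pow01 \<eta>) (\<lambda>x. f x powr p) x" .
    qed
  qed
  with c1 c2 \<eta> show thesis by (rule that)
qed

text \<open>Where X = f^(q-1) is at most 2 M, \<open>f\<close> is bounded and its power q is
  integrable. Elsewhere the equation gives X/2 \<le> K f, a quarter of X is absorbed, and X^r is
  bounded by a multiple of the integrable \<open>?Z\<close>.\<close>

lemma bootstrap_step:
  fixes f :: "'a::euclidean_space \<Rightarrow> real"
  assumes a: "a > 0" and q: "q > 1" and f: "L1_Linf f" "\<And>x. 0 \<le> f x" "integrable lborel (\<lambda>x. f x powr q)"
    and le: "AE x in lborel. f x powr (q - 1) \<le> M + heat_mix (kern01 a) f x" and M: "M > 0"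
    and p: "p \<ge> 1" "integrable lborel (\<lambda>x. f x powr p)" and r: "r \<ge> p"
    and gain: "real DIM('a) / (2 * p) * (r - p) < a * r / 2" and qr: "q \<le> (q - 1) * r"
  shows "integrable lborel (\<lambda>x. f x powr ((q - 1) * r))"
proof -
  obtain c1 c2 \<eta> where c: "c1 > 0" "c2 \<ge> 0" "\<eta> > 0"
    and est: "AE x in lborel. \<forall>A>0. heat_mix (kern01 a) f x \<le> A * c1 + c2 * A powr (1 - r) * heat_mix (pow01 \<eta>) (\<lambda>x. f x powr p) x"
    using heat_mix_interpolation[OF a f(1,2) p r gain] .
  let ?Z = "heat_mix (pow01 \<eta>) (\<lambda>x. f x powr p)"
  have [measurable]: "f \<in> borel_measurable borel" using f(1) unfolding L1_Linf_def by simp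
  have iZ: "integrable lborel ?Z" by (rule heat_mix_L1[OF weight_pow01[OF c(3)] p(2)]) simp
  define \<mu> where "\<mu> = (2 * M) powr (1 / (q - 1))"
  define c3 where "c3 = 4 * c2 * (4 * c1) powr (r - 1)"
  have "integrable lborel (\<lambda>x. \<mu> powr ((q - 1) * r - q) * f x powr q + c3 * ?Z x)"
    using f(3) iZ by auto
  then show ?thesis
  proof (rule Bochner_Integration.integrable_bound)
    show "AE x in lborel. norm (f x powr ((q - 1) * r)) \<le> norm (\<mu> powr ((q - 1) * r - q) * f x powr q + c3 * ?Z x)"
      using est le
    proof eventually_elim
      case (elim x)
      have Z0: "0 \<le> ?Z x" unfolding heat_mix_def
        using weightD(3)[OF weight_pow01[OF c(3)]] heat_conv_nonneg[of "\<lambda>x. f x powr p"]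
        by (intro integral_nonneg_AE AE_I2) simp
      have c30: "0 \<le> c3" unfolding c3_def using c by simp
      define X where "X = f x powr (q - 1)"
      have fX: "f x powr ((q - 1) * r) = X powr r" unfolding X_def by (simp add: powr_powr)
      have "f x powr ((q - 1) * r) \<le> \<mu> powr ((q - 1) * r - q) * f x powr q + c3 * ?Z x"
      proof (cases "X \<le> 2 * M")
        case True
        have "f x = X powr (1 / (q - 1))" unfolding X_def using q f(2)[of x] by (simp add: powr_powr)
        also have "\<dots> \<le> \<mu>" unfolding \<mu>_def using True q by (intro powr_mono2) (auto simp: X_def)
        finally have "f x powr ((q - 1) * r - q) \<le> \<mu> powr ((q - 1) * r - q)"
          using f(2)[of x] qr by (intro powr_mono2) auto
        then have "f x powr ((q - 1) * r - q) * f x powr q \<le> \<mu> powr ((q - 1) * r - q) * f x powr q"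
          by (rule mult_right_mono) simp
        moreover have "f x powr ((q - 1) * r - q) * f x powr q = f x powr ((q - 1) * r)"
          by (simp add: powr_add[symmetric])
        moreover have "0 \<le> c3 * ?Z x" using c30 Z0 by simp
        ultimately show ?thesis by linarith
      next
        case False
        then have X: "X > 0" using M by simp
        \<comment> \<open>The level depends on the point: it makes the first term of the estimate
          X/4. This is why the interpolation holds, off one null set, for all \<open>A\<close>
          simultaneously.\<close>
        define A where "A = X / (4 * c1)"
        have A: "A > 0" using X c by (simp add: A_def)
        have "X / 2 \<le> heat_mix (kern01 a) f x" using elim(2) False unfolding X_def by linarith
        also have "\<dots> \<le> A * c1 + c2 * A powr (1 - r) * ?Z x" using elim(1) A by blast
        also have "A * c1 = X / 4" using c by (simp add: A_def)
        finally have "X \<le> 4 * (c2 * A powr (1 - r) * ?Z x)" by linarith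
        then have "X * A powr (r - 1) \<le> 4 * (c2 * A powr (1 - r) * ?Z x) * A powr (r - 1)"
          by (rule mult_right_mono) simp
        also have "\<dots> = 4 * c2 * ?Z x * (A powr (1 - r) * A powr (r - 1))" by simp
        also have "A powr (1 - r) * A powr (r - 1) = 1" using A by (simp add: powr_add[symmetric])
        finally have "(4 * c1) powr (r - 1) * (X * A powr (r - 1)) \<le> (4 * c1) powr (r - 1) * (4 * c2 * ?Z x)"
          by (intro mult_left_mono) auto
        moreover have "(4 * c1) powr (r - 1) * (X * A powr (r - 1)) = X powr r"
        proof -
          have "(4 * c1) powr (r - 1) * A powr (r - 1) = (4 * c1 * A) powr (r - 1)"
            using c A by (simp only: powr_mult)
          also have "4 * c1 * A = X" using c by (simp add: A_def)
          finally have "(4 * c1) powr (r - 1) * (X * A powr (r - 1)) = X powr 1 * X powr (r - 1)" using X by simp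
          also have "\<dots> = X powr r" by (simp only: powr_add[symmetric]) simp
          finally show ?thesis .
        qed
        ultimately have "X powr r \<le> c3 * ?Z x" unfolding c3_def by (simp add: ac_simps)
        moreover have "0 \<le> \<mu> powr ((q - 1) * r - q) * f x powr q" by simp
        ultimately show ?thesis unfolding fX by linarith
      qed
      then show ?case by simp
    qed
  qed measurable
qed

lemma bootstrap:
  fixes f :: "'a::euclidean_space \<Rightarrow> real"
  assumes a: "a > 0" and q: "q > 2 * real DIM('a) / (real DIM('a) + a)" "q > 1"
    and f: "L1_Linf f" "\<And>x. 0 \<le> f x" "integrable lborel (\<lambda>x. f x powr q)"
    and le: "AE x in lborel. f x powr (q - 1) \<le> M + heat_mix (kern01 a) f x" and M: "M > 0"
  obtains p where "p \<ge> 1" "real DIM('a) / p < a" "integrable lborel (\<lambda>x. f x powr p)"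
proof -
  define d where "d = real DIM('a)"
  have d: "d > 0" by (simp add: d_def)
  \<comment> \<open>\<open>k < a / d\<close> makes the step admissible, \<open>k > 2 / q - 1\<close> makes the exponent grow by the factor \<open>\<theta> > 1\<close>.\<close>
  have "max 0 (2 / q - 1) < min (a / d) (1 / q)"
  proof -
    \<comment> \<open>The hypothesis on q, rearranged, says 2/q - 1 < a/d, and q > 1 says 2/q - 1 <
      1/q; hence there is room for \<open>k\<close>.\<close>
    have "2 * d < q * (d + a)" using q(1) a d unfolding d_def[symmetric] by (simp add: field_simps)
    then have "2 / q - 1 < a / d" using q d by (simp add: field_simps)
    moreover have "2 / q - 1 < 1 / q" using q by (simp add: field_simps)
    ultimately show ?thesis using a d q by simp
  qed
  then obtain k where "max 0 (2 / q - 1) < k" "k < min (a / d) (1 / q)" using dense by blast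
  then have k: "0 < k" "2 / q - 1 < k" "k < a / d" "k < 1 / q" by simp_all
  have kq: "k * q < 1" "2 - q < k * q" using k(2,4) q by (simp_all add: field_simps)
  define \<theta> where "\<theta> = (q - 1) / (1 - k * q)"
  have \<theta>: "\<theta> > 1" using kq by (simp add: \<theta>_def)
  have iter: "integrable lborel (\<lambda>x. f x powr (q * \<theta> ^ n))" for n
  proof (induction n)
    case 0
    then show ?case using f by simp
  next
    case (Suc n)
    define p where "p = q * \<theta> ^ n"
    have "1 \<le> \<theta> ^ n" using \<theta> by simp
    then have pq: "p \<ge> q" unfolding p_def using q by simp
    then have p: "p > 0" "p \<ge> 1" using q by auto
    \<comment> \<open>A fixed ratio r/p turns the condition \<open>gain\<close> into d k q / p < a,
      which follows from k < a/d because p \<ge> q. The new exponent (q - 1) r is then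
      \<open>p * \<theta>\<close>.\<close>
    define r where "r = p / (1 - k * q)"
    have r0: "r > 0" using p kq by (simp add: r_def)
    have rp: "r - p = r * (k * q)" using kq unfolding r_def by (simp add: field_simps)
    have "0 \<le> r * (k * q)" using r0 k(1) q(2) by simp
    then have rge: "r \<ge> p" using rp by linarith
    have qr: "(q - 1) * r = p * \<theta>" unfolding r_def \<theta>_def by simp
    have "integrable lborel (\<lambda>x. f x powr ((q - 1) * r))"
    proof (rule bootstrap_step[OF a q(2) f le M p(2) _ rge])
      show "integrable lborel (\<lambda>x. f x powr p)" using Suc unfolding p_def .
      have "k * (q / p) \<le> k * 1" using k pq p by (intro mult_left_mono) auto
      then have "d * (k * (q / p)) \<le> d * k" using d by (intro mult_left_mono) auto
      also have "d * k < a" using k(3) d by (simp add: field_simps)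
      finally have "r * (d * (k * (q / p))) < r * a" using r0 by (intro mult_strict_left_mono)
      then show "real DIM('a) / (2 * p) * (r - p) < a * r / 2"
        unfolding rp d_def[symmetric] using p by (simp add: field_simps)
      have "p * 1 \<le> p * \<theta>" using p \<theta> by (intro mult_left_mono) auto
      then show "q \<le> (q - 1) * r" unfolding qr using pq by simp
    qed
    then show ?case unfolding qr p_def by (simp add: mult.assoc mult.commute[of \<theta>])
  qed
  obtain n where n: "d / a < \<theta> ^ n" using real_arch_pow[OF \<theta>] by blast
  show thesis
  proof (rule that[OF _ _ iter[of n]])
    have "1 \<le> \<theta> ^ n" using \<theta> by simp
    then have "1 * \<theta> ^ n \<le> q * \<theta> ^ n" using q by (intro mult_right_mono) auto
    then have "1 \<le> q * \<theta> ^ n" "d / a < q * \<theta> ^ n" using \<open>1 \<le> \<theta> ^ n\<close> n by linarith+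
    then show "1 \<le> q * \<theta> ^ n" "real DIM('a) / (q * \<theta> ^ n) < a"
      unfolding d_def[symmetric] using a by (simp_all add: field_simps)
  qed
qed

text \<open>Each heat average is continuous, and \<open>heat_conv_sup\<close> bounds them by
  t^(-d/(2p)) uniformly in space. The condition d/p < a makes this integrable against t^(a/2-1), so
  dominated convergence applies.\<close>

lemma heat_mix_continuous:
  fixes F :: "'a::euclidean_space \<Rightarrow> real"
  assumes a: "a > 0" and F: "L1_Linf F" and p: "p \<ge> 1" "real DIM('a) / p < a" "integrable lborel (\<lambda>x. \<bar>F x\<bar> powr p)"
  shows "continuous_on UNIV (heat_mix (kern01 a) F)"
proof (rule continuous_on_sequentiallyI)
  fix u :: "nat \<Rightarrow> 'a" and x assume lim: "u \<longlonglongrightarrow> x"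
  define C where "C = pi powr (a/2) * (2 * pi) powr (- a) / Gamma (a/2)"
  define B where "B = 1 + (LINT x|lborel. \<bar>F x\<bar> powr p)"
  define b where "b = real DIM('a) / (2 * p)"
  have b: "a/2 - b > 0" using p unfolding b_def by (simp add: field_simps)
  have \<kappa>: "weight (kern01 a)" by (rule weight_kern01[OF a])
  note [measurable] = weightD(2)[OF \<kappa>]
  have [measurable]: "F \<in> borel_measurable borel" using F unfolding L1_Linf_def by simp
  have bd: "\<bar>kern01 a t * heat_conv t F y\<bar> \<le> C * B * pow01 (a/2 - b) t" for t y
  proof (cases "t \<in> {0<..<1}")
    case True
    then have t: "t > 0" by simp
    have C: "C \<ge> 0" using a unfolding C_def by (auto intro!: divide_nonneg_nonneg Gamma_real_nonneg)
    have "\<bar>heat_conv t F y\<bar> \<le> heat_conv t (\<lambda>x. \<bar>F x\<bar>) y" by (rule heat_conv_abs_le[OF t F])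
    also have "\<dots> \<le> B * t powr (- b)" unfolding B_def b_def
      by (rule heat_conv_sup[OF L1_Linf_abs[OF F] _ p(1) p(3) t]) simp
    finally have "C * t powr (a/2 - 1) * \<bar>heat_conv t F y\<bar> \<le> C * t powr (a/2 - 1) * (B * t powr (- b))"
      using C by (intro mult_left_mono) auto
    also have "\<dots> = C * B * (t powr (a/2 - 1) * t powr (- b))" by simp
    also have "t powr (a/2 - 1) * t powr (- b) = t powr (a/2 - b - 1)" by (simp add: powr_add[symmetric] algebra_simps)
    finally show ?thesis using True C unfolding kern01_eq C_def[symmetric] pow01_def by (simp add: abs_mult)
  qed (simp add: kern01_def pow01_def)
  show "(\<lambda>n. heat_mix (kern01 a) F (u n)) \<longlonglongrightarrow> heat_mix (kern01 a) F x"
    unfolding heat_mix_def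
  proof (rule integral_dominated_convergence[where w="\<lambda>t. C * B * pow01 (a/2 - b) t"])
    show "integrable lborel (\<lambda>t. C * B * pow01 (a/2 - b) t)" using weightD(1)[OF weight_pow01[OF b]] by simp
    show "AE t in lborel. (\<lambda>n. kern01 a t * heat_conv t F (u n)) \<longlonglongrightarrow> kern01 a t * heat_conv t F x"
    proof (rule AE_I2, goal_cases)
      case (1 t)
      show ?case
      proof (cases "t > 0")
        case True
        have "isCont (heat_conv t F) x" using heat_conv_continuous[OF F True] by (simp add: continuous_on_eq_continuous_at)
        then show ?thesis using lim by (intro tendsto_mult tendsto_const) (rule isCont_tendsto_compose)
      qed (simp add: kern01_def)
    qed
    show "AE t in lborel. norm (kern01 a t * heat_conv t F (u n)) \<le> C * B * pow01 (a/2 - b) t" for n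
      using bd by (intro AE_I2) simp
  qed measurable
qed

theorem minimizer_continuous:
  fixes V \<rho> :: "'a::euclidean_space \<Rightarrow> real"
  assumes a: "0 < a" "a < real DIM('a)" and q: "q > 2 * real DIM('a) / (real DIM('a) + a)"
    and min: "is_minimizer q a V \<rho>" and V: "V \<in> Hpos a" "V \<in> Cb"
  shows "\<exists>f. continuous_on UNIV f \<and> (AE x in lborel. \<rho> x = f x)"
proof -
  \<comment> \<open>Since a < d, the lower bound on q already exceeds 1.\<close>
  have "1 < 2 * real DIM('a) / (real DIM('a) + a)" using a by (simp add: field_simps)
  with q have q1: "q > 1" by linarith
  have \<rho>: "\<rho> \<in> Lq q" using min unfolding is_minimizer_def H_alpha_def by auto
  then have [measurable]: "\<rho> \<in> borel_measurable borel" unfolding Lq_def by simp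
  have i\<rho>: "integrable lborel (\<lambda>x. \<bar>\<rho> x\<bar> powr q)" using \<rho> unfolding Lq_def by simp
  have L\<rho>: "L1_Linf \<rho>"
    by (rule L1_Linf_from_abs) (use Lq_L1_Linf[OF \<rho>, of 1] q1 in auto)
  obtain G where G: "continuous_on UNIV G" "bounded (range G)"
    and eq: "AE x in lborel. spow (q - 1) (\<rho> x) = G x - heat_mix (kern01 a) \<rho> x"
    using euler_lagrange_AE[OF a q1 min V] by blast
  obtain B where B0: "\<And>x. \<bar>G x\<bar> \<le> B" using G(2) unfolding bounded_iff by auto
  \<comment> \<open>Adding 1 makes the constant strictly positive, as the bootstrap
    requires.\<close>
  have B: "\<bar>G x\<bar> \<le> \<bar>B\<bar> + 1" for x using B0[of x] by linarith
  have \<kappa>: "weight (kern01 a)" by (rule weight_kern01[OF a(1)])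
  let ?f = "\<lambda>x. \<bar>\<rho> x\<bar>"
  \<comment> \<open>The comparison of K applied to \<open>\<rho>\<close> with K applied to |\<rho>|
    needs the averages of |\<rho>| to be integrable in time, or else its right side would be 0 by
    convention. The majorant ensures this almost everywhere.\<close>
  obtain f M where F': "\<rho> \<in> borel_measurable borel" "f \<in> borel_measurable borel" "integrable lborel f"
    "0 \<le> M" "\<And>x. 0 \<le> f x" "\<And>x. \<bar>\<rho> x\<bar> \<le> f x + M"
    using L\<rho> by (rule L1_LinfE) (rule that)
  have "AE x in lborel. \<bar>\<rho> x\<bar> powr (q - 1) \<le> (\<bar>B\<bar> + 1) + heat_mix (kern01 a) ?f x"
    using eq heat_mix_L1_AE[OF \<kappa> F'(3,5)]
  proof eventually_elim
    case (elim x)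
    have i: "integrable lborel (\<lambda>t. kern01 a t * heat_conv t ?f x)"
      by (rule heat_mix_bound(1)[OF \<kappa> _ F'(3) _ F'(5) elim(2)]) (use F'(6) in auto)
    have "\<bar>heat_mix (kern01 a) \<rho> x\<bar> \<le> (LINT t|lborel. \<bar>kern01 a t * heat_conv t \<rho> x\<bar>)"
      unfolding heat_mix_def by (rule integral_abs_bound)
    also have "\<dots> \<le> heat_mix (kern01 a) ?f x"
      unfolding heat_mix_def
    proof (rule integral_mono'[OF i])
      fix t
      show "\<bar>kern01 a t * heat_conv t \<rho> x\<bar> \<le> kern01 a t * heat_conv t ?f x"
      proof (cases "t > 0")
        case True
        show ?thesis using mult_left_mono[OF heat_conv_abs_le[OF True L\<rho>, of x] weightD(3)[OF \<kappa>, of t]] weightD(3)[OF \<kappa>, of t]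
          by (simp add: abs_mult)
      qed (simp add: kern01_def)
      show "0 \<le> kern01 a t * heat_conv t ?f x"
        by (intro mult_nonneg_nonneg weightD(3)[OF \<kappa>] heat_conv_nonneg) simp
    qed
    finally have "\<bar>heat_mix (kern01 a) \<rho> x\<bar> \<le> heat_mix (kern01 a) ?f x" .
    moreover have "\<bar>\<rho> x\<bar> powr (q - 1) = \<bar>G x - heat_mix (kern01 a) \<rho> x\<bar>" using elim(1) abs_spow by metis
    ultimately show ?case using B[of x] by linarith
  qed
  then obtain p where p: "p \<ge> 1" "real DIM('a) / p < a" "integrable lborel (\<lambda>x. \<bar>\<rho> x\<bar> powr p)"
    by (rule bootstrap[OF a(1) q q1 L1_Linf_abs[OF L\<rho>] abs_ge_zero i\<rho>]) auto
  define W where "W x = G x - heat_mix (kern01 a) \<rho> x" for x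
  have cW: "continuous_on UNIV W"
    unfolding W_def[abs_def] by (intro continuous_intros G heat_mix_continuous[OF a(1) L\<rho> p])
  have "continuous_on UNIV (spow (1 / (q - 1)))"
    using q1 by (intro continuous_at_imp_continuous_on ballI isCont_spow) simp
  \<comment> \<open>\<open>W\<close> is continuous everywhere and equals the signed power of
    \<open>\<rho>\<close> almost everywhere, so undoing the power gives the continuous
    representative.\<close>
  then have "continuous_on UNIV (\<lambda>x. spow (1 / (q - 1)) (W x))"
    by (rule continuous_on_compose2[OF _ cW subset_UNIV])
  moreover have "AE x in lborel. \<rho> x = spow (1 / (q - 1)) (W x)"
    using eq
  proof eventually_elim
    case (elim x)
    show ?case using spow_inverse[of "q - 1" "\<rho> x"] q1 unfolding W_def elim[symmetric] by simp
  qed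
  ultimately show ?thesis by blast
qed

theorem mainTheorem2:
  fixes \<alpha> q :: real and V \<rho> :: "real ^ 'n \<Rightarrow> real"
  assumes "CARD('n) \<ge> 2"
    and "0 < \<alpha>" and "\<alpha> < real CARD('n)"
    and "q > 2 * real CARD('n) / (real CARD('n) + \<alpha>)"
    and "V \<in> Hpos \<alpha>" and "V \<in> Cb"
    and "is_minimizer q \<alpha> V \<rho>"
  shows "\<exists>f. continuous_on UNIV f \<and> (AE x in lborel. \<rho> x = f x)"
proof (rule minimizer_continuous[OF assms(2) _ _ assms(7) assms(5,6)])
  show "\<alpha> < real DIM(real ^ 'n)" "q > 2 * real DIM(real ^ 'n) / (real DIM(real ^ 'n) + \<alpha>)"
    using assms(3,4) by simp_all
qed

end
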